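(* Let $\hbar$ be real and an allowed value, i.e. $\hbar\in\mathbb{R}$ and $2\hbar\notin\{0,-1,-\tfrac12,-\tfrac13,\dots\}$. (i) The complex conjugation extends to a continuous $^*$-involution of $\widehat{\mathcal{A}}_\hbar(C_{n+1}^+)$, and for all $0<\epsilon<1$ and $a\in\widehat{\mathcal{A}}_\hbar(C_{n+1}^+)$ we have $\|\overline{a}\|_\epsilon=\|a\|_\epsilon$. (ii) The ideal $\mathcal{J}_{y=1}\subseteq\widehat{\mathcal{A}}_\hbar(C_{n+1}^+)$ is a $^*$-ideal. (iii) The induced continuous $^*$-involution on $\widehat{\mathcal{A}}_\hbar(\mathbb{D}_n)=\widehat{\mathcal{A}}_\hbar(C_{n+1}^+)/\mathcal{J}_{y=1}$ is the pointwise complex conjugation once we identify elements of $\widehat{\mathcal{A}}_\hbar(\mathbb{D}_n)$ with functions on $\mathbb{D}_n$. For all $0<\epsilon<1$ and $[a]\in\widehat{\mathcal{A}}_\hbar(\mathbb{D}_n)$ we have $\|\overline{[a]}\|_\epsilon=\|[a]\|_\epsilon$.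
   Context: Fix $n\ge1$. On $\mathbb{C}^{n+1}$ with coordinates $z^0,\dots,z^n$ let $\mathsf{g}=\mathrm{diag}(-1,1,\dots,1)$, $y(z)=|z^0|^2-|z^1|^2-\dots-|z^n|^2$, $C_{n+1}^+=\{z: y(z)>0\}$, $\mathbb{D}_n=\{v\in\mathbb{C}^n:|v|^2<1\}$, and $\pi\colon C_{n+1}^+\to\mathbb{D}_n$, $\pi(z)=(z^1/z^0,\dots,z^n/z^0)$. An index triple is $(P,Q,\alpha)$ with $P,Q\in\mathbb{N}_0^n$, $\alpha\in\mathbb{N}_0$, $|P|,|Q|\le\alpha$. Put $\mathsf{e}_{P,Q,\alpha}(z)=(z^0)^{\alpha-|P|}z^P(\bar z^0)^{\alpha-|Q|}\bar z^Q$ where $z^P=(z^1)^{P_1}\cdots(z^n)^{P_n}$; these form a basis of the $\mathrm{U}(1)$-invariant polynomials in $z,\bar z$. For $\hbar\ne0$ the Wick product of polynomials is $f\star g=\sum_{r\ge0}\frac{(2\hbar)^r}{r!}\sum_{i_1,\dots,i_r,j_1,\dots,j_r=0}^n\mathsf{g}^{i_1j_1}\cdots\mathsf{g}^{i_rj_r}\frac{\partial^rf}{\partial z^{i_1}\cdots\partial z^{i_r}}\frac{\partial^rg}{\partial\bar z^{j_1}\cdots\partial\bar z^{j_r}}$; it preserves $\mathrm{U}(1)$-invariant polynomials. With $(x)_r=x(x+1)\cdots(x+r-1)$, let $S$ be the (injective) linear map from $\mathrm{U}(1)$-invariant polynomials to $C^\infty(C_{n+1}^+)$ with $S\mathsf{e}_{P,Q,\alpha}=(2\hbar)^\alpha\big(\tfrac{y}{2\hbar}\big)_\alpha\frac{\mathsf{e}_{P,Q,\alpha}}{y^\alpha}$,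 and $\mathsf{f}_{P,Q,\alpha}=\frac{1}{P!(\alpha-|P|)!Q!(\alpha-|Q|)!}\big(\frac{y}{2\hbar}\big)_\alpha\frac{\mathsf{e}_{P,Q,\alpha}}{y^\alpha}$. $\mathcal{A}_\hbar(C_{n+1}^+)$ is the span of the (linearly independent) $\mathsf{f}_{P,Q,\alpha}$, with product $a\,\tilde\star\,b=S(S^{-1}a\star S^{-1}b)$. $\mathcal{A}_\hbar(C_{n+1}^+)$ carries the locally convex topology of the seminorms $\|a\|_\epsilon=\sup_{(P,Q,\alpha)}|a_{P,Q,\alpha}|/(\alpha!)^\epsilon$, $0<\epsilon<1$, for $a=\sum a_{P,Q,\alpha}\mathsf{f}_{P,Q,\alpha}$. The product and all evaluations $\delta_w(a)=a(w)$, $w\in C_{n+1}^+$, are continuous, and the completion $\widehat{\mathcal{A}}_\hbar(C_{n+1}^+)$ is a Fréchet algebra of functions on $C_{n+1}^+$, consisting of all $\sum a_{P,Q,\alpha}\mathsf{f}_{P,Q,\alpha}$ for which all these seminorms are finite. For allowed $\hbar$, $\mathcal{J}_{y=1}=\bigcap_{y(w)=1}\ker\delta_w$ is a closed two-sided ideal, and $\widehat{\mathcal{A}}_\hbar(\mathbb{D}_n)=\widehat{\mathcal{A}}_\hbar(C_{n+1}^+)/\mathcal{J}_{y=1}$ with quotient topology and induced product $\star_{\mathbb{D}_n}$; its elements are functions on $\mathbb{D}_n$ via $[a](v)=a(w)$ for any $w$ with $\pi(w)=v$, $y(w)=1$. It has the Schauder basis $\mathsf{f}_{P,Q}=[\mathsf{f}_{P,Q,\max(|P|,|Q|)}]$,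 $P,Q\in\mathbb{N}_0^n$, and its topology is defined by $\|[a]\|_\epsilon=\sup_{P,Q}|a_{P,Q}|/(\max(|P|,|Q|)!)^\epsilon$, $0<\epsilon<1$, for $[a]=\sum_{P,Q}a_{P,Q}\mathsf{f}_{P,Q}$. *)

theory Defs
  imports "HOL-Analysis.Analysis" "HOL-Library.Function_Algebras"
begin

text \<open>
  The coordinates of complex (n+1)-space are indexed by the type \<open>'n option\<close>: \<open>None\<close> is the index 0
  and \<open>Some i\<close> are the indices 1, ..., n, where n is the cardinality of the finite type \<open>'n\<close>
  (hence n is at least 1).  The parameter \<open>h\<close> stands for hbar.  Functions on the open cone
  \<open>Cplus\<close> are total functions that vanish outside \<open>Cplus\<close>.
\<close>

type_synonym 'n pt = "complex ^ 'n option"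
type_synonym 'n cfn = "complex ^ 'n option \<Rightarrow> complex"
type_synonym 'n mi = "'n \<Rightarrow> nat"

definition cscale :: "complex \<Rightarrow> ('a \<Rightarrow> complex) \<Rightarrow> 'a \<Rightarrow> complex" where
  "cscale c f = (\<lambda>x. c * f x)"

global_interpretation cfun: vector_space "cscale :: complex \<Rightarrow> ('a \<Rightarrow> complex) \<Rightarrow> 'a \<Rightarrow> complex"
  by unfold_locales (auto simp: cscale_def fun_eq_iff algebra_simps)

section \<open>The geometric setting\<close>

definition gmet :: "'n option \<Rightarrow> 'n option \<Rightarrow> complex" where
  "gmet i j = (if i \<noteq> j then 0 else if i = None then - 1 else 1)"

definition ypot :: "'n::finite pt \<Rightarrow> real" where
  "ypot z = (cmod (z $ None))\<^sup>2 - (\<Sum>i\<in>UNIV. (cmod (z $ Some i))\<^sup>2)"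

definition Cplus :: "'n::finite pt set" where
  "Cplus = {z. ypot z > 0}"

definition disc :: "(complex ^ 'n::finite) set" where
  "disc = {v. (norm v)\<^sup>2 < 1}"

definition dproj :: "'n::finite pt \<Rightarrow> complex ^ 'n" where
  "dproj z = (\<chi> i. z $ Some i / z $ None)"

section \<open>Invariant polynomials and the Wick product\<close>

definition mabs :: "'n::finite mi \<Rightarrow> nat" where
  "mabs P = (\<Sum>i\<in>UNIV. P i)"

definition mfact :: "'n::finite mi \<Rightarrow> nat" where
  "mfact P = (\<Prod>i\<in>UNIV. fact (P i))"

definition triples :: "('n::finite mi \<times> 'n mi \<times> nat) set" where
  "triples = {(P, Q, \<alpha>). mabs P \<le> \<alpha> \<and> mabs Q \<le> \<alpha>}"

definition ebas :: "'n::finite mi \<times> 'n mi \<times> nat \<Rightarrow> 'n cfn" where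
  "ebas = (\<lambda>(P, Q, \<alpha>) z.
     (z $ None) ^ (\<alpha> - mabs P) * (\<Prod>i\<in>UNIV. (z $ Some i) ^ P i) *
     (cnj (z $ None)) ^ (\<alpha> - mabs Q) * (\<Prod>i\<in>UNIV. (cnj (z $ Some i)) ^ Q i))"

definition zmonom :: "'n::finite option mi \<Rightarrow> 'n option mi \<Rightarrow> 'n cfn" where
  "zmonom A B z = (\<Prod>i\<in>UNIV. (z $ i) ^ A i) * (\<Prod>i\<in>UNIV. (cnj (z $ i)) ^ B i)"

definition invpolys :: "'n::finite cfn set" where
  "invpolys = {p \<in> cfun.span {zmonom A B | A B. True}.
     \<forall>u z. cmod u = 1 \<longrightarrow> p (\<chi> i. u * z $ i) = p z}"

text \<open>Wirtinger derivatives.\<close>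

definition dz :: "'n::finite option \<Rightarrow> 'n cfn \<Rightarrow> 'n cfn" where
  "dz i f = (\<lambda>z. (frechet_derivative f (at z) (axis i 1)
                   - \<i> * frechet_derivative f (at z) (axis i \<i>)) / 2)"

definition dzbar :: "'n::finite option \<Rightarrow> 'n cfn \<Rightarrow> 'n cfn" where
  "dzbar i f = (\<lambda>z. (frechet_derivative f (at z) (axis i 1)
                      + \<i> * frechet_derivative f (at z) (axis i \<i>)) / 2)"

text \<open>For polynomials only finitely many terms of the sum over \<open>r\<close> are nonzero.\<close>

definition wick :: "complex \<Rightarrow> 'n::finite cfn \<Rightarrow> 'n cfn \<Rightarrow> 'n cfn" where
  "wick h f g = (\<lambda>z. \<Sum>r. (2 * h) ^ r / fact r *
     (\<Sum>is\<in>{is. length is = r}. \<Sum>js\<in>{js. length js = r}.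
        (\<Prod>k<r. gmet (is ! k) (js ! k)) * foldr dz is f z * foldr dzbar js g z))"

section \<open>The algebra on the cone\<close>

definition Sbas :: "complex \<Rightarrow> 'n::finite mi \<times> 'n mi \<times> nat \<Rightarrow> 'n cfn" where
  "Sbas h = (\<lambda>(P, Q, \<alpha>) z. if z \<in> Cplus
     then (2 * h) ^ \<alpha> * pochhammer (of_real (ypot z) / (2 * h)) \<alpha>
          * ebas (P, Q, \<alpha>) z / of_real (ypot z) ^ \<alpha>
     else 0)"

definition fbas :: "complex \<Rightarrow> 'n::finite mi \<times> 'n mi \<times> nat \<Rightarrow> 'n cfn" where
  "fbas h = (\<lambda>(P, Q, \<alpha>) z. if z \<in> Cplus
     then 1 / (of_nat (mfact P) * fact (\<alpha> - mabs P) * of_nat (mfact Q) * fact (\<alpha> - mabs Q))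
          * pochhammer (of_real (ypot z) / (2 * h)) \<alpha>
          * ebas (P, Q, \<alpha>) z / of_real (ypot z) ^ \<alpha>
     else 0)"

text \<open>
  The linear extension of \<open>ebas t \<mapsto> Sbas h t\<close>; the functions \<open>ebas t\<close>, for \<open>t\<close> in
  \<open>triples\<close>, form a basis of \<open>invpolys\<close>.
\<close>

definition Smap :: "complex \<Rightarrow> 'n::finite cfn \<Rightarrow> 'n cfn" where
  "Smap h p = (\<Sum>t\<in>{t \<in> triples. cfun.representation (ebas ` triples) p (ebas t) \<noteq> 0}.
     cscale (cfun.representation (ebas ` triples) p (ebas t)) (Sbas h t))"

definition alg :: "complex \<Rightarrow> 'n::finite cfn set" where
  "alg h = cfun.span (fbas h ` triples)"

definition tstar :: "complex \<Rightarrow> 'n::finite cfn \<Rightarrow> 'n cfn \<Rightarrow> 'n cfn" where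
  "tstar h a b = Smap h (wick h (the_inv_into invpolys (Smap h) a)
                                (the_inv_into invpolys (Smap h) b))"

section \<open>The completion\<close>

definition admissible :: "('n::finite mi \<times> 'n mi \<times> nat \<Rightarrow> complex) set" where
  "admissible = {c. (\<forall>t. t \<notin> triples \<longrightarrow> c t = 0) \<and>
     (\<forall>\<epsilon>::real. 0 < \<epsilon> \<and> \<epsilon> < 1 \<longrightarrow>
        bdd_above ((\<lambda>(P, Q, \<alpha>). cmod (c (P, Q, \<alpha>)) / fact \<alpha> powr \<epsilon>) ` triples))}"

definition fseries :: "complex \<Rightarrow> ('n::finite mi \<times> 'n mi \<times> nat \<Rightarrow> complex) \<Rightarrow> 'n cfn" where
  "fseries h c = (\<lambda>w. \<Sum>\<^sub>\<infinity>t\<in>triples. c t * fbas h t w)"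

definition halg :: "complex \<Rightarrow> 'n::finite cfn set" where
  "halg h = fseries h ` admissible"

definition hcoef :: "complex \<Rightarrow> 'n::finite cfn \<Rightarrow> 'n mi \<times> 'n mi \<times> nat \<Rightarrow> complex" where
  "hcoef h = the_inv_into admissible (fseries h)"

definition hnorm :: "complex \<Rightarrow> real \<Rightarrow> 'n::finite cfn \<Rightarrow> real" where
  "hnorm h \<epsilon> a = (SUP (P, Q, \<alpha>)\<in>triples. cmod (hcoef h a (P, Q, \<alpha>)) / fact \<alpha> powr \<epsilon>)"

definition htop :: "complex \<Rightarrow> 'n::finite cfn topology" where
  "htop h = topology_generated_by
     {{b \<in> halg h. hnorm h \<epsilon> (b - a) < r} | a \<epsilon> r. a \<in> halg h \<and> 0 < \<epsilon> \<and> \<epsilon> < 1 \<and> 0 < r}"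

text \<open>
  The continuous extension of the product to the completion.  On \<open>halg h \<times> halg h\<close> it is
  determined by the density of \<open>alg h\<close>; its values elsewhere are irrelevant.
\<close>

definition hstar :: "complex \<Rightarrow> 'n::finite cfn \<Rightarrow> 'n cfn \<Rightarrow> 'n cfn" where
  "hstar h = (SOME m.
     continuous_map (prod_topology (htop h) (htop h)) (htop h) (\<lambda>(a, b). m a b) \<and>
     (\<forall>a\<in>alg h. \<forall>b\<in>alg h. m a b = tstar h a b))"

section \<open>The quotient algebra of functions on the disc\<close>

definition Jideal :: "complex \<Rightarrow> 'n::finite cfn set" where
  "Jideal h = {a \<in> halg h. \<forall>w. ypot w = 1 \<longrightarrow> a w = 0}"

definition jrel :: "complex \<Rightarrow> 'n::finite cfn rel" where
  "jrel h = {(a, b). a \<in> halg h \<and> b \<in> halg h \<and> a - b \<in> Jideal h}"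

definition cls :: "complex \<Rightarrow> 'n::finite cfn \<Rightarrow> 'n cfn set" where
  "cls h a = jrel h `` {a}"

definition qalg :: "complex \<Rightarrow> 'n::finite cfn set set" where
  "qalg h = halg h // jrel h"

definition qadd :: "complex \<Rightarrow> 'n::finite cfn set \<Rightarrow> 'n cfn set \<Rightarrow> 'n cfn set" where
  "qadd h X Y = (\<Union>a\<in>X. \<Union>b\<in>Y. cls h (a + b))"

definition qscale :: "complex \<Rightarrow> complex \<Rightarrow> 'n::finite cfn set \<Rightarrow> 'n cfn set" where
  "qscale h c X = (\<Union>a\<in>X. cls h (cscale c a))"

definition qstar :: "complex \<Rightarrow> 'n::finite cfn set \<Rightarrow> 'n cfn set \<Rightarrow> 'n cfn set" where
  "qstar h X Y = (\<Union>a\<in>X. \<Union>b\<in>Y. cls h (hstar h a b))"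

definition quotient_topology :: "'a topology \<Rightarrow> ('a \<Rightarrow> 'b) \<Rightarrow> 'b topology" where
  "quotient_topology T q =
     topology (\<lambda>U. U \<subseteq> q ` topspace T \<and> openin T {x \<in> topspace T. q x \<in> U})"

lemma openin_quotient_topology:
  "openin (quotient_topology T q) U \<longleftrightarrow>
     U \<subseteq> q ` topspace T \<and> openin T {x \<in> topspace T. q x \<in> U}"
proof -
  have "istopology (\<lambda>U. U \<subseteq> q ` topspace T \<and> openin T {x \<in> topspace T. q x \<in> U})"
    unfolding istopology_def
  proof (intro conjI allI impI; (elim conjE)?)
    fix U V
    assume "openin T {x \<in> topspace T. q x \<in> U}" "openin T {x \<in> topspace T. q x \<in> V}"
    then have "openin T ({x \<in> topspace T. q x \<in> U} \<inter> {x \<in> topspace T. q x \<in> V})"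
      by (rule openin_Int)
    moreover have "{x \<in> topspace T. q x \<in> U} \<inter> {x \<in> topspace T. q x \<in> V}
                   = {x \<in> topspace T. q x \<in> U \<inter> V}" by auto
    ultimately show "openin T {x \<in> topspace T. q x \<in> U \<inter> V}" by simp
  next
    fix \<K>
    assume "\<forall>K\<in>\<K>. K \<subseteq> q ` topspace T \<and> openin T {x \<in> topspace T. q x \<in> K}"
    then have "openin T (\<Union>K\<in>\<K>. {x \<in> topspace T. q x \<in> K})" by blast
    moreover have "(\<Union>K\<in>\<K>. {x \<in> topspace T. q x \<in> K}) = {x \<in> topspace T. q x \<in> \<Union>\<K>}" by auto
    ultimately show "openin T {x \<in> topspace T. q x \<in> \<Union>\<K>}" by simp
  qed auto
  then show ?thesis by (simp add: quotient_topology_def)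
qed

definition qtop :: "complex \<Rightarrow> 'n::finite cfn set topology" where
  "qtop h = quotient_topology (htop h) (cls h)"

definition qeval :: "'n::finite cfn set \<Rightarrow> complex ^ 'n \<Rightarrow> complex" where
  "qeval X v = (THE c. \<forall>a\<in>X. \<forall>w. dproj w = v \<and> ypot w = 1 \<longrightarrow> a w = c)"

text \<open>
  The coordinates of a class with respect to the Schauder basis of the classes of
  \<open>fbas h (P, Q, max (mabs P) (mabs Q))\<close>; the expansion converges (unconditionally) in \<open>qtop h\<close>.
\<close>

definition qcoef :: "complex \<Rightarrow> 'n::finite cfn set \<Rightarrow> 'n mi \<times> 'n mi \<Rightarrow> complex" where
  "qcoef h X = (THE c. limitin (qtop h)
     (\<lambda>F. cls h (\<Sum>(P, Q)\<in>F. cscale (c (P, Q)) (fbas h (P, Q, max (mabs P) (mabs Q)))))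
     X (finite_subsets_at_top UNIV))"

definition qnorm :: "complex \<Rightarrow> real \<Rightarrow> 'n::finite cfn set \<Rightarrow> real" where
  "qnorm h \<epsilon> X = (SUP (P, Q). cmod (qcoef h X (P, Q)) / fact (max (mabs P) (mabs Q)) powr \<epsilon>)"

section \<open>Involutions and ideals\<close>

definition star_involution ::
  "'a set \<Rightarrow> ('a \<Rightarrow> 'a \<Rightarrow> 'a) \<Rightarrow> (complex \<Rightarrow> 'a \<Rightarrow> 'a) \<Rightarrow> ('a \<Rightarrow> 'a \<Rightarrow> 'a) \<Rightarrow> ('a \<Rightarrow> 'a) \<Rightarrow> bool" where
  "star_involution V ad sc pr \<sigma> \<longleftrightarrow>
     (\<forall>a\<in>V. \<sigma> a \<in> V \<and> \<sigma> (\<sigma> a) = a) \<and>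
     (\<forall>a\<in>V. \<forall>b\<in>V. \<sigma> (ad a b) = ad (\<sigma> a) (\<sigma> b)) \<and>
     (\<forall>c. \<forall>a\<in>V. \<sigma> (sc c a) = sc (cnj c) (\<sigma> a)) \<and>
     (\<forall>a\<in>V. \<forall>b\<in>V. \<sigma> (pr a b) = pr (\<sigma> b) (\<sigma> a))"

definition star_ideal ::
  "('a \<Rightarrow> complex) set \<Rightarrow> (('a \<Rightarrow> complex) \<Rightarrow> ('a \<Rightarrow> complex) \<Rightarrow> 'a \<Rightarrow> complex) \<Rightarrow>
   (('a \<Rightarrow> complex) \<Rightarrow> 'a \<Rightarrow> complex) \<Rightarrow> ('a \<Rightarrow> complex) set \<Rightarrow> bool" where
  "star_ideal V pr \<sigma> I \<longleftrightarrow>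
     I \<subseteq> V \<and> cfun.subspace I \<and>
     (\<forall>a\<in>I. \<forall>b\<in>V. pr a b \<in> I \<and> pr b a \<in> I) \<and>
     (\<forall>a\<in>I. \<sigma> a \<in> I)"

end

theory Submission
  imports Defs "HOL-Complex_Analysis.Complex_Analysis"
begin

text \<open>
  A triple \<open>(P, Q, \<alpha>)\<close> is the same as a pair \<open>(A, B)\<close> of multi-indices on the coordinates \<open>0, \<dots>, n\<close>
  with \<open>\<bar>A\<bar> = \<bar>B\<bar> = \<alpha>\<close>, the exponents of the monomial \<open>z\<^sup>A cnj z\<^sup>B\<close>.  In these indices the product of
  two basis functions is a finite sum over the contracted multi-indices \<open>K\<close>,

  \<open>f\<^sub>(\<^sub>A\<^sub>,\<^sub>B\<^sub>) * f\<^sub>(\<^sub>C\<^sub>,\<^sub>D\<^sub>) = \<Sum>K. c(A, B, C, D, K) f\<^sub>(\<^sub>A\<^sub>-\<^sub>K\<^sub>+\<^sub>C\<^sub>,\<^sub>B\<^sub>+\<^sub>D\<^sub>-\<^sub>K\<^sub>)\<close>,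

  whose coefficients are real and do not involve \<open>h\<close>, because the powers of \<open>2 h\<close> from the contraction
  cancel those from the normalisation (\<open>tstar_fpair\<close>).  They and the number of terms grow at most
  geometrically in the degree, and every geometric growth is absorbed by an arbitrarily small power
  of the factorial.  So the formula extends to all coefficient families of the completion
  (\<open>cprod\<close>), the extension is continuous, and by density and the Hausdorff property it is the
  product \<open>hstar\<close> (\<open>hstar_series\<close>).

  For real \<open>h\<close> the complex conjugate of \<open>f\<^sub>(\<^sub>A\<^sub>,\<^sub>B\<^sub>)\<close> is \<open>f\<^sub>(\<^sub>B\<^sub>,\<^sub>A\<^sub>)\<close>, so conjugation swaps the two
  multi-indices of a coefficient family and conjugates the coefficients.  This visibly preserves the
  seminorms, and it reverses products since the coefficients \<open>c\<close> are symmetric under swapping and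
  exchanging the factors (\<open>cprod_cconj\<close>).  Coefficients are determined by the function
  (\<open>pairing_fpair_injective\<close>): on the ray through a point with \<open>y = 1\<close> the degree \<open>\<alpha>\<close> enters only
  through \<open>pochhammer (y / (2 h)) \<alpha>\<close>, the series is entire in \<open>y\<close>, and at \<open>y / (2 h) = - N\<close> it becomes
  a finite triangular sum.

  The vanishing ideal is plainly closed under conjugation.  That it is a right ideal follows from a
  description by functionals: pointwise multiplication by \<open>y\<close> is a finite recursion on the basis, and
  functionals on which \<open>y\<close> acts as \<open>1\<close> are called \<open>level\<close>.  Using
  \<open>\<bar>z\<^sub>0\<bar>\<^sup>2 = y + \<bar>z\<^sub>1\<bar>\<^sup>2 + \<dots> + \<bar>z\<^sub>n\<bar>\<^sup>2\<close> to eliminate \<open>\<bar>z\<^sub>0\<bar>\<^sup>2\<close>, one gets an explicit operator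
  \<open>reduce\<close> into the reduced families, those supported on monomials without a factor \<open>\<bar>z\<^sub>0\<bar>\<^sup>2\<close>, that no
  level functional notices (\<open>has_sum_reduce\<close>); it needs \<open>h\<close> to be allowed, since it divides by
  \<open>pochhammer (1 / (2 h))\<close>.  Reduced families are determined by their values on \<open>y = 1\<close>
  (\<open>hyperboloid_independence\<close>), so a function in the ideal reduces to \<open>0\<close> and all level functionals
  vanish on it.  For a point \<open>w\<close> with \<open>y w = 1\<close> the functional \<open>a \<mapsto> (a * f\<^sub>t) w\<close> is level
  (\<open>level_pair_mult\<close>), whence \<open>a * b\<close> vanishes at \<open>w\<close> for every \<open>b\<close>.  Conjugation turns the right ideal
  into a two-sided one.

  On the quotient everything descends.  The reduced indices are those of the Schauder basis, so the
  Schauder coefficients of a class are the coefficients of its reduction (\<open>qcoef_cls\<close>).  Reduction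
  commutes with conjugation by uniqueness, and the quotient norms are invariant because swapping
  \<open>(P, Q)\<close> does not change \<open>max \<bar>P\<bar> \<bar>Q\<bar>\<close>.
\<close>

section \<open>Independence of monomials under infinite sums\<close>

text \<open>
  Fourier and Mellin type averaging, in a form without integrals: the zero sums of \<open>f m\<close>, for
  bounded multipliers \<open>m\<close> that are \<open>1\<close> on \<open>Y\<close> and small on any prescribed finite set outside \<open>Y\<close>,
  converge by dominated convergence to the sum of \<open>f\<close> over \<open>Y\<close>.
\<close>

lemma infsum_multiplier_limit:
  fixes f :: "'x \<Rightarrow> complex"
  assumes f: "f summable_on X" and Y: "Y \<subseteq> X"
    and mult: "\<And>F e. finite F \<Longrightarrow> F \<subseteq> X \<Longrightarrow> 0 < e \<Longrightarrow>
      \<exists>m. (\<forall>x\<in>X. cmod (m x) \<le> 1) \<and> (\<forall>x\<in>Y. m x = 1) \<and> (\<forall>x\<in>F - Y. cmod (m x) \<le> e) \<and>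
          ((\<lambda>x. f x * m x) has_sum 0) X"
  shows "(f has_sum 0) Y"
proof -
  have sY: "f summable_on Y" by (rule summable_on_subset_banach[OF f Y])
  have nX: "(\<lambda>x. norm (f x)) summable_on X"
    using f by (simp only: summable_on_iff_abs_summable_on_complex)
  have "cmod (infsum f Y) \<le> e" if e: "e > 0" for e :: real
  proof -
    define T where "T = infsum (\<lambda>x. norm (f x)) X"
    have T0: "T \<ge> 0" unfolding T_def by (rule infsum_nonneg) simp
    obtain F where F: "finite F" "F \<subseteq> X" and Fe: "norm (sum (\<lambda>x. norm (f x)) F - T) \<le> e / 2"
      using infsum_finite_approximation[OF nX, of "e/2"] e unfolding T_def dist_norm
      by (metis half_gt_zero)
    define d where "d = e / (2 * (T + 1))"
    have d0: "d > 0" using e T0 by (simp add: d_def)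
    obtain m where m1: "\<And>x. x \<in> X \<Longrightarrow> cmod (m x) \<le> 1" and mY: "\<And>x. x \<in> Y \<Longrightarrow> m x = 1"
      and mF: "\<And>x. x \<in> F - Y \<Longrightarrow> cmod (m x) \<le> d" and m0: "((\<lambda>x. f x * m x) has_sum 0) X"
      using mult[OF F d0] by blast
    have "(f has_sum infsum f Y) Y" using sY by simp
    then have hsY: "((\<lambda>x. f x * m x) has_sum infsum f Y) Y"
      using has_sum_cong[of Y "\<lambda>x. f x * m x" f "infsum f Y"] mY by simp
    have sXm: "(\<lambda>x. f x * m x) summable_on (X - Y)"
      by (rule summable_on_subset_banach[OF has_sum_imp_summable[OF m0]]) auto
    have hs: "((\<lambda>x. f x * m x) has_sum (infsum f Y + infsum (\<lambda>x. f x * m x) (X - Y))) (Y \<union> (X - Y))"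
      by (rule has_sum_Un_disjoint[OF hsY]) (use sXm in auto)
    have "Y \<union> (X - Y) = X" using Y by blast
    then have eq: "infsum f Y = - infsum (\<lambda>x. f x * m x) (X - Y)"
      using hs m0 has_sum_unique by (metis add_eq_0_iff2 add.inverse_inverse)
    have nXY: "(\<lambda>x. norm (f x * m x)) summable_on (X - Y)"
      using sXm by (simp only: summable_on_iff_abs_summable_on_complex)
    have nF: "(\<lambda>x. norm (f x)) summable_on (X - F)"
      by (rule summable_on_subset_banach[OF nX]) auto
    have bound: "cmod (infsum (\<lambda>x. f x * m x) (X - Y)) \<le> infsum (\<lambda>x. norm (f x * m x)) (X - Y)"
      by (rule norm_infsum_bound[OF nXY])
    also have "\<dots> \<le> infsum (\<lambda>x. (if x \<in> F then d * norm (f x) else norm (f x))) X"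
    proof (rule infsum_mono_neutral[OF nXY])
      show "(\<lambda>x. if x \<in> F then d * norm (f x) else norm (f x)) summable_on X"
      proof (rule summable_on_comparison_test[of "\<lambda>x. (d + 1) * norm (f x)"])
        show "(\<lambda>x. (d + 1) * norm (f x)) summable_on X"
          using nX by (rule summable_on_cmult_right)
      qed (use d0 in \<open>auto simp: algebra_simps\<close>)
      fix x assume "x \<in> X - (X - Y)" show "0 \<le> (if x \<in> F then d * norm (f x) else norm (f x))"
        using d0 by simp
    next
      fix x assume x: "x \<in> (X - Y) \<inter> X"
      have "norm (f x * m x) \<le> d * norm (f x)" if "x \<in> F"
        using mF[of x] x that mult_right_mono[of "cmod (m x)" d "cmod (f x)"] by (simp add: norm_mult mult.commute)
      moreover have "norm (f x * m x) \<le> norm (f x)"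
        using m1[of x] x by (simp add: norm_mult mult_left_le)
      ultimately show "norm (f x * m x) \<le> (if x \<in> F then d * norm (f x) else norm (f x))" by simp
    qed (use d0 in auto)
    also have "\<dots> = d * sum (\<lambda>x. norm (f x)) F + (T - sum (\<lambda>x. norm (f x)) F)"
    proof -
      have "((\<lambda>x. norm (f x)) has_sum (T - sum (\<lambda>x. norm (f x)) F)) (X - F)"
        using infsum_Diff[OF nX _ F(2)] F(1) nF unfolding T_def
        by (simp add: has_sum_iff)
      then have a: "((\<lambda>x. if x \<in> F then d * norm (f x) else norm (f x)) has_sum
          (T - sum (\<lambda>x. norm (f x)) F)) (X - F)"
        by (rule has_sum_cong[THEN iffD1, rotated]) auto
      have b: "((\<lambda>x. if x \<in> F then d * norm (f x) else norm (f x)) has_sum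
          (d * sum (\<lambda>x. norm (f x)) F)) F"
        using F by (intro has_sum_finiteI) (auto simp: sum_distrib_left)
      have "F \<union> (X - F) = X" using F by blast
      then show ?thesis using has_sum_Un_disjoint[OF b a] by (simp add: infsumI)
    qed
    also have "\<dots> \<le> d * T + e / 2"
    proof -
      have "sum (\<lambda>x. norm (f x)) F \<le> T" unfolding T_def
        by (rule finite_sum_le_infsum[OF nX F]) simp
      then show ?thesis using Fe d0 by (smt (verit) mult_left_mono real_norm_def)
    qed
    also have "d * T \<le> e / 2"
      using T0 e by (simp add: d_def field_simps)
    finally show ?thesis unfolding eq by simp
  qed
  then have "cmod (infsum f Y) \<le> 0" by (meson dense not_le)
  then show ?thesis using sY by (simp add: has_sum_iff)
qed

lemma has_sum_sum:
  fixes f :: "'j \<Rightarrow> 'x \<Rightarrow> complex"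
  assumes "\<And>j. j \<in> J \<Longrightarrow> (f j has_sum s j) X"
  shows "((\<lambda>x. \<Sum>j\<in>J. f j x) has_sum (\<Sum>j\<in>J. s j)) X"
  using assms by (induction J rule: infinite_finite_induct) (auto intro!: has_sum_add)

lemma sum_roots_of_unity_powi:
  assumes "N > (0::nat)"
  shows "(\<Sum>j<N. cis (2 * pi * real j / real N) powi k) = (if int N dvd k then of_nat N else 0)"
proof -
  define w where "w = cis (2 * pi * real_of_int k / real N)"
  have wj: "cis (2 * pi * real j / real N) powi k = w ^ j" for j
    by (simp add: w_def cis_power_int Complex.DeMoivre algebra_simps)
  have wN: "w ^ N = 1"
  proof -
    have "w ^ N = cis (2 * pi * of_int k)" using assms by (simp add: w_def Complex.DeMoivre)
    also have "\<dots> = 1" using cis_multiple_2pi[of "of_int k"] by simp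
    finally show ?thesis .
  qed
  have w1: "w = 1 \<longleftrightarrow> int N dvd k"
  proof
    assume "w = 1"
    then have "exp (\<i> * of_real (2 * pi * real_of_int k / real N)) = exp 0"
      by (simp add: w_def cis_conv_exp)
    then obtain n :: int where "\<i> * of_real (2 * pi * real_of_int k / real N) = 0 + (of_int (2 * n) * pi) * \<i>"
      unfolding exp_eq by blast
    then have "complex_of_real (2 * pi * real_of_int k / real N) = complex_of_real (real_of_int (2 * n) * pi)"
      by (simp add: complex_eq_iff)
    then have "2 * pi * real_of_int k / real N = real_of_int (2 * n) * pi"
      by (simp only: of_real_eq_iff)
    then have "real_of_int k = real_of_int (n * int N)"
      using assms by (simp add: field_simps)
    then have "k = n * int N" by (simp only: of_int_eq_iff)
    then show "int N dvd k" by simp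
  next
    assume "int N dvd k"
    then obtain n where "k = int N * n" by blast
    then have "2 * pi * real_of_int k / real N = 2 * pi * of_int n" using assms by simp
    then show "w = 1" using cis_multiple_2pi[of "of_int n"] by (simp add: w_def)
  qed
  show ?thesis
  proof (cases "w = 1")
    case True
    then show ?thesis using w1 by (simp add: wj)
  next
    case False
    then show ?thesis using w1 wN by (simp add: wj geometric_sum)
  qed
qed

text \<open>
  Averaging over roots of unity of large order isolates the terms of one weight \<open>\<kappa> = k\<close>.
\<close>

lemma phase_separation:
  fixes f :: "'x \<Rightarrow> complex" and \<kappa> :: "'x \<Rightarrow> int"
  assumes "\<And>u. cmod u = 1 \<Longrightarrow> ((\<lambda>x. f x * u powi \<kappa> x) has_sum 0) X"
  shows "(f has_sum 0) {x \<in> X. \<kappa> x = k}"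
proof (rule infsum_multiplier_limit[where X = X])
  show "f summable_on X" using assms[of 1] by (auto simp: has_sum_iff)
next
  fix F :: "'x set" and e :: real assume F: "finite F" "F \<subseteq> X" and "0 < e"
  \<comment> \<open>\<open>N\<close> exceeds every \<open>\<bar>\<kappa> x - k\<bar>\<close> on \<open>F\<close>, so averaging over the \<open>N\<close>-th roots of unity
    keeps only those points of \<open>F\<close> that lie in the fibre.\<close>
  define N where "N = nat (\<Sum>x\<in>F. \<bar>\<kappa> x - k\<bar>) + 1"
  have N0: "N > 0" by (simp add: N_def)
  define m :: "'x \<Rightarrow> complex" where "m = (\<lambda>x. if int N dvd \<kappa> x - k then 1 else 0)"
  have small: "\<bar>\<kappa> x - k\<bar> < int N" if "x \<in> F" for x
  proof -
    have "\<bar>\<kappa> x - k\<bar> \<le> (\<Sum>x\<in>F. \<bar>\<kappa> x - k\<bar>)" using F(1) that by (intro member_le_sum) auto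
    then show ?thesis by (simp add: N_def)
  qed
  have mF: "m x = 0" if "x \<in> F - {x \<in> X. \<kappa> x = k}" for x
  proof -
    have "\<kappa> x - k \<noteq> 0" "\<bar>\<kappa> x - k\<bar> < \<bar>int N\<bar>" using that F small by auto
    then have "\<not> int N dvd \<kappa> x - k" using dvd_imp_le_int[of "\<kappa> x - k" "int N"] by auto
    then show ?thesis by (simp add: m_def)
  qed
  have "((\<lambda>x. \<Sum>j<N. cis (2 * pi * real j / real N) powi (- k) / of_nat N
            * (f x * cis (2 * pi * real j / real N) powi \<kappa> x)) has_sum (\<Sum>j<N. 0)) X"
  proof (rule has_sum_sum)
    fix j
    have "((\<lambda>x. f x * cis (2 * pi * real j / real N) powi \<kappa> x) has_sum 0) X" by (rule assms) simp
    from has_sum_cmult_right[OF this, of "cis (2 * pi * real j / real N) powi (- k) / of_nat N"]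
    show "((\<lambda>x. cis (2 * pi * real j / real N) powi (- k) / of_nat N
            * (f x * cis (2 * pi * real j / real N) powi \<kappa> x)) has_sum 0) X"
      by simp
  qed
  moreover have "(\<Sum>j<N. cis (2 * pi * real j / real N) powi (- k) / of_nat N
            * (f x * cis (2 * pi * real j / real N) powi \<kappa> x)) = f x * m x" for x
  proof -
    have "(\<Sum>j<N. cis (2 * pi * real j / real N) powi (- k) / of_nat N
            * (f x * cis (2 * pi * real j / real N) powi \<kappa> x))
        = f x / of_nat N * (\<Sum>j<N. cis (2 * pi * real j / real N) powi (\<kappa> x - k))"
      by (simp add: sum_distrib_left power_int_diff power_int_minus field_simps)
    then show ?thesis using N0 by (simp add: sum_roots_of_unity_powi m_def)
  qed
  ultimately have "((\<lambda>x. f x * m x) has_sum 0) X" by simp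
  then show "\<exists>m. (\<forall>x\<in>X. cmod (m x) \<le> 1) \<and> (\<forall>x\<in>{x \<in> X. \<kappa> x = k}. m x = 1) \<and>
      (\<forall>x\<in>F - {x \<in> X. \<kappa> x = k}. cmod (m x) \<le> e) \<and> ((\<lambda>x. f x * m x) has_sum 0) X"
    using mF \<open>0 < e\<close> by (intro exI[of _ m]) (auto simp: m_def)
qed auto

text \<open>
  Once the terms of weight below \<open>k\<close> are removed, which is the induction hypothesis, dividing by
  \<open>t ^ k\<close> and letting \<open>t\<close> tend to \<open>0\<close> leaves the terms of weight \<open>k\<close>.
\<close>

lemma dilation_separation:
  fixes f :: "'x \<Rightarrow> complex" and \<kappa> :: "'x \<Rightarrow> nat"
  assumes "\<And>t::real. 0 < t \<Longrightarrow> t \<le> 1 \<Longrightarrow> ((\<lambda>x. f x * of_real t ^ \<kappa> x) has_sum 0) X"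
  shows "(f has_sum 0) {x \<in> X. \<kappa> x = k}"
proof (induction k rule: less_induct)
  case (less k)
  have fX: "f summable_on X" using assms[of 1] by (auto simp: has_sum_iff)
  define X' where "X' = {x \<in> X. \<kappa> x \<ge> k}"
  have low: "((\<lambda>x. f x * of_real t ^ \<kappa> x) has_sum 0) {x \<in> X. \<kappa> x < k}" for t :: real
  proof -
    have eq: "{x \<in> X. \<kappa> x < k} = (\<Union>l\<in>{..<k}. {x \<in> X. \<kappa> x = l})" by auto
    have "((\<lambda>x. f x * of_real t ^ \<kappa> x) has_sum (\<Sum>l\<in>{..<k}. 0)) (\<Union>l\<in>{..<k}. {x \<in> X. \<kappa> x = l})"
    proof (rule sum_has_sum)
      fix l assume "l \<in> {..<k}"
      then have "(f has_sum 0) {x \<in> X. \<kappa> x = l}" using less by simp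
      from has_sum_cmult_left[OF this, of "of_real t ^ l"]
      have "((\<lambda>x. f x * of_real t ^ l) has_sum 0) {x \<in> X. \<kappa> x = l}" by simp
      then show "((\<lambda>x. f x * of_real t ^ \<kappa> x) has_sum 0) {x \<in> X. \<kappa> x = l}"
        by (rule has_sum_cong[THEN iffD1, rotated]) auto
    qed auto
    then show ?thesis unfolding eq by simp
  qed
  have X': "((\<lambda>x. f x * of_real t ^ \<kappa> x) has_sum 0) X'" if "0 < t" "t \<le> 1" for t :: real
  proof -
    have "((\<lambda>x. f x * of_real t ^ \<kappa> x) has_sum (0 - 0)) (X - {x \<in> X. \<kappa> x < k})"
      by (rule has_sum_Diff[OF assms[OF that] low]) auto
    moreover have "X - {x \<in> X. \<kappa> x < k} = X'" by (auto simp: X'_def)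
    ultimately show ?thesis by simp
  qed
  have "(f has_sum 0) {x \<in> X'. \<kappa> x = k}"
  proof (rule infsum_multiplier_limit[where X = X'])
    show "f summable_on X'" by (rule summable_on_subset_banach[OF fX]) (auto simp: X'_def)
  next
    fix F :: "'x set" and e :: real assume F: "finite F" "F \<subseteq> X'" and e: "0 < e"
    \<comment> \<open>the multiplier \<open>t ^ (\<kappa> x - k)\<close> is at most \<open>t\<close> off the fibre\<close>
    define t where "t = min 1 e"
    have t: "0 < t" "t \<le> 1" "t \<le> e" using e by (auto simp: t_def)
    define m :: "'x \<Rightarrow> complex" where "m = (\<lambda>x. of_real t ^ (\<kappa> x - k))"
    have "((\<lambda>x. inverse (of_real t ^ k) * (f x * of_real t ^ \<kappa> x)) has_sum 0) X'"
      using has_sum_cmult_right[OF X'[OF t(1,2)]] by (metis mult_zero_right)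
    then have "((\<lambda>x. f x * m x) has_sum 0) X'"
    proof (rule has_sum_cong[THEN iffD1, rotated])
      fix x assume "x \<in> X'"
      then have "\<kappa> x = k + (\<kappa> x - k)" by (simp add: X'_def)
      then have "complex_of_real t ^ \<kappa> x = of_real t ^ k * m x" unfolding m_def by (metis power_add)
      then show "inverse (of_real t ^ k) * (f x * of_real t ^ \<kappa> x) = f x * m x"
        using t(1) by simp
    qed
    moreover have "cmod (m x) \<le> e" if "x \<in> F - {x \<in> X'. \<kappa> x = k}" for x
    proof -
      have "\<kappa> x - k \<noteq> 0" using that F by (auto simp: X'_def)
      then obtain j where "\<kappa> x - k = Suc j" using not0_implies_Suc by blast
      then have "cmod (m x) = t * t ^ j" using t by (simp add: m_def norm_mult norm_power)
      also have "\<dots> \<le> t * 1" using t by (intro mult_left_mono power_le_one) auto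
      finally show ?thesis using t by simp
    qed
    ultimately show "\<exists>m. (\<forall>x\<in>X'. cmod (m x) \<le> 1) \<and> (\<forall>x\<in>{x \<in> X'. \<kappa> x = k}. m x = 1) \<and>
        (\<forall>x\<in>F - {x \<in> X'. \<kappa> x = k}. cmod (m x) \<le> e) \<and> ((\<lambda>x. f x * m x) has_sum 0) X'"
      using t by (intro exI[of _ m]) (auto simp: m_def norm_power power_le_one)
  qed auto
  moreover have "{x \<in> X'. \<kappa> x = k} = {x \<in> X. \<kappa> x = k}" by (auto simp: X'_def)
  ultimately show ?case by simp
qed

text \<open>
  Rotating one coordinate at a time isolates a fixed difference \<open>P - Q\<close>.  On the remaining terms
  \<open>\<rho>\<close> is a common nonzero factor, so it can be divided out, and rescaling one coordinate at a time
  then isolates \<open>P + Q\<close>.  The factor \<open>\<rho>\<close> allows for powers of a coordinate \<open>z\<^sub>0\<close> that is a function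
  of the moduli of the others.
\<close>

lemma monomial_independence:
  fixes b :: "('a::finite \<Rightarrow> nat) \<Rightarrow> ('a \<Rightarrow> nat) \<Rightarrow> complex"
    and \<rho> :: "('a \<Rightarrow> int) \<Rightarrow> ('a \<Rightarrow> real) \<Rightarrow> complex"
  assumes \<delta>: "\<delta> > 0" and \<rho>: "\<And>D r. \<rho> D r \<noteq> 0"
    and zero: "\<And>v :: 'a \<Rightarrow> complex. (\<And>i. cmod (v i) < \<delta>) \<Longrightarrow>
      ((\<lambda>(P, Q). b P Q * \<rho> (\<lambda>i. int (P i) - int (Q i)) (\<lambda>i. cmod (v i))
          * ((\<Prod>i\<in>UNIV. v i ^ P i) * (\<Prod>i\<in>UNIV. cnj (v i) ^ Q i))) has_sum 0) UNIV"
  shows "b P Q = 0"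
proof -
  have fun_upd_prod: "(\<Prod>i\<in>UNIV. (v(j := c * v j)) i ^ P i) = c ^ P j * (\<Prod>i\<in>UNIV. v i ^ P i)"
    for v :: "'a \<Rightarrow> complex" and j c and P :: "'a \<Rightarrow> nat"
  proof -
    have "(\<Prod>i\<in>UNIV. (v(j := c * v j)) i ^ P i)
        = (\<Prod>i\<in>UNIV. (if i = j then c ^ P i else 1) * v i ^ P i)"
      by (rule prod.cong) (auto simp: power_mult_distrib)
    then show ?thesis by (simp add: prod.distrib)
  qed
  have cnj_upd: "cnj ((v(j := c * v j)) i) = ((\<lambda>i. cnj (v i))(j := cnj c * cnj (v j))) i"
    for v :: "'a \<Rightarrow> complex" and j c i by simp
  define T where "T = (\<lambda>v (P, Q). b P Q * \<rho> (\<lambda>i. int (P i) - int (Q i)) (\<lambda>i. cmod (v i))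
          * ((\<Prod>i\<in>UNIV. v i ^ P i) * (\<Prod>i\<in>UNIV. cnj (v i) ^ Q i)))"
  define D where "D = (\<lambda>i. int (P i) - int (Q i))"
  have phases: "(T v has_sum 0) {(P, Q). \<forall>j\<in>J. int (P j) - int (Q j) = D j}"
    if "finite J" "\<And>i. cmod (v i) < \<delta>" for J v
    using that
  proof (induction J arbitrary: v)
    case empty
    then show ?case using zero[of v] by (simp add: T_def)
  next
    case (insert j J)
    define X where "X = {(P, Q). \<forall>j\<in>J. int (P j) - int (Q j) = D j}"
    have "(T v has_sum 0) {x \<in> X. (\<lambda>(P, Q). int (P j) - int (Q j)) x = D j}"
    proof (rule phase_separation)
      fix u :: complex assume u: "cmod u = 1"
      have cmod_eq: "(\<lambda>i. cmod ((v(j := u * v j)) i)) = (\<lambda>i. cmod (v i))"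
        using u by (auto simp: fun_eq_iff norm_mult)
      have "(T (v(j := u * v j)) has_sum 0) X"
        unfolding X_def using insert.prems u by (intro insert.IH) (auto simp: norm_mult)
      moreover have "T (v(j := u * v j)) x = T v x * u powi (\<lambda>(P, Q). int (P j) - int (Q j)) x" for x
      proof (cases x)
        case (Pair P Q)
        have "u \<noteq> 0" using u by auto
        have "cnj u = inverse u" using u
          by (metis complex_div_cnj divide_inverse mult.commute mult_1 norm_one of_real_1 one_power2 power_one div_by_1 inverse_eq_divide)
        then have "u ^ P j * cnj u ^ Q j = u powi (int (P j) - int (Q j))"
          using \<open>u \<noteq> 0\<close> by (simp add: power_int_diff power_inverse divide_inverse)
        moreover have "(\<Prod>i\<in>UNIV. cnj ((v(j := u * v j)) i) ^ Q i) = cnj u ^ Q j * (\<Prod>i\<in>UNIV. cnj (v i) ^ Q i)"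
          unfolding cnj_upd by (rule fun_upd_prod)
        ultimately show ?thesis
          unfolding T_def Pair prod.case cmod_eq fun_upd_prod by (simp add: mult_ac)
      qed
      ultimately show "((\<lambda>x. T v x * u powi (\<lambda>(P, Q). int (P j) - int (Q j)) x) has_sum 0) X"
        using has_sum_cong by (metis (no_types, lifting))
    qed
    moreover have "{x \<in> X. (\<lambda>(P, Q). int (P j) - int (Q j)) x = D j}
        = {(P, Q). \<forall>j\<in>insert j J. int (P j) - int (Q j) = D j}"
      by (auto simp: X_def)
    ultimately show ?case by simp
  qed
  define R where "R = (\<lambda>s (P', Q'). b P' Q' * ((\<Prod>i\<in>UNIV. complex_of_real (s i) ^ P' i) * (\<Prod>i\<in>UNIV. complex_of_real (s i) ^ Q' i)))"
  define Y where "Y = {(P', Q'). \<forall>j. int (P' j) - int (Q' j) = D j}"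
  have fibre: "(R s has_sum 0) Y" if "\<And>i. 0 < s i" "\<And>i. s i < \<delta>" for s :: "'a \<Rightarrow> real"
  proof -
    have "(T (\<lambda>i. complex_of_real (s i)) has_sum 0) Y"
      using phases[of UNIV "\<lambda>i. complex_of_real (s i)"] that less_imp_le[OF that(1)] by (simp add: Y_def)
    from has_sum_cmult_right[OF this, of "inverse (\<rho> D s)"]
    have "((\<lambda>x. inverse (\<rho> D s) * T (\<lambda>i. complex_of_real (s i)) x) has_sum 0) Y" by simp
    then show ?thesis
    proof (rule has_sum_cong[THEN iffD1, rotated])
      fix x assume "x \<in> Y"
      then obtain P' Q' where x: "x = (P', Q')" and "(\<lambda>i. int (P' i) - int (Q' i)) = D"
        by (auto simp: Y_def)
      then show "inverse (\<rho> D s) * T (\<lambda>i. complex_of_real (s i)) x = R s x"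
        using \<rho>[of D s] less_imp_le[OF that(1)] by (simp add: T_def R_def)
    qed
  qed
  have dilations: "(R s has_sum 0) {x \<in> Y. \<forall>j\<in>J. fst x j = P j}"
    if "finite J" "\<And>i. 0 < s i" "\<And>i. s i < \<delta>" for J and s :: "'a \<Rightarrow> real"
    using that
  proof (induction J arbitrary: s)
    case empty
    then show ?case using fibre[of s] by simp
  next
    case (insert j J)
    define X where "X = {x \<in> Y. \<forall>j\<in>J. fst x j = P j}"
    have "(R s has_sum 0) {x \<in> X. (\<lambda>(P', Q'). P' j + Q' j) x = P j + Q j}"
    proof (rule dilation_separation)
      fix t :: real assume t: "0 < t" "t \<le> 1"
      have upd: "(\<Prod>i\<in>UNIV. complex_of_real ((s(j := t * s j)) i) ^ P' i)
          = of_real t ^ P' j * (\<Prod>i\<in>UNIV. complex_of_real (s i) ^ P' i)" for P' :: "'a \<Rightarrow> nat"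
      proof -
        have "complex_of_real ((s(j := t * s j)) i)
            = ((\<lambda>i. complex_of_real (s i))(j := of_real t * complex_of_real (s j))) i" for i
          by simp
        then show ?thesis using fun_upd_prod[of "\<lambda>i. complex_of_real (s i)" j "of_real t" P']
          by (simp del: fun_upd_apply)
      qed
      have "t * s j < \<delta>" using t insert.prems
        by (metis mult_left_le_one_le less_imp_le le_less_trans)
      then have "(R (s(j := t * s j)) has_sum 0) X"
        unfolding X_def using insert.prems t by (intro insert.IH) auto
      moreover have "R (s(j := t * s j)) x = R s x * complex_of_real t ^ (\<lambda>(P', Q'). P' j + Q' j) x" for x
        using upd unfolding R_def by (cases x) (simp add: power_add mult_ac del: fun_upd_apply)
      ultimately show "((\<lambda>x. R s x * complex_of_real t ^ (\<lambda>(P', Q'). P' j + Q' j) x) has_sum 0) X"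
        using has_sum_cong by (metis (no_types, lifting))
    qed
    moreover have "{x \<in> X. (\<lambda>(P', Q'). P' j + Q' j) x = P j + Q j}
        = {x \<in> Y. \<forall>j\<in>insert j J. fst x j = P j}"
    proof -
      have "P' j + Q' j = P j + Q j \<longleftrightarrow> P' j = P j" if "(P', Q') \<in> Y" for P' Q'
      proof -
        have "int (P' j) - int (Q' j) = int (P j) - int (Q j)" using that by (simp add: Y_def D_def)
        then show ?thesis by linarith
      qed
      then show ?thesis by (fastforce simp: X_def)
    qed
    ultimately show ?case by simp
  qed
  have single: "{x \<in> Y. \<forall>j\<in>UNIV. fst x j = P j} = {(P, Q)}"
    by (auto simp: Y_def D_def fun_eq_iff)
  define s where "s = (\<lambda>i::'a. \<delta> / 2)"
  have "(R s has_sum 0) {(P, Q)}"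
    using dilations[of UNIV s] \<delta> unfolding single by (simp add: s_def)
  then have "R s (P, Q) = 0" by (simp add: has_sum_finite_iff)
  then show ?thesis using \<delta> by (simp add: R_def s_def)
qed

section \<open>Multi-indices and factorial estimates\<close>

lemma prod_UNIV_option:
  fixes f :: "'a::finite option \<Rightarrow> 'b::comm_monoid_mult"
  shows "(\<Prod>i\<in>UNIV. f i) = f None * (\<Prod>i\<in>UNIV. f (Some i))"
  by (simp add: UNIV_option_conv prod.reindex)

lemma sum_UNIV_option:
  fixes f :: "'a::finite option \<Rightarrow> 'b::comm_monoid_add"
  shows "(\<Sum>i\<in>UNIV. f i) = f None + (\<Sum>i\<in>UNIV. f (Some i))"
  by (simp add: UNIV_option_conv sum.reindex)

lemma mabs_option: "mabs A = A None + mabs (A \<circ> Some)"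
  by (simp add: mabs_def sum_UNIV_option)

lemma mfact_option: "mfact A = fact (A None) * mfact (A \<circ> Some)"
  by (simp add: mfact_def prod_UNIV_option)

lemma mabs_add [simp]: "mabs (A + B) = mabs A + mabs B"
  by (simp add: mabs_def sum.distrib)

lemma mabs_mono: "A \<le> B \<Longrightarrow> mabs A \<le> mabs B"
  by (simp add: mabs_def le_fun_def sum_mono)

lemma le_mabs: "A i \<le> mabs A"
  unfolding mabs_def by (rule member_le_sum) auto

lemma mabs_diff: "K \<le> A \<Longrightarrow> mabs (A - K) = mabs A - mabs K"
  by (simp add: mabs_def le_fun_def sum_subtractf_nat)

lemma mfact_pos [simp]: "0 < mfact A"
  by (simp add: mfact_def prod_pos)

lemma mi_between:
  "{A :: 'a::finite mi. \<forall>i. A i \<le> N} = PiE UNIV (\<lambda>_. {..N})"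
  by (auto simp: PiE_def Pi_def)

lemma finite_mi_le: "finite {A :: 'a::finite mi. \<forall>i. A i \<le> N}"
  unfolding mi_between by (intro finite_PiE) auto

lemma card_mi_le: "card {A :: 'a::finite mi. \<forall>i. A i \<le> N} = Suc N ^ CARD('a)"
  unfolding mi_between by (simp add: card_PiE)

lemma finite_mabs_le: "finite {A :: 'a::finite mi. mabs A \<le> N}"
  by (rule finite_subset[OF _ finite_mi_le[of N]]) (use le_mabs le_trans in blast)

lemma finite_mabs_eq: "finite {A :: 'a::finite mi. mabs A = N}"
  by (rule finite_subset[OF _ finite_mabs_le[of N]]) auto

lemma card_mabs_le: "card {A :: 'a::finite mi. mabs A \<le> N} \<le> (2 ^ CARD('a)) ^ N"
proof -
  have "card {A :: 'a mi. mabs A \<le> N} \<le> card {A :: 'a mi. \<forall>i. A i \<le> N}"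
    by (rule card_mono[OF finite_mi_le]) (use le_mabs le_trans in blast)
  also have "\<dots> \<le> (2 ^ N) ^ CARD('a)"
    unfolding card_mi_le by (rule power_mono) (auto simp: Suc_leI less_exp)
  finally show ?thesis by (simp add: power_mult[symmetric] mult.commute)
qed

text \<open>The geometric series in several variables is a product of geometric series.\<close>

lemma summable_on_mi_geometric:
  fixes \<rho> :: real
  assumes "0 \<le> \<rho>" "\<rho> < 1"
  shows "(\<lambda>A :: 'a::finite mi. \<rho> ^ mabs A) summable_on UNIV"
proof (rule nonneg_bdd_above_summable_on)
  show "bdd_above (sum (\<lambda>A :: 'a mi. \<rho> ^ mabs A) ` {F. F \<subseteq> UNIV \<and> finite F})"
  proof (rule bdd_aboveI2)
    fix F :: "'a mi set" assume F: "F \<in> {F. F \<subseteq> UNIV \<and> finite F}"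
    define N where "N = (\<Sum>A\<in>F. mabs A)"
    have sub: "F \<subseteq> {A. \<forall>i. A i \<le> N}"
    proof safe
      fix A i assume "A \<in> F"
      then have "mabs A \<le> N" unfolding N_def using F by (intro member_le_sum) auto
      then show "A i \<le> N" using le_mabs[of A i] by simp
    qed
    have "(\<Sum>A\<in>F. \<rho> ^ mabs A) \<le> (\<Sum>A | \<forall>i::'a. A i \<le> N. \<rho> ^ mabs A)"
      by (rule sum_mono2[OF finite_mi_le sub]) (use assms in auto)
    also have "\<dots> = (\<Prod>i\<in>(UNIV :: 'a set). \<Sum>k\<le>N. \<rho> ^ k)"
      unfolding mi_between by (subst prod_sum_PiE) (auto simp: mabs_def power_sum)
    also have "\<dots> = (\<Sum>k\<le>N. \<rho> ^ k) ^ CARD('a)" by simp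
    also have "\<dots> \<le> (1 / (1 - \<rho>)) ^ CARD('a)"
    proof (rule power_mono)
      have "(\<Sum>k\<le>N. \<rho> ^ k) \<le> (\<Sum>k. \<rho> ^ k)"
        by (rule sum_le_suminf) (use assms in \<open>auto intro!: summable_geometric\<close>)
      then show "(\<Sum>k\<le>N. \<rho> ^ k) \<le> 1 / (1 - \<rho>)" using assms by (simp add: suminf_geometric)
    qed (use assms in \<open>auto intro!: sum_nonneg\<close>)
    finally show "(\<Sum>A\<in>F. \<rho> ^ mabs A) \<le> (1 / (1 - \<rho>)) ^ CARD('a)" .
  qed
qed (use assms in auto)

lemma summable_on_prod_nonneg:
  fixes f :: "'x \<Rightarrow> real" and g :: "'y \<Rightarrow> real"
  assumes f: "f summable_on X" and g: "g summable_on Y"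
    and "\<And>x. 0 \<le> f x" "\<And>y. 0 \<le> g y"
  shows "(\<lambda>(x, y). f x * g y) summable_on (X \<times> Y)"
proof (rule summable_on_SigmaI[where g = "\<lambda>x. f x * infsum g Y"])
  fix x
  have "(g has_sum infsum g Y) Y" using g by simp
  then show "((\<lambda>y. case (x, y) of (x, y) \<Rightarrow> f x * g y) has_sum f x * infsum g Y) Y"
    by (simp add: has_sum_cmult_right)
next
  show "(\<lambda>x. f x * infsum g Y) summable_on X" by (rule summable_on_cmult_left[OF f])
qed (use assms in auto)

text \<open>
  The \<open>n\<close>-th term of the exponential series of \<open>L powr (1 / \<epsilon>)\<close> is bounded by its sum.
\<close>

lemma power_le_fact_powr:
  fixes L \<epsilon> :: real
  assumes "L > 0" "\<epsilon> > 0"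
  obtains C where "C > 0" "\<And>n. L ^ n \<le> C * fact n powr \<epsilon>"
proof -
  define a where "a = L powr (1 / \<epsilon>)"
  have a0: "a > 0" using assms by (simp add: a_def)
  have "L ^ n \<le> exp a powr \<epsilon> * fact n powr \<epsilon>" for n
  proof -
    have sm: "summable (\<lambda>k. a ^ k / fact k)" using summable_exp[of a] by (simp add: divide_inverse mult.commute)
    have "(\<Sum>k\<in>{n}. a ^ k / fact k) \<le> (\<Sum>k. a ^ k / fact k)"
      by (rule sum_le_suminf[OF sm]) (use a0 in auto)
    also have "\<dots> = exp a" by (simp add: exp_def divide_inverse mult.commute scaleR_conv_of_real)
    finally have "a ^ n \<le> exp a * fact n" by (simp add: field_simps)
    then have "(a ^ n) powr \<epsilon> \<le> (exp a * fact n) powr \<epsilon>"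
      using a0 assms by (intro powr_mono2) auto
    also have "\<dots> = exp a powr \<epsilon> * fact n powr \<epsilon>" by (simp add: powr_mult)
    also have "(a ^ n) powr \<epsilon> = L ^ n"
      using assms a0 by (simp add: powr_realpow[symmetric] powr_powr a_def)
    finally show ?thesis .
  qed
  then show ?thesis using that[of "exp a powr \<epsilon>"] by simp
qed

lemma fact_add_le: "fact (m + n) \<le> (2::nat) ^ (m + n) * (fact m * fact n)"
proof -
  have "fact m * fact n * (m + n choose m) = (fact (m + n) :: nat)"
    using binomial_fact_lemma[of m "m + n"] by simp
  moreover have "(m + n choose m) \<le> 2 ^ (m + n)" by (rule binomial_le_pow2)
  ultimately show ?thesis by (metis mult.commute mult_le_mono2)
qed

lemma fact_mult_le: "fact m * fact n \<le> (fact (m + n) :: nat)"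
proof -
  have "fact m * fact n dvd (fact (m + n) :: nat)" by (rule fact_fact_dvd_fact)
  then show ?thesis by (rule dvd_imp_le) simp
qed

text \<open>
  Together with its converse below, this allows factorials of multi-indices to be traded for the
  factorial of the degree at the cost of a geometric factor.
\<close>

lemma fact_mabs_le: "fact (mabs (A :: 'a::finite mi)) \<le> (2 ^ CARD('a)) ^ mabs A * mfact A"
proof -
  have "fact (\<Sum>i\<in>J. A i) \<le> (2 ^ card J) ^ (\<Sum>i\<in>J. A i) * (\<Prod>i\<in>J. fact (A i) :: nat)"
    if "finite J" for J
    using that
  proof induction
    case (insert j J)
    let ?s = "\<Sum>i\<in>J. A i"
    have "fact (A j + ?s) \<le> (2::nat) ^ (A j + ?s) * (fact (A j) * fact ?s)" by (rule fact_add_le)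
    also have "\<dots> \<le> 2 ^ (A j + ?s) * (fact (A j) * ((2 ^ card J) ^ ?s * (\<Prod>i\<in>J. fact (A i))))"
      using insert.IH by simp
    also have "\<dots> \<le> 2 ^ (A j + ?s) * (fact (A j) * ((2 ^ card J) ^ (A j + ?s) * (\<Prod>i\<in>J. fact (A i))))"
      by (intro mult_le_mono order_refl power_increasing) auto
    also have "\<dots> = (2 ^ card (insert j J)) ^ (A j + ?s) * (\<Prod>i\<in>insert j J. fact (A i))"
      using insert.hyps by (simp add: power_mult_distrib mult_ac)
    finally show ?case using insert.hyps by simp
  qed auto
  from this[of UNIV] show ?thesis by (simp add: mabs_def mfact_def)
qed

lemma mfact_le_fact_mabs: "mfact A \<le> fact (mabs A)"
proof -
  have "(\<Prod>i\<in>J. fact (A i)) \<le> (fact (\<Sum>i\<in>J. A i) :: nat)" if "finite J" for J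
    using that
  proof induction
    case (insert j J)
    have "fact (A j) * (\<Prod>i\<in>J. fact (A i)) \<le> fact (A j) * (fact (\<Sum>i\<in>J. A i) :: nat)"
      using insert.IH by simp
    also have "\<dots> \<le> fact (A j + (\<Sum>i\<in>J. A i))" by (rule fact_mult_le)
    finally show ?case using insert.hyps by simp
  qed auto
  from this[of UNIV] show ?thesis by (simp add: mabs_def mfact_def)
qed

text \<open>
  The bound depends on \<open>z\<close> through \<open>m\<close> only; this uniformity is what makes series in the
  Pochhammer symbols converge locally uniformly.
\<close>

lemma norm_pochhammer_le:
  fixes z :: complex
  assumes "cmod z \<le> real m"
  shows "cmod (pochhammer z l) \<le> 2 ^ (m + l) * fact l"
proof -
  have "cmod (pochhammer z l) \<le> (\<Prod>j = 0..<l. real (Suc m + j))"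
    unfolding pochhammer_prod prod_norm[symmetric]
  proof (rule prod_mono)
    fix j assume "j \<in> {0..<l}"
    have "cmod (z + of_nat j) \<le> cmod z + real j" by (metis norm_of_nat norm_triangle_ineq)
    then show "0 \<le> cmod (z + of_nat j) \<and> cmod (z + of_nat j) \<le> real (Suc m + j)"
      using assms by simp
  qed
  also have "\<dots> = real (pochhammer (Suc m) l)" by (simp add: pochhammer_prod)
  also have "\<dots> \<le> real (2 ^ (m + l) * fact l)"
  proof -
    have "fact m * pochhammer (Suc m) l = (fact (m + l) :: nat)"
      using pochhammer_product'[of "1::nat" m l] by (simp add: pochhammer_fact)
    then have "fact m * pochhammer (Suc m) l \<le> fact m * (2 ^ (m + l) * fact l)"
      using fact_add_le[of m l] by (simp add: mult_ac)
    then have "pochhammer (Suc m) l \<le> 2 ^ (m + l) * fact l" by simp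
    then show ?thesis by (simp only: of_nat_le_iff)
  qed
  finally show ?thesis by simp
qed

section \<open>Balanced pairs of multi-indices\<close>

type_synonym 'n pidx = "'n option mi \<times> 'n option mi"

text \<open>
  The exponents of \<open>z\<^sup>A cnj z\<^sup>B\<close> including the coordinate \<open>0\<close>: the triple \<open>(P, Q, \<alpha>)\<close> is the pair with
  zeroth entries \<open>\<alpha> - \<bar>P\<bar>\<close> and \<open>\<alpha> - \<bar>Q\<bar>\<close>.  In this form all coordinates enter the product
  formula alike.
\<close>

definition balanced :: "'n::finite pidx set" where
  "balanced = {(A, B). mabs A = mabs B}"

definition triple_of :: "'n::finite pidx \<Rightarrow> 'n mi \<times> 'n mi \<times> nat" where
  "triple_of = (\<lambda>(A, B). (A \<circ> Some, B \<circ> Some, mabs A))"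

definition lift_mi :: "nat \<Rightarrow> 'n::finite mi \<Rightarrow> 'n option mi" where
  "lift_mi \<alpha> P = (\<lambda>i. case i of None \<Rightarrow> \<alpha> - mabs P | Some j \<Rightarrow> P j)"

abbreviation deg :: "'n::finite pidx \<Rightarrow> nat" where
  "deg t \<equiv> mabs (fst t)"

definition fpair :: "complex \<Rightarrow> 'n::finite pidx \<Rightarrow> 'n cfn" where
  "fpair h t w = fbas h (triple_of t) w"

lemma lift_mi_simps [simp]:
  "lift_mi \<alpha> P None = \<alpha> - mabs P" "lift_mi \<alpha> P (Some i) = P i" "lift_mi \<alpha> P \<circ> Some = P"
  by (auto simp: lift_mi_def)

lemma mabs_lift_mi: "mabs P \<le> \<alpha> \<Longrightarrow> mabs (lift_mi \<alpha> P) = \<alpha>"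
  by (simp add: mabs_option)

lemma lift_mi_restrict: "mabs A = \<alpha> \<Longrightarrow> lift_mi \<alpha> (A \<circ> Some) = A"
  by (auto simp: lift_mi_def mabs_option fun_eq_iff split: option.split)

lemma bij_betw_triple_of: "bij_betw triple_of balanced triples"
  by (rule bij_betw_byWitness[where f' = "\<lambda>(P, Q, \<alpha>). (lift_mi \<alpha> P, lift_mi \<alpha> Q)"])
    (auto simp: triple_of_def balanced_def triples_def lift_mi_restrict mabs_lift_mi mabs_option)

lemma ebas_triple_of: "t \<in> balanced \<Longrightarrow> ebas (triple_of t) = zmonom (fst t) (snd t)"
proof -
  assume t: "t \<in> balanced"
  obtain A B where AB: "t = (A, B)" by fastforce
  have "mabs A - mabs (A \<circ> Some) = A None" "mabs A - mabs (B \<circ> Some) = B None"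
    using t by (simp_all add: AB balanced_def mabs_option)
  then show ?thesis
    by (simp add: AB ebas_def triple_of_def zmonom_def prod_UNIV_option fun_eq_iff mult_ac)
qed

lemma fpair_eq:
  assumes "(A, B) \<in> balanced" "w \<in> Cplus"
  shows "fpair h (A, B) w = pochhammer (of_real (ypot w) / (2 * h)) (mabs A) * zmonom A B w
    / (of_nat (mfact A) * of_nat (mfact B) * of_real (ypot w) ^ mabs A)"
proof -
  have a: "mabs A - mabs (A \<circ> Some) = A None" by (simp add: mabs_option)
  have b: "mabs A - mabs (B \<circ> Some) = B None" using assms by (simp add: balanced_def mabs_option)
  have "ebas (A \<circ> Some, B \<circ> Some, mabs A) = zmonom A B"
    using ebas_triple_of[OF assms(1)] by (simp add: triple_of_def)
  then show ?thesis
    using assms(2) by (simp add: fpair_def fbas_def triple_of_def mfact_option[of A] mfact_option[of B] a b mult_ac)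
qed

lemma fpair_outside: "w \<notin> Cplus \<Longrightarrow> fpair h t w = 0"
  by (auto simp: fpair_def fbas_def split: prod.splits)

lemma norm_zmonom_le:
  fixes w :: "'n::finite pt"
  assumes "1 \<le> R" "\<And>i. cmod (w $ i) \<le> R"
  shows "cmod (zmonom A B w) \<le> R ^ (mabs A + mabs B)"
proof -
  have "cmod (\<Prod>i\<in>UNIV. w $ i ^ A i) \<le> R ^ mabs A" for A
    unfolding mabs_def power_sum prod_norm[symmetric] norm_power
    by (rule prod_mono) (auto intro!: power_mono assms)
  moreover have "cmod (\<Prod>i\<in>UNIV. cnj (w $ i) ^ A i) \<le> R ^ mabs A" for A
    unfolding mabs_def power_sum prod_norm[symmetric] norm_power complex_mod_cnj
    by (rule prod_mono) (auto intro!: power_mono assms)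
  ultimately show ?thesis
    unfolding zmonom_def norm_mult power_add using assms(1) by (intro mult_mono) auto
qed

text \<open>
  The Pochhammer symbol contributes one factorial and the normalisation divides by two, up to
  geometric factors.
\<close>

lemma norm_fpair_le:
  fixes w :: "'n::finite pt"
  obtains C R where "C > 0" "R \<ge> 1"
    "\<And>t. t \<in> balanced \<Longrightarrow> cmod (fpair h t w) \<le> C * R ^ deg t / fact (deg t)"
proof (cases "w \<in> Cplus")
  case False
  then show ?thesis using that[of 1 1] by (simp add: fpair_outside)
next
  case True
  then have y: "ypot w > 0" by (simp add: Cplus_def)
  define y where "y = ypot w"
  define x where "x = complex_of_real y / (2 * h)"
  obtain m :: nat where m: "cmod x \<le> real m" using real_arch_simple by blast
  define \<rho> where "\<rho> = 1 + norm w"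
  define D :: real where "D = 2 ^ CARD('n option)"
  have D1: "D \<ge> 1" unfolding D_def by (rule one_le_power) simp
  have \<rho>1: "\<rho> \<ge> 1" by (simp add: \<rho>_def)
  define R where "R = 1 + 2 * \<rho>^2 * D^2 / y"
  have R1: "R \<ge> 1" using y D1 \<rho>1 by (simp add: R_def y_def)
  show ?thesis
  proof (rule that[of "2 ^ m" R])
    fix t :: "'n pidx" assume t: "t \<in> balanced"
    obtain A B where AB: "t = (A, B)" by fastforce
    have eqd: "mabs B = mabs A" using t by (simp add: AB balanced_def)
    define \<alpha> where "\<alpha> = mabs A"
    have fA: "real (fact \<alpha>) \<le> D ^ \<alpha> * mfact A"
      using of_nat_mono[OF fact_mabs_le[of A], where 'a = real] by (simp add: D_def \<alpha>_def power_mult_distrib)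
    have fB: "real (fact \<alpha>) \<le> D ^ \<alpha> * mfact B"
      using of_nat_mono[OF fact_mabs_le[of B], where 'a = real] by (simp add: D_def \<alpha>_def eqd power_mult_distrib)
    have z: "cmod (zmonom A B w) \<le> \<rho> ^ (\<alpha> + \<alpha>)"
      using norm_zmonom_le[of \<rho> w A B] \<rho>1 Finite_Cartesian_Product.norm_nth_le[of w]
      by (simp add: eqd \<alpha>_def \<rho>_def add_increasing)
    have p: "cmod (pochhammer x \<alpha>) \<le> 2 ^ (m + \<alpha>) * fact \<alpha>" by (rule norm_pochhammer_le[OF m])
    have "cmod (fpair h t w) = cmod (pochhammer x \<alpha>) * cmod (zmonom A B w) / (mfact A * mfact B * y ^ \<alpha>)"
      using fpair_eq[of A B w h] t True y
      by (simp add: AB x_def y_def \<alpha>_def norm_mult norm_divide norm_power)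
    also have "\<dots> \<le> (2 ^ (m + \<alpha>) * fact \<alpha>) * \<rho> ^ (\<alpha> + \<alpha>) / (mfact A * mfact B * y ^ \<alpha>)"
      using p z y y_def by (intro divide_right_mono mult_mono) auto
    also have "\<dots> \<le> (2 ^ (m + \<alpha>) * fact \<alpha>) * \<rho> ^ (\<alpha> + \<alpha>) / ((fact \<alpha> / D ^ \<alpha>) * (fact \<alpha> / D ^ \<alpha>) * y ^ \<alpha>)"
    proof (rule divide_left_mono)
      have p: "fact \<alpha> / D ^ \<alpha> \<le> real (mfact A)" and q: "fact \<alpha> / D ^ \<alpha> \<le> real (mfact B)"
        using fA fB D1 by (simp_all add: field_simps)
      show "(fact \<alpha> / D ^ \<alpha>) * (fact \<alpha> / D ^ \<alpha>) * y ^ \<alpha> \<le> mfact A * mfact B * y ^ \<alpha>"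
        unfolding of_nat_mult by (rule mult_right_mono[OF mult_mono[OF p q]]) (use y D1 y_def in auto)
      show "0 < real (mfact A * mfact B) * y ^ \<alpha> * (fact \<alpha> / D ^ \<alpha> * (fact \<alpha> / D ^ \<alpha>) * y ^ \<alpha>)"
        using y D1 y_def by simp
    qed (use \<rho>1 in auto)
    also have "\<dots> = 2 ^ m * (2 * \<rho>^2 * D^2 / y) ^ \<alpha> / fact \<alpha>"
      using y D1 y_def by (simp add: field_simps power_add power_mult_distrib power2_eq_square power_divide)
    also have "\<dots> \<le> 2 ^ m * R ^ \<alpha> / fact \<alpha>"
      using y D1 \<rho>1 by (intro divide_right_mono mult_left_mono power_mono) (auto simp: R_def y_def)
    finally show "cmod (fpair h t w) \<le> 2 ^ m * R ^ deg t / fact (deg t)" by (simp add: \<alpha>_def AB)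
  qed (use R1 in auto)
qed

section \<open>The Wick product of monomials\<close>

definition unit_mi :: "'a \<Rightarrow> 'a mi" where
  "unit_mi j = (\<lambda>i. if i = j then 1 else 0)"

lemma mabs_unit_mi [simp]: "mabs (unit_mi j) = 1"
  by (simp add: mabs_def unit_mi_def)

lemma unit_mi_self [simp]: "unit_mi j j = 1"
  by (simp add: unit_mi_def)

lemma diff_add_unit_mi: "0 < L j \<Longrightarrow> L - unit_mi j + unit_mi j = L"
  by (auto simp: unit_mi_def fun_eq_iff)

text \<open>Both sides count a multi-index \<open>L\<close> of degree \<open>m + 1\<close> with weight \<open>\<Sum>j. L j = m + 1\<close>.\<close>

lemma sum_mabs_Suc:
  fixes \<phi> :: "'a::finite mi \<Rightarrow> complex"
  shows "(\<Sum>j\<in>UNIV. \<Sum>L | mabs L = m. of_nat (Suc (L j)) * \<phi> (L + unit_mi j))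
    = of_nat (Suc m) * (\<Sum>L | mabs L = Suc m. \<phi> L)"
proof -
  have "(\<Sum>L | mabs L = m. of_nat (Suc (L j)) * \<phi> (L + unit_mi j))
      = (\<Sum>L | mabs L = Suc m. of_nat (L j) * \<phi> L)" for j
  proof -
    have "(\<Sum>L | mabs L = Suc m. of_nat (L j) * \<phi> L)
        = (\<Sum>L | mabs L = Suc m \<and> 0 < L j. of_nat (L j) * \<phi> L)"
      by (rule sum.mono_neutral_right) (auto simp: finite_mabs_eq)
    also have "\<dots> = (\<Sum>L | mabs L = m. of_nat (Suc (L j)) * \<phi> (L + unit_mi j))"
    proof (rule sum.reindex_bij_witness[of _ "\<lambda>L. L + unit_mi j" "\<lambda>L. L - unit_mi j"])
      fix L assume L: "L \<in> {L. mabs L = Suc m \<and> 0 < L j}"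
      then show eq: "L - unit_mi j + unit_mi j = L" by (simp add: diff_add_unit_mi)
      have "mabs (L - unit_mi j) + 1 = mabs L" by (metis eq mabs_add mabs_unit_mi)
      then show "L - unit_mi j \<in> {L. mabs L = m}" using L by simp
      show "of_nat (Suc ((L - unit_mi j) j)) * \<phi> (L - unit_mi j + unit_mi j) = of_nat (L j) * \<phi> L"
        using L unfolding eq by simp
    qed auto
    finally show ?thesis ..
  qed
  then have "(\<Sum>j\<in>UNIV. \<Sum>L | mabs L = m. of_nat (Suc (L j)) * \<phi> (L + unit_mi j))
      = (\<Sum>L | mabs L = Suc m. \<Sum>j\<in>UNIV. of_nat (L j) * \<phi> L)"
    by (simp only:) (rule sum.swap)
  also have "\<dots> = (\<Sum>L | mabs L = Suc m. of_nat (mabs L) * \<phi> L)"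
    by (simp add: sum_distrib_right[symmetric] mabs_def of_nat_sum[symmetric] del: of_nat_sum)
  also have "\<dots> = (\<Sum>L | mabs L = Suc m. of_nat (Suc m) * \<phi> L)" by (rule sum.cong) auto
  finally show ?thesis by (simp only: sum_distrib_left)
qed

lemma has_derivative_monomial:
  fixes l :: "'a::finite \<Rightarrow> 'v::real_normed_vector \<Rightarrow> complex"
  assumes "\<And>i. bounded_linear (l i)"
  shows "((\<lambda>z. \<Prod>i\<in>UNIV. l i z ^ A i) has_derivative
    (\<lambda>v. \<Sum>j\<in>UNIV. of_nat (A j) * l j v * (\<Prod>i\<in>UNIV. l i z ^ (A - unit_mi j) i))) (at z)"
proof -
  have "((\<lambda>z. l i z ^ A i) has_derivative (\<lambda>v. of_nat (A i) * l i v * l i z ^ (A i - 1))) (at z)" for i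
  proof -
    have "(l i has_derivative l i) (at z)" by (rule bounded_linear_imp_has_derivative[OF assms])
    from has_derivative_power[OF this, of "A i"] show ?thesis by (simp add: mult_ac)
  qed
  then have "((\<lambda>z. \<Prod>i\<in>UNIV. l i z ^ A i) has_derivative
     (\<lambda>v. \<Sum>j\<in>UNIV. of_nat (A j) * l j v * l j z ^ (A j - 1) * (\<Prod>i\<in>UNIV - {j}. l i z ^ A i))) (at z)"
    by (intro has_derivative_prod)
  moreover have "l j z ^ (A j - 1) * (\<Prod>i\<in>UNIV - {j}. l i z ^ A i)
      = (\<Prod>i\<in>UNIV. l i z ^ (A - unit_mi j) i)" for j
  proof -
    have "(\<Prod>i\<in>UNIV - {j}. l i z ^ A i) = (\<Prod>i\<in>UNIV - {j}. l i z ^ (A - unit_mi j) i)"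
      by (rule prod.cong) (auto simp: unit_mi_def)
    then show ?thesis by (simp add: prod.remove[of UNIV j])
  qed
  ultimately show ?thesis by (simp add: mult.assoc)
qed

lemma has_derivative_zmonom:
  fixes A B :: "'s \<Rightarrow> 'n::finite option mi" and z :: "'n pt"
  shows
  "((\<lambda>z. \<Sum>s\<in>S. c s * zmonom (A s) (B s) z) has_derivative
    (\<lambda>v. \<Sum>s\<in>S. c s * ((\<Sum>j\<in>UNIV. of_nat (A s j) * v $ j * zmonom (A s - unit_mi j) (B s) z)
      + (\<Sum>j\<in>UNIV. of_nat (B s j) * cnj (v $ j) * zmonom (A s) (B s - unit_mi j) z)))) (at z)"
proof (rule has_derivative_sum)
  fix s
  have a: "((\<lambda>z :: 'n pt. \<Prod>i\<in>UNIV. (z $ i) ^ A s i) has_derivative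
    (\<lambda>v :: 'n pt. \<Sum>j\<in>UNIV. of_nat (A s j) * (v $ j) * (\<Prod>i\<in>UNIV. (z $ i) ^ (A s - unit_mi j) i))) (at z)"
    by (rule has_derivative_monomial) (rule bounded_linear_vec_nth)
  have b: "((\<lambda>z :: 'n pt. \<Prod>i\<in>UNIV. cnj (z $ i) ^ B s i) has_derivative
    (\<lambda>v :: 'n pt. \<Sum>j\<in>UNIV. of_nat (B s j) * cnj (v $ j) * (\<Prod>i\<in>UNIV. cnj (z $ i) ^ (B s - unit_mi j) i))) (at z)"
    by (rule has_derivative_monomial)
      (rule bounded_linear_compose[OF bounded_linear_cnj bounded_linear_vec_nth])
  have "((\<lambda>z. zmonom (A s) (B s) z) has_derivative
    (\<lambda>v. (\<Sum>j\<in>UNIV. of_nat (A s j) * v $ j * zmonom (A s - unit_mi j) (B s) z)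
      + (\<Sum>j\<in>UNIV. of_nat (B s j) * cnj (v $ j) * zmonom (A s) (B s - unit_mi j) z))) (at z)"
    unfolding zmonom_def using has_derivative_mult[OF a b]
    by (simp add: sum_distrib_left sum_distrib_right mult_ac add.commute)
  then show "((\<lambda>z. c s * zmonom (A s) (B s) z) has_derivative
    (\<lambda>v. c s * ((\<Sum>j\<in>UNIV. of_nat (A s j) * v $ j * zmonom (A s - unit_mi j) (B s) z)
      + (\<Sum>j\<in>UNIV. of_nat (B s j) * cnj (v $ j) * zmonom (A s) (B s - unit_mi j) z)))) (at z)"
    by (rule has_derivative_mult_right)
qed

lemma sum_axis:
  fixes i :: "'a::finite" and c :: complex
  shows
  "(\<Sum>j\<in>UNIV. f j * ((axis i c :: complex ^ 'a) $ j) * g j) = f i * c * (g i :: complex)"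
  "(\<Sum>j\<in>UNIV. f j * cnj ((axis i c :: complex ^ 'a) $ j) * g j) = f i * cnj c * (g i :: complex)"
proof -
  have "(\<Sum>j\<in>UNIV. f j * ((axis i c :: complex ^ 'a) $ j) * g j) = (\<Sum>j\<in>UNIV. if j = i then f j * c * g j else 0)"
    by (rule sum.cong) (auto simp: axis_def)
  then show "(\<Sum>j\<in>UNIV. f j * ((axis i c :: complex ^ 'a) $ j) * g j) = f i * c * (g i :: complex)" by simp
  have "(\<Sum>j\<in>UNIV. f j * cnj ((axis i c :: complex ^ 'a) $ j) * g j) = (\<Sum>j\<in>UNIV. if j = i then f j * cnj c * g j else 0)"
    by (rule sum.cong) (auto simp: axis_def)
  then show "(\<Sum>j\<in>UNIV. f j * cnj ((axis i c :: complex ^ 'a) $ j) * g j) = f i * cnj c * (g i :: complex)" by simp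
qed

lemma dz_zmonom:
  "dz i (\<lambda>z. \<Sum>s\<in>S. c s * zmonom (A s) (B s) z)
    = (\<lambda>z. \<Sum>s\<in>S. c s * of_nat (A s i) * zmonom (A s - unit_mi i) (B s) z)"
  unfolding dz_def frechet_derivative_at[OF has_derivative_zmonom, symmetric] sum_axis
  by (simp add: fun_eq_iff sum_distrib_left sum_subtractf[symmetric] sum_divide_distrib algebra_simps)

lemma dzbar_zmonom:
  "dzbar i (\<lambda>z. \<Sum>s\<in>S. c s * zmonom (A s) (B s) z)
    = (\<lambda>z. \<Sum>s\<in>S. c s * of_nat (B s i) * zmonom (A s) (B s - unit_mi i) z)"
  unfolding dzbar_def frechet_derivative_at[OF has_derivative_zmonom, symmetric] sum_axis
  by (simp add: fun_eq_iff sum_distrib_left sum.distrib[symmetric] sum_divide_distrib algebra_simps)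

definition wick_term :: "nat \<Rightarrow> 'n::finite cfn \<Rightarrow> 'n cfn \<Rightarrow> 'n cfn" where
  "wick_term r f g z = (\<Sum>is\<in>{is. length is = r}. \<Sum>js\<in>{js. length js = r}.
     (\<Prod>k<r. gmet (is ! k) (js ! k)) * foldr dz is f z * foldr dzbar js g z)"

lemma sum_lists_snoc:
  fixes F :: "'a::finite list \<Rightarrow> 'b::comm_monoid_add"
  shows "(\<Sum>is | length is = Suc r. F is) = (\<Sum>i\<in>UNIV. \<Sum>is | length is = r. F (is @ [i]))"
proof -
  have fin: "finite {is :: 'a list. length is = r}"
    using finite_lists_length_eq[of "UNIV :: 'a set" r] by simp
  have "(\<Sum>i\<in>UNIV. \<Sum>is | length is = r. F (is @ [i]))
      = (\<Sum>(i, is)\<in>UNIV \<times> {is. length is = r}. F (is @ [i]))"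
    using fin by (simp add: sum.cartesian_product)
  also have "\<dots> = (\<Sum>is | length is = Suc r. F is)"
    by (rule sum.reindex_bij_witness[of _ "\<lambda>is. (last is, butlast is)" "\<lambda>(i, is). is @ [i]"])
      (auto simp: append_butlast_last_id length_Suc_conv_rev)
  finally show ?thesis ..
qed

text \<open>
  The innermost derivative is peeled off, so that the order of contraction can be handled by
  induction.
\<close>

lemma wick_term_Suc:
  "wick_term (Suc r) f g z = (\<Sum>i\<in>UNIV. gmet i i * wick_term r (dz i f) (dzbar i g) z)"
proof -
  have "wick_term (Suc r) f g z = (\<Sum>i\<in>UNIV. \<Sum>is | length is = r. \<Sum>j\<in>UNIV. \<Sum>js | length js = r.
      (\<Prod>k<r. gmet (is ! k) (js ! k)) * gmet i j * foldr dz is (dz i f) z * foldr dzbar js (dzbar j g) z)"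
    unfolding wick_term_def sum_lists_snoc
    by (intro sum.cong refl) (auto simp: nth_append)
  also have "\<dots> = (\<Sum>i\<in>UNIV. \<Sum>is | length is = r. \<Sum>js | length js = r.
      (\<Prod>k<r. gmet (is ! k) (js ! k)) * gmet i i * foldr dz is (dz i f) z * foldr dzbar js (dzbar i g) z)"
  proof (intro sum.cong refl)
    fix i :: "'a option" and "is" :: "'a option list"
    define G where "G j = (\<Sum>js | length js = r.
      (\<Prod>k<r. gmet (is ! k) (js ! k)) * gmet i j * foldr dz is (dz i f) z * foldr dzbar js (dzbar j g) z)" for j
    have "G j = (if j = i then G i else 0)" for j
      by (auto simp: G_def gmet_def)
    then have "(\<Sum>j\<in>UNIV. G j) = (\<Sum>j\<in>UNIV. if j = i then G i else 0)" by (rule sum.cong[OF refl])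
    then show "(\<Sum>j\<in>UNIV. \<Sum>js | length js = r. (\<Prod>k<r. gmet (is ! k) (js ! k)) * gmet i j * foldr dz is (dz i f) z * foldr dzbar js (dzbar j g) z)
      = (\<Sum>js | length js = r. (\<Prod>k<r. gmet (is ! k) (js ! k)) * gmet i i * foldr dz is (dz i f) z * foldr dzbar js (dzbar i g) z)"
      by (simp add: G_def)
  qed
  finally show ?thesis by (simp add: wick_term_def sum_distrib_left mult_ac)
qed

text \<open>
  The coefficient with which the contraction of \<open>K\<close> between \<open>z\<^sup>A\<close> and \<open>cnj z\<^sup>D\<close> occurs, that is
  \<open>(1/K!) (d/dz)\<^sup>K z\<^sup>A (d/dcnj z)\<^sup>K cnj z\<^sup>D\<close> with the metric signs, without the remaining monomials.
\<close>

definition contraction :: "'n::finite option mi \<Rightarrow> 'n option mi \<Rightarrow> 'n option mi \<Rightarrow> complex" where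
  "contraction A D K = (\<Prod>i\<in>UNIV. gmet i i ^ K i * fact (K i) * of_nat (A i choose K i) * of_nat (D i choose K i))"

lemma contraction_Suc:
  "gmet i i * of_nat (A i) * of_nat (D i) * contraction (A - unit_mi i) (D - unit_mi i) K
    = of_nat (Suc (K i)) * contraction A D (K + unit_mi i)"
proof -
  define F where "F A D K j = gmet j j ^ K j * fact (K j) * of_nat (A j choose K j) * complex_of_nat (D j choose K j)"
    for A D K :: "'a option mi" and j
  have rest: "(\<Prod>j\<in>UNIV - {i}. F (A - unit_mi i) (D - unit_mi i) K j) = (\<Prod>j\<in>UNIV - {i}. F A D (K + unit_mi i) j)"
    by (rule prod.cong) (auto simp: F_def unit_mi_def)
  have abs: "of_nat (A i) * complex_of_nat (A i - 1 choose K i) = of_nat (Suc (K i)) * of_nat (A i choose Suc (K i))" for A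
    unfolding of_nat_mult[symmetric] by (simp only: binomial_absorption)
  have "gmet i i * of_nat (A i) * of_nat (D i) * F (A - unit_mi i) (D - unit_mi i) K i
      = gmet i i ^ Suc (K i) * fact (K i) * (of_nat (A i) * of_nat (A i - 1 choose K i)) * (of_nat (D i) * of_nat (D i - 1 choose K i))"
    by (simp add: F_def)
  also have "\<dots> = of_nat (Suc (K i)) * F A D (K + unit_mi i) i"
    unfolding abs by (simp add: F_def)
  finally show ?thesis
    using rest unfolding contraction_def F_def[symmetric] prod.remove[of UNIV i "F _ _ _", OF finite UNIV_I]
    by (simp add: mult.assoc[symmetric])
qed

lemma contraction_eq_0: "\<not> K \<le> A \<or> \<not> K \<le> D \<Longrightarrow> contraction A D K = 0"
  unfolding contraction_def by (auto simp: le_fun_def not_le intro!: prod_zero)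

text \<open>
  Contracting one more index \<open>i\<close> lowers both exponents, and each multi-index \<open>K\<close> of the next
  order is reached from \<open>K - e\<^sub>i\<close> with weight \<open>K i\<close>; these weights add up to the order.
\<close>

lemma wick_term_zmonom:
  "wick_term r (\<lambda>z. \<Sum>s\<in>S. c s * zmonom (A s) (B s) z) (\<lambda>z. \<Sum>t\<in>T. d t * zmonom (C t) (D t) z) z
   = (\<Sum>s\<in>S. \<Sum>t\<in>T. c s * d t * (fact r * (\<Sum>K | mabs K = r.
        contraction (A s) (D t) K * zmonom (A s - K + C t) (B s + (D t - K)) z)))"
proof (induction r arbitrary: c A d D)
  case 0
  have eq: "{K :: 'a option mi. mabs K = 0} = {0}" by (auto simp: mabs_def fun_eq_iff)
  have zm: "zmonom (A + C) (B + D) z = zmonom A B z * zmonom C D z" for A B C D :: "'a option mi"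
    by (simp add: zmonom_def power_add prod.distrib mult_ac)
  have c0: "contraction A D 0 = 1" "contraction A D (\<lambda>_. 0) = 1" "A - 0 = A" for A D :: "'a option mi"
    by (simp_all add: contraction_def)
  have "{is. is = []} = {[]}" by auto
  then show ?case
    by (simp only: wick_term_def eq c0 zm sum_product) (simp add: mult_ac sum_product c0 zm del: plus_fun_apply)
next
  case (Suc r)
  have series: "fact r * (of_nat (Suc r) * x) = fact (Suc r) * x" for x :: complex
    by (simp add: algebra_simps)
  have eq: "A s - unit_mi i - K = A s - (K + unit_mi i)" for i K s and A :: "'s \<Rightarrow> 'a option mi"
    by (simp add: fun_eq_iff add.commute)
  have eq': "A s - unit_mi i - K = A s - (K + unit_mi i)" for i K s and A :: "'t \<Rightarrow> 'a option mi"
    by (simp add: fun_eq_iff add.commute)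
  have "wick_term (Suc r) (\<lambda>z. \<Sum>s\<in>S. c s * zmonom (A s) (B s) z) (\<lambda>z. \<Sum>t\<in>T. d t * zmonom (C t) (D t) z) z
    = (\<Sum>i\<in>UNIV. gmet i i * (\<Sum>s\<in>S. \<Sum>t\<in>T. (c s * of_nat (A s i)) * (d t * of_nat (D t i)) * (fact r * (\<Sum>K | mabs K = r.
        contraction (A s - unit_mi i) (D t - unit_mi i) K
        * zmonom (A s - unit_mi i - K + C t) (B s + (D t - unit_mi i - K)) z))))"
    unfolding wick_term_Suc dz_zmonom dzbar_zmonom by (subst Suc.IH) (rule refl)
  also have "\<dots> = (\<Sum>i\<in>UNIV. \<Sum>s\<in>S. \<Sum>t\<in>T. c s * d t * (fact r * (\<Sum>K | mabs K = r.
        (gmet i i * of_nat (A s i) * of_nat (D t i) * contraction (A s - unit_mi i) (D t - unit_mi i) K)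
        * zmonom (A s - unit_mi i - K + C t) (B s + (D t - unit_mi i - K)) z)))"
    by (simp add: sum_distrib_left mult_ac)
  also have "\<dots> = (\<Sum>i\<in>UNIV. \<Sum>s\<in>S. \<Sum>t\<in>T. c s * d t * (fact r * (\<Sum>K | mabs K = r.
        of_nat (Suc (K i)) * (contraction (A s) (D t) (K + unit_mi i)
        * zmonom (A s - (K + unit_mi i) + C t) (B s + (D t - (K + unit_mi i))) z))))"
    unfolding contraction_Suc eq eq' by (simp add: mult.assoc)
  also have "\<dots> = (\<Sum>s\<in>S. \<Sum>t\<in>T. \<Sum>i\<in>UNIV. c s * d t * (fact r * (\<Sum>K | mabs K = r.
        of_nat (Suc (K i)) * (contraction (A s) (D t) (K + unit_mi i)
        * zmonom (A s - (K + unit_mi i) + C t) (B s + (D t - (K + unit_mi i))) z))))"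
    by (subst sum.swap, intro sum.cong refl, subst sum.swap, rule refl)
  also have "\<dots> = (\<Sum>s\<in>S. \<Sum>t\<in>T. c s * d t * (fact r * (\<Sum>i\<in>UNIV. \<Sum>K | mabs K = r.
        of_nat (Suc (K i)) * (contraction (A s) (D t) (K + unit_mi i)
        * zmonom (A s - (K + unit_mi i) + C t) (B s + (D t - (K + unit_mi i))) z))))"
    by (simp only: sum_distrib_left)
  also have "\<dots> = (\<Sum>s\<in>S. \<Sum>t\<in>T. c s * d t * (fact r * (of_nat (Suc r) * (\<Sum>K | mabs K = Suc r.
        contraction (A s) (D t) K * zmonom (A s - K + C t) (B s + (D t - K)) z))))"
    by (intro sum.cong refl arg_cong2[where f = "(*)"] sum_mabs_Suc)
  finally show ?case by (simp only: series)
qed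

lemma wick_zmonom:
  assumes "finite S" "finite T"
  shows "wick h (\<lambda>z. \<Sum>s\<in>S. c s * zmonom (A s) (B s) z) (\<lambda>z. \<Sum>t\<in>T. d t * zmonom (C t) (D t) z) z
   = (\<Sum>s\<in>S. \<Sum>t\<in>T. c s * d t * (\<Sum>K | K \<le> A s \<and> K \<le> D t.
        (2 * h) ^ mabs K * contraction (A s) (D t) K * zmonom (A s - K + C t) (B s + (D t - K)) z))"
proof -
  define M where "M = (\<Sum>s\<in>S. mabs (A s))"
  define X where "X s t K = (2 * h) ^ mabs K * contraction (A s) (D t) K * zmonom (A s - K + C t) (B s + (D t - K)) z"
    for s t K
  have M: "mabs (A s) \<le> M" if "s \<in> S" for s
    unfolding M_def using assms that by (intro member_le_sum) auto
  have X0: "X s t K = 0" if "\<not> (K \<le> A s \<and> K \<le> D t)" for s t K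
    using contraction_eq_0[of K "A s" "D t"] that by (auto simp: X_def)
  have term_eq: "(2 * h) ^ r / fact r * wick_term r (\<lambda>z. \<Sum>s\<in>S. c s * zmonom (A s) (B s) z) (\<lambda>z. \<Sum>t\<in>T. d t * zmonom (C t) (D t) z) z
      = (\<Sum>s\<in>S. \<Sum>t\<in>T. c s * d t * (\<Sum>K | mabs K = r. X s t K))" for r
    unfolding wick_term_zmonom sum_distrib_left X_def
    by (intro sum.cong refl) simp
  have "wick h (\<lambda>z. \<Sum>s\<in>S. c s * zmonom (A s) (B s) z) (\<lambda>z. \<Sum>t\<in>T. d t * zmonom (C t) (D t) z) z
    = (\<Sum>r. \<Sum>s\<in>S. \<Sum>t\<in>T. c s * d t * (\<Sum>K | mabs K = r. X s t K))"
    unfolding wick_def wick_term_def[symmetric] term_eq ..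
  also have "\<dots> = (\<Sum>r\<le>M. \<Sum>s\<in>S. \<Sum>t\<in>T. c s * d t * (\<Sum>K | mabs K = r. X s t K))"
  proof (rule suminf_finite)
    fix r assume "r \<notin> {..M}"
    then have "X s t K = 0" if "s \<in> S" "mabs K = r" for s t K
      using X0[of K s t] M[OF that(1)] mabs_mono[of K "A s"] that by auto
    then show "(\<Sum>s\<in>S. \<Sum>t\<in>T. c s * d t * (\<Sum>K | mabs K = r. X s t K)) = 0"
      by (intro sum.neutral ballI) simp
  qed simp
  also have "\<dots> = (\<Sum>s\<in>S. \<Sum>t\<in>T. \<Sum>r\<le>M. c s * d t * (\<Sum>K | mabs K = r. X s t K))"
    by (subst sum.swap, intro sum.cong refl, subst sum.swap, rule refl)
  also have "\<dots> = (\<Sum>s\<in>S. \<Sum>t\<in>T. c s * d t * (\<Sum>K | K \<le> A s \<and> K \<le> D t. X s t K))"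
  proof (intro sum.cong refl)
    fix s t assume s: "s \<in> S"
    have "(\<Sum>r\<le>M. \<Sum>K | mabs K = r. X s t K) = (\<Sum>K | mabs K \<le> M. X s t K)"
    proof -
      have "(\<Sum>r\<le>M. \<Sum>K | mabs K = r. X s t K) = (\<Sum>r\<le>M. \<Sum>K \<in> {K \<in> {K. mabs K \<le> M}. mabs K = r}. X s t K)"
        by (intro sum.cong refl) auto
      also have "\<dots> = (\<Sum>K | mabs K \<le> M. X s t K)"
        by (rule sum.group[OF finite_mabs_le]) auto
      finally show ?thesis .
    qed
    also have "\<dots> = (\<Sum>K | K \<le> A s \<and> K \<le> D t. X s t K)"
    proof (rule sum.mono_neutral_right[OF finite_mabs_le])
      show "{K. K \<le> A s \<and> K \<le> D t} \<subseteq> {K. mabs K \<le> M}"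
        using mabs_mono M[OF s] order_trans by blast
    qed (use X0 in auto)
    finally show "(\<Sum>r\<le>M. c s * d t * (\<Sum>K | mabs K = r. X s t K)) = c s * d t * (\<Sum>K | K \<le> A s \<and> K \<le> D t. X s t K)"
      by (simp add: sum_distrib_left[symmetric])
  qed
  finally show ?thesis unfolding X_def .
qed

section \<open>Injectivity of the expansion on the cone\<close>

text \<open>
  The coefficient families of the elements of the completion, with all seminorms finite.
\<close>

definition rapid :: "('n::finite pidx \<Rightarrow> complex) set" where
  "rapid = {c. (\<forall>t. t \<notin> balanced \<longrightarrow> c t = 0) \<and>
     (\<forall>\<epsilon>::real. 0 < \<epsilon> \<and> \<epsilon> < 1 \<longrightarrow> (\<exists>C>0. \<forall>t. cmod (c t) \<le> C * fact (deg t) powr \<epsilon>))}"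

text \<open>
  The functionals that can be applied termwise to \<open>rapid\<close> families, given by their values on the
  basis; evaluations at points are the first examples.
\<close>

definition tame :: "('n::finite pidx \<Rightarrow> complex) \<Rightarrow> bool" where
  "tame \<Lambda> \<longleftrightarrow> (\<exists>C>0. \<exists>R\<ge>1. \<forall>t\<in>balanced. cmod (\<Lambda> t) \<le> C * R ^ deg t / fact (deg t))"

definition pairing :: "('n::finite pidx \<Rightarrow> complex) \<Rightarrow> ('n pidx \<Rightarrow> complex) \<Rightarrow> complex" where
  "pairing \<Lambda> c = (\<Sum>\<^sub>\<infinity>t\<in>balanced. c t * \<Lambda> t)"

lemma rapid_outside: "c \<in> rapid \<Longrightarrow> t \<notin> balanced \<Longrightarrow> c t = 0"
  unfolding rapid_def by blast

lemma rapid_bound: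
  assumes "c \<in> rapid" "0 < \<epsilon>" "\<epsilon> < 1"
  obtains C where "C > 0" "\<And>t. cmod (c t) \<le> C * fact (deg t) powr \<epsilon>"
  using assms unfolding rapid_def by blast

lemma tameI:
  assumes "C > 0" "R \<ge> 1" "\<And>t. t \<in> balanced \<Longrightarrow> cmod (\<Lambda> t) \<le> C * R ^ deg t / fact (deg t)"
  shows "tame \<Lambda>"
  using assms unfolding tame_def by blast

lemma tame_fpair: "tame (\<lambda>t. fpair h t w)"
  using norm_fpair_le[of h w] unfolding tame_def by metis

text \<open>
  Since \<open>\<epsilon> < 1\<close>, the quotient \<open>fact n powr \<epsilon> / fact n\<close> still decays faster than any geometric
  sequence.
\<close>

lemma fact_powr_absorb:
  fixes R \<rho> \<epsilon> :: real
  assumes "R > 0" "\<rho> > 0" "\<epsilon> < 1"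
  obtains C where "C > 0" "\<And>n. R ^ n * fact n powr \<epsilon> / fact n \<le> C * \<rho> ^ n"
proof -
  obtain C where C: "C > 0" "\<And>n. (R / \<rho>) ^ n \<le> C * fact n powr (1 - \<epsilon>)"
    using power_le_fact_powr[of "R / \<rho>" "1 - \<epsilon>"] assms by auto
  show ?thesis
  proof (rule that[OF C(1)])
    fix n
    have eq: "fact n powr (1 - \<epsilon>) * fact n powr \<epsilon> = (fact n :: real)"
      by (simp add: powr_add[symmetric])
    have "R ^ n = (R / \<rho>) ^ n * \<rho> ^ n" using assms by (simp add: power_divide)
    also have "\<dots> \<le> (C * fact n powr (1 - \<epsilon>)) * \<rho> ^ n"
      using C(2)[of n] assms by (intro mult_right_mono) auto
    finally have "R ^ n * fact n powr \<epsilon> \<le> (C * fact n powr (1 - \<epsilon>)) * \<rho> ^ n * fact n powr \<epsilon>"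
      by (rule mult_right_mono) simp
    also have "\<dots> = C * \<rho> ^ n * fact n" using eq by (simp add: algebra_simps)
    finally show "R ^ n * fact n powr \<epsilon> / fact n \<le> C * \<rho> ^ n"
      by (simp add: divide_le_eq)
  qed
qed

lemma summable_on_balanced:
  fixes \<rho> :: real
  assumes "0 \<le> \<rho>" "\<rho> < 1"
  shows "(\<lambda>t :: 'n::finite pidx. \<rho> ^ deg t) summable_on balanced"
proof -
  have "(\<lambda>(A, B). sqrt \<rho> ^ mabs A * sqrt \<rho> ^ mabs B) summable_on (UNIV :: 'n option mi set) \<times> (UNIV :: 'n option mi set)"
    by (rule summable_on_prod_nonneg) (use assms in \<open>auto intro!: summable_on_mi_geometric\<close>)
  then have "(\<lambda>(A, B). sqrt \<rho> ^ mabs A * sqrt \<rho> ^ mabs B) summable_on (balanced :: 'n pidx set)"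
    by (rule summable_on_subset_banach) auto
  then show ?thesis
    by (rule summable_on_cong[THEN iffD1, rotated])
      (use assms in \<open>auto simp: balanced_def power_mult_distrib[symmetric]\<close>)
qed

lemma tame_bound:
  assumes "c \<in> rapid" "tame \<Lambda>" "\<rho> > 0"
  obtains K where "K > 0" "\<And>t. t \<in> balanced \<Longrightarrow> cmod (c t * \<Lambda> t) \<le> K * \<rho> ^ deg t"
proof -
  obtain C where C: "C > 0" "\<And>t. cmod (c t) \<le> C * fact (deg t) powr (1/2)"
    using rapid_bound[OF assms(1), of "1/2"] by auto
  obtain D R where D: "D > 0" "R \<ge> 1" "\<And>t. t \<in> balanced \<Longrightarrow> cmod (\<Lambda> t) \<le> D * R ^ deg t / fact (deg t)"
    using assms(2) unfolding tame_def by blast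
  obtain K where K: "K > 0" "\<And>n. R ^ n * fact n powr (1/2) / fact n \<le> K * \<rho> ^ n"
    using fact_powr_absorb[of R \<rho> "1/2"] D(2) assms(3) by auto
  show ?thesis
  proof (rule that[of "C * D * K"])
    fix t :: "'a pidx" assume t: "t \<in> balanced"
    have "cmod (c t * \<Lambda> t) \<le> (C * fact (deg t) powr (1/2)) * (D * R ^ deg t / fact (deg t))"
      unfolding norm_mult using C D(3)[OF t] by (intro mult_mono) (auto intro: order_trans[OF norm_ge_zero])
    also have "\<dots> = C * D * (R ^ deg t * fact (deg t) powr (1/2) / fact (deg t))" by simp
    also have "\<dots> \<le> C * D * (K * \<rho> ^ deg t)" using C D K by (intro mult_left_mono) auto
    finally show "cmod (c t * \<Lambda> t) \<le> C * D * K * \<rho> ^ deg t" by (simp add: mult.assoc)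
  qed (use C D K in auto)
qed

lemma norm_summable_pairing:
  fixes c :: "'n::finite pidx \<Rightarrow> complex"
  assumes "c \<in> rapid" "tame \<Lambda>"
  shows "(\<lambda>t. norm (c t * \<Lambda> t)) summable_on balanced"
proof -
  obtain K where "K > 0" "\<And>t. t \<in> balanced \<Longrightarrow> cmod (c t * \<Lambda> t) \<le> K * (1/2) ^ deg t"
    using tame_bound[OF assms, of "1/2"] by auto
  then show ?thesis
    by (intro Infinite_Sum.abs_summable_on_comparison_test'[where g = "\<lambda>t :: 'n pidx. K * (1/2) ^ deg t"]
        summable_on_cmult_right summable_on_balanced) auto
qed

lemma summable_pairing:
  assumes "c \<in> rapid" "tame \<Lambda>"
  shows "(\<lambda>t. c t * \<Lambda> t) summable_on balanced"
  by (rule abs_summable_summable[OF norm_summable_pairing[OF assms]])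

lemma finite_balanced_deg: "finite {t \<in> balanced. deg t = \<alpha>}"
  by (rule finite_subset[of _ "{A. mabs A = \<alpha>} \<times> {B. mabs B = \<alpha>}"])
    (auto simp: balanced_def finite_mabs_eq)

lemma finite_balanced_deg_le: "finite {t \<in> balanced. deg t \<le> \<alpha>}"
  by (rule finite_subset[of _ "{A. mabs A \<le> \<alpha>} \<times> {B. mabs B \<le> \<alpha>}"])
    (auto simp: balanced_def finite_mabs_le)

lemma has_sum_fibres:
  fixes f :: "'x \<Rightarrow> 'b::banach" and g :: "'x \<Rightarrow> 'u"
  assumes f: "(f has_sum S) X" and g: "g ` X \<subseteq> U"
  shows "((\<lambda>u. \<Sum>\<^sub>\<infinity>x\<in>{x \<in> X. g x = u}. f x) has_sum S) U"
proof -
  have eq: "(\<lambda>x. (g x, x)) ` X = Sigma U (\<lambda>u. {x \<in> X. g x = u})" using g by auto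
  have "((\<lambda>p. f (snd p)) has_sum S) ((\<lambda>x. (g x, x)) ` X)"
    using f by (subst has_sum_reindex) (auto simp: o_def inj_on_def)
  then show ?thesis
    unfolding eq
  proof (rule has_sum_SigmaD)
    fix u
    have "f summable_on {x \<in> X. g x = u}"
      by (rule summable_on_subset_banach[OF has_sum_imp_summable[OF f]]) auto
    then show "((\<lambda>x. f (snd (u, x))) has_sum (\<Sum>\<^sub>\<infinity>x\<in>{x \<in> X. g x = u}. f x)) {x \<in> X. g x = u}"
      by simp
  qed
qed

lemma has_sum_imp_sums_fibres:
  fixes f :: "'x \<Rightarrow> 'b::{banach,second_countable_topology}" and \<kappa> :: "'x \<Rightarrow> nat"
  assumes "(f has_sum S) X" and fin: "\<And>k. finite {x \<in> X. \<kappa> x = k}"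
  shows "(\<lambda>k. \<Sum>x | x \<in> X \<and> \<kappa> x = k. f x) sums S"
  using has_sum_imp_sums[OF has_sum_fibres[OF assms(1), of \<kappa> UNIV]] fin by simp

lemma zmonom_scale:
  "zmonom A B (\<chi> i. c * w $ i) = c ^ mabs A * cnj c ^ mabs B * zmonom A B w"
  by (simp add: zmonom_def power_mult_distrib prod.distrib mabs_def power_sum mult_ac)

lemma ypot_scale: "ypot (\<chi> i. c * w $ i) = (cmod c)\<^sup>2 * ypot w"
  by (simp add: ypot_def norm_mult power_mult_distrib sum_distrib_left right_diff_distrib)

text \<open>The point of the hyperboloid \<open>y = 1\<close> above the point \<open>v\<close> of the disc.\<close>

definition hyp_pt :: "('n::finite \<Rightarrow> complex) \<Rightarrow> 'n pt" where
  "hyp_pt v = (\<chi> i. complex_of_real (1 / sqrt (1 - (\<Sum>i\<in>UNIV. (cmod (v i))\<^sup>2))) *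
     ((\<chi> i. case i of None \<Rightarrow> 1 | Some j \<Rightarrow> v j) :: 'n pt) $ i)"

lemma ypot_hyp_pt:
  assumes "(\<Sum>i\<in>UNIV. (cmod (v i))\<^sup>2) < 1"
  shows "ypot (hyp_pt v) = 1"
  unfolding hyp_pt_def ypot_scale using assms
  by (simp add: ypot_def norm_divide power_divide)

lemma zmonom_hyp_pt:
  "zmonom A B (hyp_pt v) = of_real (1 / sqrt (1 - (\<Sum>i\<in>UNIV. (cmod (v i))\<^sup>2))) ^ (mabs A + mabs B)
    * ((\<Prod>i\<in>UNIV. v i ^ A (Some i)) * (\<Prod>i\<in>UNIV. cnj (v i) ^ B (Some i)))"
  unfolding hyp_pt_def zmonom_scale by (simp add: zmonom_def prod_UNIV_option power_add)

lemma sum_norm_less_1: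
  fixes v :: "'n::finite \<Rightarrow> complex"
  assumes "\<And>i. cmod (v i) < 1 / CARD('n)"
  shows "(\<Sum>i\<in>UNIV. (cmod (v i))\<^sup>2) < 1"
proof -
  have "(cmod (v i))\<^sup>2 < 1 / CARD('n)" for i
  proof -
    have "cmod (v i) < 1"
      using assms[of i] by (rule less_le_trans) simp
    then have "(cmod (v i))\<^sup>2 \<le> cmod (v i)" by (simp add: power2_eq_square mult_left_le)
    then show ?thesis using assms[of i] by simp
  qed
  then have "(\<Sum>i\<in>UNIV. (cmod (v i))\<^sup>2) < (\<Sum>i\<in>(UNIV :: 'n set). 1 / CARD('n))"
    by (intro sum_strict_mono) auto
  then show ?thesis by simp
qed

text \<open>
  In a fixed degree, homogeneity turns the values at the points \<open>hyp_pt v\<close> into a polynomial in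
  \<open>v\<close> and \<open>cnj v\<close> on a small polydisc, with the zeroth coordinate scaled to \<open>1\<close>.
\<close>

lemma homogeneous_independence:
  fixes c :: "'n::finite pidx \<Rightarrow> complex"
  assumes zero: "\<And>w. ypot w = 1 \<Longrightarrow> (\<Sum>t | t \<in> balanced \<and> deg t = N. c t * zmonom (fst t) (snd t) w) = 0"
    and t: "t \<in> balanced" "deg t = N"
  shows "c t = 0"
proof -
  define b where "b P Q = (if mabs P \<le> N \<and> mabs Q \<le> N then c (lift_mi N P, lift_mi N Q) else 0)"
    for P Q :: "'n mi"
  have "b P Q = 0" for P Q
  proof (rule monomial_independence[where \<delta> = "1 / CARD('n)" and \<rho> = "\<lambda>_ _. 1"])
    fix v :: "'n \<Rightarrow> complex" assume v: "\<And>i. cmod (v i) < 1 / CARD('n)"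
    define m where "m P Q = (\<Prod>i\<in>UNIV. v i ^ P i) * (\<Prod>i\<in>UNIV. cnj (v i) ^ Q i)" for P Q :: "'n mi"
    define s where "s = 1 - (\<Sum>i\<in>UNIV. (cmod (v i))\<^sup>2)"
    have s: "s > 0" using sum_norm_less_1[OF v] by (simp add: s_def)
    define X where "X = {P :: 'n mi. mabs P \<le> N} \<times> {Q :: 'n mi. mabs Q \<le> N}"
    have "0 = (\<Sum>t | t \<in> balanced \<and> deg t = N. c t * zmonom (fst t) (snd t) (hyp_pt v))"
      using zero[OF ypot_hyp_pt] s by (simp add: s_def)
    also have "\<dots> = (\<Sum>t | t \<in> balanced \<and> deg t = N.
        of_real (1 / sqrt s) ^ (N + N) * (c t * m (fst t \<circ> Some) (snd t \<circ> Some)))"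
      by (rule sum.cong) (auto simp: zmonom_hyp_pt balanced_def s_def m_def)
    also have "\<dots> = of_real (1 / sqrt s) ^ (N + N) *
        (\<Sum>t | t \<in> balanced \<and> deg t = N. c t * m (fst t \<circ> Some) (snd t \<circ> Some))"
      by (simp add: sum_distrib_left)
    also have "(\<Sum>t | t \<in> balanced \<and> deg t = N. c t * m (fst t \<circ> Some) (snd t \<circ> Some))
        = (\<Sum>(P, Q)\<in>X. b P Q * m P Q)"
      by (rule sum.reindex_bij_witness[of _ "\<lambda>(P, Q). (lift_mi N P, lift_mi N Q)"
            "\<lambda>(A, B). (A \<circ> Some, B \<circ> Some)"])
        (auto simp: X_def b_def balanced_def lift_mi_restrict mabs_lift_mi mabs_option)
    finally have "(\<Sum>(P, Q)\<in>X. b P Q * m P Q) = 0" using s by simp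
    then have "((\<lambda>(P, Q). b P Q * m P Q) has_sum 0) X"
      by (intro has_sum_finiteI) (auto simp: X_def finite_mabs_le)
    then have "((\<lambda>(P, Q). b P Q * m P Q) has_sum 0) UNIV"
      by (rule has_sum_cong_neutral[THEN iffD1, rotated -1]) (auto simp: X_def b_def split: if_splits)
    then show "((\<lambda>(P, Q). b P Q * 1 * ((\<Prod>i\<in>UNIV. v i ^ P i) * (\<Prod>i\<in>UNIV. cnj (v i) ^ Q i))) has_sum 0) UNIV"
      by (simp add: m_def)
  qed auto
  from this[of "fst t \<circ> Some" "snd t \<circ> Some"] show ?thesis
    using t by (cases t) (auto simp: b_def balanced_def lift_mi_restrict mabs_option split: if_splits)
qed

text \<open>
  The series defines an entire function of \<open>x = s h\<close> that vanishes on a ray, hence everywhere.  At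
  the points \<open>x = 0, -1, -2, \<dots>\<close> it is a finite sum, and these sums form a triangular system.
\<close>

lemma factorial_series_independence:
  fixes F :: "nat \<Rightarrow> complex" and h :: real
  assumes h: "h \<noteq> 0"
    and bound: "\<And>m::nat. \<exists>M. summable M \<and> (\<forall>x n. cmod x \<le> real m \<longrightarrow> cmod (pochhammer x n * F n) \<le> M n)"
    and zero: "\<And>s::real. s > 0 \<Longrightarrow> (\<lambda>n. pochhammer (of_real (s * h)) n * F n) sums 0"
  shows "F N = 0"
proof -
  obtain g where g: "\<And>x. (\<lambda>n. pochhammer x n * F n) sums g x"
    and gd: "\<And>x. g field_differentiable (at x)"
  proof -
    have "\<exists>g. \<forall>x\<in>UNIV. ((\<lambda>n. pochhammer x n * F n) sums g x) \<and> g field_differentiable (at x)"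
    proof (rule series_differentiable_comparison_complex)
      fix n and x :: complex
      have "(\<lambda>x. pochhammer x n) field_differentiable (at x)"
      proof (induction n)
        case (Suc n)
        have "(\<lambda>x. x + of_nat n) field_differentiable (at x)"
          by (intro field_differentiable_add field_differentiable_ident field_differentiable_const)
        with Suc show ?case unfolding pochhammer_Suc by (rule field_differentiable_mult)
      qed (simp add: field_differentiable_const)
      then show "(\<lambda>x. pochhammer x n * F n) field_differentiable (at x)"
        by (rule field_differentiable_mult) (rule field_differentiable_const)
    next
      fix x :: complex
      obtain m :: nat where m: "cmod x + 1 \<le> real m" using real_arch_simple by blast
      obtain M where M: "summable M" "\<And>x n. cmod x \<le> real m \<Longrightarrow> cmod (pochhammer x n * F n) \<le> M n"
        using bound[of m] by blast
      have M0: "M n \<ge> 0" for n using order_trans[OF norm_ge_zero M(2)[of 0 n]] by simp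
      show "\<exists>d h. 0 < d \<and> summable h \<and> range h \<subseteq> \<real>\<^sub>\<ge>\<^sub>0 \<and>
          (\<forall>\<^sub>F n in sequentially. \<forall>y\<in>ball x d \<inter> UNIV. cmod (pochhammer y n * F n) \<le> cmod (h n))"
      proof (rule exI[of _ 1], rule exI[of _ "\<lambda>n. complex_of_real (M n)"],
          intro conjI always_eventually allI ballI)
        fix n and y :: complex assume "y \<in> ball x 1 \<inter> UNIV"
        then have "cmod y \<le> real m" using m norm_triangle_ineq2[of y x] by (auto simp: dist_norm norm_minus_commute)
        then show "cmod (pochhammer y n * F n) \<le> cmod (complex_of_real (M n))"
          using M(2) M0 by simp
      qed (use M M0 in \<open>auto simp: summable_of_real\<close>)
    next
      fix g assume "\<forall>x\<in>UNIV. ((\<lambda>n. pochhammer x n * F n) sums g x) \<and> g field_differentiable (at x)"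
      then show "\<exists>g. \<forall>x\<in>UNIV. ((\<lambda>n. pochhammer x n * F n) sums g x) \<and> g field_differentiable (at x)"
        by blast
    qed simp
    then show ?thesis using that by blast
  qed
  have hol: "g holomorphic_on UNIV" using gd by (auto simp: holomorphic_on_def)
  have g0: "g x = 0" for x
  proof (rule analytic_continuation[OF hol, where U = "(\<lambda>s. of_real (s * h)) ` {0<..}" and \<xi> = "of_real h"])
    show "complex_of_real h islimpt (\<lambda>s. of_real (s * h)) ` {0<..}"
      unfolding islimpt_approachable
    proof safe
      fix e :: real assume e: "e > 0"
      define s where "s = 1 + e / (2 * \<bar>h\<bar>)"
      have "s * h - h = e / (2 * \<bar>h\<bar>) * h" by (simp add: s_def algebra_simps)
      then have "dist (complex_of_real (s * h)) (of_real h) = e / 2"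
        using h e by (simp only: dist_of_real dist_real_def) (simp add: abs_mult)
      moreover have "s > 0" using e h by (simp add: s_def add_pos_pos)
      moreover have "complex_of_real (s * h) \<noteq> of_real h" using calculation(1) e by auto
      ultimately show "\<exists>x'\<in>(\<lambda>s. complex_of_real (s * h)) ` {0<..}. x' \<noteq> complex_of_real h \<and> dist x' (complex_of_real h) < e"
        using e by (intro bexI[of _ "complex_of_real (s * h)"]) auto
    qed
    fix z assume "z \<in> (\<lambda>s. complex_of_real (s * h)) ` {0<..}"
    then show "g z = 0" using zero g sums_unique2 by blast
  qed auto
  show ?thesis
  proof (induction N rule: less_induct)
    case (less N)
    \<comment> \<open>At \<open>x = - N\<close> the series stops after the term of index \<open>N\<close>.\<close>
    have "(\<lambda>n. pochhammer (- of_nat N) n * F n) sums (\<Sum>n\<in>{..N}. pochhammer (- of_nat N) n * F n)"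
      by (rule sums_finite) (auto simp: pochhammer_of_nat_eq_0_lemma)
    then have "(\<Sum>n\<in>{..N}. pochhammer (- of_nat N) n * F n) = 0"
      using g g0 sums_unique2 by metis
    moreover have "(\<Sum>n\<in>{..N}. pochhammer (- of_nat N) n * F n) = pochhammer (- of_nat N) N * F N"
      using less by (subst sum.remove[of _ N]) (auto intro!: sum.neutral)
    ultimately show ?case by (simp add: pochhammer_same)
  qed
qed

text \<open>
  On the ray \<open>sqrt s w\<close> with \<open>y w = 1\<close>, the factor \<open>y\<^sup>-\<^sup>\<alpha>\<close> cancels the homogeneity of the monomial and
  \<open>s\<close> only enters through the Pochhammer symbol.  So the homogeneous parts vanish one by one, and
  then their coefficients.
\<close>

lemma pairing_fpair_injective:
  fixes c :: "'n::finite pidx \<Rightarrow> complex" and h :: real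
  assumes c: "c \<in> rapid" and h: "h \<noteq> 0"
    and zero: "\<And>w. w \<in> Cplus \<Longrightarrow> pairing (\<lambda>t. fpair (of_real h) t w) c = 0"
  shows "c = (\<lambda>_. 0)"
proof -
  define a where "a t = c t / (of_nat (mfact (fst t)) * of_nat (mfact (snd t)))" for t
  have F0: "(\<Sum>t | t \<in> balanced \<and> deg t = N. a t * zmonom (fst t) (snd t) w) = 0"
    if w: "ypot w = 1" for N w
  proof (rule factorial_series_independence[where h = "1 / (2 * h)" and F = "\<lambda>N. \<Sum>t | t \<in> balanced \<and> deg t = N. a t * zmonom (fst t) (snd t) w"])
    show "1 / (2 * h) \<noteq> 0" using h by simp
  next
    fix m :: nat
    define \<rho> where "\<rho> = 1 + norm w"
    define D :: real where "D = 2 ^ CARD('n option)"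
    have D1: "D \<ge> 1" unfolding D_def by (rule one_le_power) simp
    have \<rho>1: "\<rho> \<ge> 1" by (simp add: \<rho>_def)
    \<comment> \<open>a majorant of \<open>pochhammer x n\<close> times the monomials that is uniform in \<open>cmod x \<le> m\<close>\<close>
    define \<Lambda> where "\<Lambda> t = complex_of_real (2 ^ (m + deg t) * fact (deg t) * \<rho> ^ (2 * deg t)
        / (of_nat (mfact (fst t)) * of_nat (mfact (snd t))))" for t :: "'n pidx"
    have "tame \<Lambda>"
    proof (rule tameI[of "2 ^ m" "2 * \<rho>^2 * D^2"])
      show "1 \<le> 2 * \<rho>^2 * D^2"
        using mult_mono[of 1 "\<rho>^2" 1 "D^2"] D1 \<rho>1 by (simp add: one_le_power)
      fix t :: "'n pidx" assume t: "t \<in> balanced"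
      obtain A B where AB: "t = (A, B)" by fastforce
      have eqd: "mabs B = mabs A" using t by (simp add: AB balanced_def)
      define \<alpha> where "\<alpha> = mabs A"
      have "real (fact \<alpha>) \<le> D ^ \<alpha> * mfact A"
        using of_nat_mono[OF fact_mabs_le[of A], where 'a = real] by (simp add: D_def \<alpha>_def power_mult_distrib)
      then have p: "fact \<alpha> / D ^ \<alpha> \<le> real (mfact A)" using D1 by (simp add: field_simps)
      have "real (fact \<alpha>) \<le> D ^ \<alpha> * mfact B"
        using of_nat_mono[OF fact_mabs_le[of B], where 'a = real] by (simp add: D_def \<alpha>_def eqd power_mult_distrib)
      then have q: "fact \<alpha> / D ^ \<alpha> \<le> real (mfact B)" using D1 by (simp add: field_simps)
      have "cmod (\<Lambda> t) = 2 ^ (m + \<alpha>) * fact \<alpha> * \<rho> ^ (2 * \<alpha>) / (real (mfact A) * real (mfact B))"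
        using \<rho>1 by (simp add: \<Lambda>_def AB \<alpha>_def norm_mult norm_divide norm_power)
      also have "\<dots> \<le> 2 ^ (m + \<alpha>) * fact \<alpha> * \<rho> ^ (2 * \<alpha>) / (fact \<alpha> / D ^ \<alpha> * (fact \<alpha> / D ^ \<alpha>))"
      proof (rule divide_left_mono)
        show "fact \<alpha> / D ^ \<alpha> * (fact \<alpha> / D ^ \<alpha>) \<le> real (mfact A) * real (mfact B)"
          by (rule mult_mono[OF p q]) (use D1 in auto)
        show "0 < real (mfact A) * real (mfact B) * (fact \<alpha> / D ^ \<alpha> * (fact \<alpha> / D ^ \<alpha>))"
          using D1 by simp
      qed (use \<rho>1 in auto)
      also have "\<dots> = 2 ^ m * (2 * \<rho>^2 * D^2) ^ \<alpha> / fact \<alpha>"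
        using D1 by (simp add: field_simps power_add power_mult_distrib power2_eq_square power_mult)
      finally show "cmod (\<Lambda> t) \<le> 2 ^ m * (2 * \<rho>^2 * D^2) ^ deg t / fact (deg t)"
        by (simp add: AB \<alpha>_def)
    qed simp
    then have "(\<lambda>t. norm (c t * \<Lambda> t)) summable_on balanced" by (rule norm_summable_pairing[OF c])
    then have sm: "summable (\<lambda>n. \<Sum>t | t \<in> balanced \<and> deg t = n. norm (c t * \<Lambda> t))"
      using has_sum_imp_sums_fibres[OF has_sum_infsum finite_balanced_deg] sums_summable by blast
    have "cmod (pochhammer x n * (\<Sum>t | t \<in> balanced \<and> deg t = n. a t * zmonom (fst t) (snd t) w))
        \<le> (\<Sum>t | t \<in> balanced \<and> deg t = n. norm (c t * \<Lambda> t))" if x: "cmod x \<le> real m" for x n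
      unfolding sum_distrib_left
    proof (rule order_trans[OF norm_sum sum_mono])
      fix t :: "'n pidx" assume t: "t \<in> {t. t \<in> balanced \<and> deg t = n}"
      have z: "cmod (zmonom (fst t) (snd t) w) \<le> \<rho> ^ (2 * n)"
        using norm_zmonom_le[of \<rho> w "fst t" "snd t"] \<rho>1 Finite_Cartesian_Product.norm_nth_le[of w] t
        by (auto simp: balanced_def \<rho>_def add_increasing mult_2)
      have "cmod (pochhammer x n * (a t * zmonom (fst t) (snd t) w))
          = cmod (a t) * (cmod (pochhammer x n) * cmod (zmonom (fst t) (snd t) w))" by (simp add: norm_mult)
      also have "\<dots> \<le> cmod (a t) * ((2 ^ (m + n) * fact n) * \<rho> ^ (2 * n))"
        using norm_pochhammer_le[OF x, of n] z by (intro mult_left_mono mult_mono) auto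
      also have "\<dots> = norm (c t * \<Lambda> t)"
        using t \<rho>1 by (simp add: a_def \<Lambda>_def norm_mult norm_divide norm_power)
      finally show "cmod (pochhammer x n * (a t * zmonom (fst t) (snd t) w)) \<le> norm (c t * \<Lambda> t)" .
    qed
    then show "\<exists>M. summable M \<and> (\<forall>x n. cmod x \<le> real m \<longrightarrow>
        cmod (pochhammer x n * (\<Sum>t | t \<in> balanced \<and> deg t = n. a t * zmonom (fst t) (snd t) w)) \<le> M n)"
      using sm by blast
  next
    fix s :: real assume s: "s > 0"
    define w' where "w' = (\<chi> i. complex_of_real (sqrt s) * w $ i)"
    have y: "ypot w' = s" unfolding w'_def ypot_scale using w s by simp
    then have w': "w' \<in> Cplus" using s by (simp add: Cplus_def)
    have "((\<lambda>t. c t * fpair (of_real h) t w') has_sum 0) balanced"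
      using summable_pairing[OF c tame_fpair] zero[OF w'] by (simp add: has_sum_iff pairing_def)
    from has_sum_imp_sums_fibres[OF this finite_balanced_deg]
    have "(\<lambda>n. \<Sum>t | t \<in> balanced \<and> deg t = n. c t * fpair (of_real h) t w') sums 0" .
    moreover have "(\<Sum>t | t \<in> balanced \<and> deg t = n. c t * fpair (of_real h) t w')
        = pochhammer (of_real (s * (1 / (2 * h)))) n * (\<Sum>t | t \<in> balanced \<and> deg t = n. a t * zmonom (fst t) (snd t) w)" for n
      unfolding sum_distrib_left
    proof (intro sum.cong refl)
      fix t :: "'n pidx" assume t: "t \<in> {t. t \<in> balanced \<and> deg t = n}"
      then obtain A B where AB: "t = (A, B)" "mabs A = n" "mabs B = n" "(A, B) \<in> balanced"
        by (cases t) (auto simp: balanced_def)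
      have "complex_of_real (sqrt s) ^ n * complex_of_real (sqrt s) ^ n = of_real s ^ n"
        using s by (simp add: power_mult_distrib[symmetric] of_real_mult[symmetric] del: of_real_mult)
      then have "zmonom A B w' = of_real s ^ n * zmonom A B w"
        unfolding w'_def zmonom_scale using AB by simp
      then show "c t * fpair (of_real h) t w' = pochhammer (of_real (s * (1 / (2 * h)))) n * (a t * zmonom (fst t) (snd t) w)"
        using fpair_eq[OF AB(4) w', of "of_real h"] s y AB(2) by (simp add: AB(1) a_def)
    qed
    ultimately show "(\<lambda>n. pochhammer (of_real (s * (1 / (2 * h)))) n * (\<Sum>t | t \<in> balanced \<and> deg t = n. a t * zmonom (fst t) (snd t) w)) sums 0"
      by simp
  qed
  have "c t = 0" for t
  proof (cases "t \<in> balanced")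
    case True
    from homogeneous_independence[OF F0 True refl] have "a t = 0" by simp
    then show ?thesis using mfact_pos[of "fst t"] mfact_pos[of "snd t"] by (auto simp: a_def)
  next
    case False
    then show ?thesis by (rule rapid_outside[OF c])
  qed
  then show ?thesis by auto
qed

section \<open>Structure constants of the transported product\<close>

abbreviation zmon :: "'n::finite pidx \<Rightarrow> 'n cfn" where
  "zmon t \<equiv> zmonom (fst t) (snd t)"

text \<open>
  The first factor loses \<open>K\<close> holomorphic and the second factor \<open>K\<close> antiholomorphic variables.
\<close>

definition merge_idx :: "'n::finite pidx \<Rightarrow> 'n pidx \<Rightarrow> 'n option mi \<Rightarrow> 'n pidx" where
  "merge_idx s t K = (fst s - K + fst t, snd s + (snd t - K))"

definition contractions :: "'n::finite pidx \<Rightarrow> 'n pidx \<Rightarrow> 'n option mi set" where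
  "contractions s t = {K. K \<le> fst s \<and> K \<le> snd t}"

definition mfact2 :: "'n::finite pidx \<Rightarrow> nat" where
  "mfact2 t = mfact (fst t) * mfact (snd t)"

text \<open>
  The structure constants with respect to the basis \<open>fpair\<close>.  They do not depend on \<open>h\<close>: the
  monomial of index \<open>t\<close> corresponds to \<open>(2 h) ^ deg t * mfact2 t\<close> times a basis function, and by
  \<open>merge_degree\<close> the powers of \<open>2 h\<close> cancel the power \<open>(2 h) ^ mabs K\<close> of the contraction.
\<close>

definition struct_const :: "'n::finite pidx \<Rightarrow> 'n pidx \<Rightarrow> 'n option mi \<Rightarrow> complex" where
  "struct_const s t K = contraction (fst s) (snd t) K * of_nat (mfact2 (merge_idx s t K))
     / (of_nat (mfact2 s) * of_nat (mfact2 t))"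

lemma mfact2_pos [simp]: "0 < mfact2 t"
  by (simp add: mfact2_def)

lemma mfact2_nonzero [simp]: "mfact2 t \<noteq> 0"
  using mfact2_pos[of t] by linarith

lemma finite_mi_below: "finite {K. K \<le> (A :: 'a::finite mi)}"
  by (rule finite_subset[OF _ finite_mabs_le[of "mabs A"]]) (auto intro: mabs_mono)

lemma finite_contractions [simp]: "finite (contractions s t)"
  by (rule finite_subset[OF _ finite_mi_below[of "fst s"]]) (auto simp: contractions_def)

lemma merge_degree:
  assumes "s \<in> balanced" "t \<in> balanced" "K \<in> contractions s t"
  shows "merge_idx s t K \<in> balanced" "deg (merge_idx s t K) + mabs K = deg s + deg t"
    "mabs K \<le> deg s" "mabs K \<le> deg t"
proof -
  have K: "K \<le> fst s" "K \<le> snd t" using assms(3) by (auto simp: contractions_def)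
  show m: "mabs K \<le> deg s" "mabs K \<le> deg t"
    using mabs_mono[OF K(1)] mabs_mono[OF K(2)] assms(2) by (auto simp: balanced_def)
  show "merge_idx s t K \<in> balanced" "deg (merge_idx s t K) + mabs K = deg s + deg t"
    using assms m by (auto simp: merge_idx_def balanced_def mabs_diff[OF K(1)] mabs_diff[OF K(2)])
qed

subsection \<open>Linear combinations of monomials\<close>

lemma sum_fun_apply: "(\<Sum>i\<in>I. f i) x = (\<Sum>i\<in>I. f i x)"
  by (induction I rule: infinite_finite_induct) auto

lemma sum_cscale: "(\<Sum>i\<in>I. cscale (c i) (g i)) = (\<lambda>x. \<Sum>i\<in>I. c i * g i x)"
  by (auto simp: fun_eq_iff sum_fun_apply cscale_def)

lemma span_image_cases:
  assumes "p \<in> cfun.span (g ` X)"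
  obtains F c where "finite F" "F \<subseteq> X" "p = (\<lambda>x. \<Sum>i\<in>F. c i * g i x)"
proof -
  obtain T r where T: "finite T" "T \<subseteq> g ` X" and p: "p = (\<Sum>a\<in>T. cscale (r a) a)"
    using assms unfolding cfun.span_explicit by blast
  obtain F where F: "F \<subseteq> X" "inj_on g F" "T = g ` F" using T(2) unfolding subset_image_inj by blast
  have "p = (\<lambda>x. \<Sum>i\<in>F. r (g i) * g i x)"
    unfolding p F(3) sum.reindex[OF F(2)] o_def sum_cscale ..
  moreover have "finite F" using T(1) F finite_image_iff by blast
  ultimately show ?thesis using that[of F "r \<circ> g"] F(1) by simp
qed

lemma span_image_sum:
  assumes "F \<subseteq> X"
  shows "(\<lambda>x. \<Sum>i\<in>F. c i * g i x) \<in> cfun.span (g ` X)"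
  unfolding sum_cscale[symmetric] using assms
  by (intro cfun.span_sum cfun.span_scale cfun.span_base) auto

text \<open>
  Equating a polynomial in \<open>z\<close> and \<open>cnj z\<close> to \<open>0\<close> everywhere is the special case of finitely many
  terms of \<open>monomial_independence\<close>.
\<close>

lemma zmonom_independence:
  fixes c :: "'n::finite pidx \<Rightarrow> complex"
  assumes F: "finite F" and zero: "\<And>z. (\<Sum>t\<in>F. c t * zmon t z) = 0" and t: "t \<in> F"
  shows "c t = 0"
proof -
  define b where "b A B = (if (A, B) \<in> F then c (A, B) else 0)" for A B
  have "b A B = 0" for A B
  proof (rule monomial_independence[where \<delta> = 1 and \<rho> = "\<lambda>_ _. 1"])
    fix v :: "'n option \<Rightarrow> complex"
    have "((\<lambda>(A, B). b A B * zmonom A B (\<chi> i. v i)) has_sum 0) F"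
      using F zero[of "\<chi> i. v i"]
      by (intro has_sum_finiteI) (auto simp: b_def split_def)
    then have "((\<lambda>(A, B). b A B * zmonom A B (\<chi> i. v i)) has_sum 0) UNIV"
      by (rule has_sum_cong_neutral[THEN iffD1, rotated -1]) (auto simp: b_def split: if_splits)
    then show "((\<lambda>(A, B). b A B * 1 * ((\<Prod>i\<in>UNIV. v i ^ A i) * (\<Prod>i\<in>UNIV. cnj (v i) ^ B i))) has_sum 0) UNIV"
      by (simp add: zmonom_def)
  qed auto
  from this[of "fst t" "snd t"] show ?thesis using t by (simp add: b_def)
qed

lemma ebas_triples: "ebas ` triples = zmon ` (balanced :: 'n::finite pidx set)"
proof -
  have "ebas ` triples = ebas ` triple_of ` (balanced :: 'n pidx set)"
    using bij_betw_triple_of bij_betw_imp_surj_on by metis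
  also have "\<dots> = zmon ` (balanced :: 'n pidx set)"
    unfolding image_image by (rule image_cong) (auto simp: ebas_triple_of)
  finally show ?thesis .
qed

lemma inj_zmon: "inj (zmon :: 'n::finite pidx \<Rightarrow> 'n cfn)"
proof (rule injI, rule ccontr)
  fix s t :: "'n pidx" assume eq: "zmon s = zmon t" and ne: "s \<noteq> t"
  have "(if s = t then 1 else - 1) = (0 :: complex)"
  proof (rule zmonom_independence[of "{s, t}" "\<lambda>u. if u = t then 1 else - 1" s])
    fix z show "(\<Sum>u\<in>{s, t}. (if u = t then 1 else - 1) * zmon u z) = 0"
      using ne fun_cong[OF eq, of z] by simp
  qed auto
  then show False by (auto split: if_splits)
qed

lemma independent_zmon: "cfun.independent (zmon ` (X :: 'n::finite pidx set))"
  unfolding cfun.independent_explicit_module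
proof (intro allI impI)
  fix T u and v :: "'n cfn"
  assume T: "finite T" "T \<subseteq> zmon ` X" and zero: "(\<Sum>v\<in>T. cscale (u v) v) = 0" and v: "v \<in> T"
  obtain F where F: "T = zmon ` F" "finite F"
    using T finite_subset_image[OF T] by blast
  have inj: "inj_on zmon F" by (rule inj_on_subset[OF inj_zmon]) simp
  have "(\<Sum>t\<in>F. u (zmon t) * zmon t z) = 0" for z
  proof -
    have "(\<Sum>t\<in>F. cscale (u (zmon t)) (zmon t)) = 0"
      using zero unfolding F(1) sum.reindex[OF inj] o_def .
    from fun_cong[OF this, of z] show ?thesis unfolding sum_cscale by simp
  qed
  then show "u v = 0" using zmonom_independence[OF F(2), of "\<lambda>t. u (zmon t)"] v F(1) by blast
qed

text \<open>
  A rotation multiplies the monomial of index \<open>(A, B)\<close> by \<open>u ^ (\<bar>A\<bar> - \<bar>B\<bar>)\<close>, so only balanced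
  monomials survive in an invariant polynomial.
\<close>

lemma invpolys_eq_span: "invpolys = cfun.span (zmon ` (balanced :: 'n::finite pidx set))"
proof (rule set_eqI, rule iffI)
  fix p :: "'n cfn" assume p: "p \<in> invpolys"
  have range: "{zmonom A B | A B. True} = zmon ` (UNIV :: 'n pidx set)"
    by (auto simp: image_def)
  obtain F c where F: "finite F" and pF: "p = (\<lambda>z. \<Sum>t\<in>F. c t * zmon t z)"
    using p unfolding invpolys_def range by (auto elim: span_image_cases)
  have c0: "c t = 0" if t: "t \<in> F" "t \<notin> balanced" for t
  proof -
    \<comment> \<open>this phase multiplies the monomial of index \<open>t\<close> by \<open>-1\<close>\<close>
    define \<theta> where "\<theta> = pi / (real (mabs (fst t)) - real (mabs (snd t)))"
    define u where "u = cis \<theta>"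
    have ne: "mabs (fst t) \<noteq> mabs (snd t)" using t(2) by (auto simp: balanced_def split_def)
    have "u ^ mabs (fst t) * cnj u ^ mabs (snd t) = cis (real (mabs (fst t)) * \<theta> + real (mabs (snd t)) * (- \<theta>))"
      by (simp add: u_def cis_cnj Complex.DeMoivre cis_mult)
    also have "real (mabs (fst t)) * \<theta> + real (mabs (snd t)) * (- \<theta>) = (real (mabs (fst t)) - real (mabs (snd t))) * \<theta>"
      by (simp add: algebra_simps)
    also have "\<dots> = pi" using ne by (simp add: \<theta>_def)
    finally have u: "u ^ mabs (fst t) * cnj u ^ mabs (snd t) = - 1" by simp
    have "(\<Sum>t\<in>F. (c t * (u ^ mabs (fst t) * cnj u ^ mabs (snd t) - 1)) * zmon t z) = 0" for z
    proof -
      have "p (\<chi> i. u * z $ i) = p z" using p by (simp add: invpolys_def u_def)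
      then have "(\<Sum>t\<in>F. c t * (u ^ mabs (fst t) * cnj u ^ mabs (snd t) * zmon t z)) - (\<Sum>t\<in>F. c t * zmon t z) = 0"
        unfolding pF zmonom_scale by simp
      then show ?thesis unfolding sum_subtractf[symmetric] by (simp add: algebra_simps)
    qed
    from zmonom_independence[OF F this t(1)] show ?thesis unfolding u by simp
  qed
  have "p = (\<lambda>z. \<Sum>t\<in>F \<inter> balanced. c t * zmon t z)"
    unfolding pF by (rule ext, rule sum.mono_neutral_right[OF F]) (use c0 in auto)
  also have "\<dots> \<in> cfun.span (zmon ` balanced)" by (rule span_image_sum) auto
  finally show "p \<in> cfun.span (zmon ` balanced)" .
next
  fix p :: "'n cfn" assume p: "p \<in> cfun.span (zmon ` balanced)"
  obtain F c where F: "finite F" "F \<subseteq> balanced" and pF: "p = (\<lambda>z. \<Sum>t\<in>F. c t * zmon t z)"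
    by (rule span_image_cases[OF p])
  have "p \<in> cfun.span {zmonom A B | A B. True}"
    by (rule subsetD[OF cfun.span_mono p]) auto
  moreover have "p (\<chi> i. u * z $ i) = p z" if u: "cmod u = 1" for u z
  proof -
    have uu: "u * cnj u = 1" using u by (simp add: complex_norm_square[symmetric])
    have "u ^ mabs (fst t) * cnj u ^ mabs (snd t) = 1" if "t \<in> F" for t
      using that F(2) by (auto simp: balanced_def power_mult_distrib[symmetric] uu)
    then show ?thesis unfolding pF zmonom_scale by (intro sum.cong) auto
  qed
  ultimately show "p \<in> invpolys" by (simp add: invpolys_def)
qed

text \<open>
  The indices \<open>\<tau> i\<close> may coincide, as they do in products; the representation in the basis collects
  them.
\<close>

lemma Smap_family:
  fixes \<tau> :: "'i \<Rightarrow> 'n::finite pidx"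
  assumes I: "finite I" and \<tau>: "\<And>i. i \<in> I \<Longrightarrow> \<tau> i \<in> balanced"
  shows "Smap h (\<lambda>z. \<Sum>i\<in>I. c i * zmon (\<tau> i) z)
    = (\<lambda>w. \<Sum>i\<in>I. c i * ((2 * h) ^ deg (\<tau> i) * of_nat (mfact2 (\<tau> i)) * fpair h (\<tau> i) w))"
proof -
  define p where "p = (\<lambda>z. \<Sum>i\<in>I. c i * zmon (\<tau> i) z)"
  define S where "S t = (\<lambda>w. (2 * h) ^ deg t * of_nat (mfact2 t) * fpair h t w)" for t :: "'n pidx"
  define r where "r t = (\<Sum>i\<in>I. if \<tau> i = t then c i else 0)" for t
  have rep: "cfun.representation (ebas ` triples) p (zmon t) = r t" if "t \<in> balanced" for t
  proof -
    have p: "p = (\<Sum>i\<in>I. cscale (c i) (zmon (\<tau> i)))" by (simp add: p_def sum_cscale)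
    have ind: "cfun.independent (zmon ` (balanced :: 'n pidx set))" by (rule independent_zmon)
    have sp: "zmon (\<tau> i) \<in> cfun.span (zmon ` balanced)" if "i \<in> I" for i
      using \<tau>[OF that] by (intro cfun.span_base) auto
    have "cfun.representation (zmon ` balanced) p (zmon t)
        = (\<Sum>i\<in>I. cfun.representation (zmon ` balanced) (cscale (c i) (zmon (\<tau> i))) (zmon t))"
      unfolding p by (subst cfun.representation_sum[OF ind]) (auto intro: cfun.span_scale sp)
    also have "\<dots> = (\<Sum>i\<in>I. if \<tau> i = t then c i else 0)"
    proof (rule sum.cong[OF refl])
      fix i assume i: "i \<in> I"
      have "cfun.representation (zmon ` balanced) (zmon (\<tau> i)) (zmon t) = (if zmon t = zmon (\<tau> i) then 1 else 0)"
        using \<tau>[OF i] by (subst cfun.representation_basis[OF ind]) auto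
      then show "cfun.representation (zmon ` balanced) (cscale (c i) (zmon (\<tau> i))) (zmon t) = (if \<tau> i = t then c i else 0)"
        unfolding cfun.representation_scale[OF ind sp[OF i]] by (auto dest: injD[OF inj_zmon])
    qed
    finally show ?thesis by (simp add: ebas_triples r_def)
  qed
  have Sb: "Sbas h (triple_of t) = S t" if "t \<in> balanced" for t
  proof
    fix w
    obtain A B where t: "t = (A, B)" by fastforce
    show "Sbas h (triple_of t) w = S t w"
    proof (cases "w \<in> Cplus")
      case True
      then show ?thesis using that ebas_triple_of[of t]
        by (simp add: t S_def fpair_eq Sbas_def triple_of_def mfact2_def less_imp_neq[symmetric] mult_ac)
    next
      case False
      then show ?thesis by (auto simp: Sbas_def S_def fpair_outside split: prod.splits)
    qed
  qed
  define T where "T = {t \<in> balanced. r t \<noteq> 0}"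
  have "{t \<in> triples. cfun.representation (ebas ` triples) p (ebas t) \<noteq> 0} = triple_of ` T"
  proof -
    define q where "q = cfun.representation (ebas ` triples) p"
    have q: "q (ebas (triple_of t)) = r t" if "t \<in> balanced" for t
      unfolding q_def ebas_triple_of[OF that] by (rule rep[OF that])
    have "{t \<in> triples. q (ebas t) \<noteq> 0} = {t \<in> triple_of ` (balanced :: 'n pidx set). q (ebas t) \<noteq> 0}"
      using bij_betw_triple_of bij_betw_imp_surj_on by metis
    also have "\<dots> = triple_of ` {t \<in> balanced. q (ebas (triple_of t)) \<noteq> 0}" by blast
    also have "{t \<in> balanced. q (ebas (triple_of t)) \<noteq> 0} = T"
      unfolding T_def by (rule Collect_cong) (use q in auto)
    finally have "{t \<in> triples. q (ebas t) \<noteq> 0} = triple_of ` T" .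
    then show ?thesis by (simp add: q_def)
  qed
  then have "Smap h p = (\<Sum>t\<in>triple_of ` T. cscale (cfun.representation (ebas ` triples) p (ebas t)) (Sbas h t))"
    by (simp add: Smap_def)
  also have "\<dots> = (\<Sum>t\<in>T. cscale (r t) (S t))"
  proof (subst sum.reindex)
    show "inj_on triple_of T"
      by (rule inj_on_subset[OF bij_betw_imp_inj_on[OF bij_betw_triple_of]]) (auto simp: T_def)
  qed (auto intro!: sum.cong simp: T_def ebas_triple_of rep Sb)
  also have "\<dots> = (\<lambda>w. \<Sum>t\<in>T. r t * S t w)" by (rule sum_cscale)
  also have "\<dots> = (\<lambda>w. \<Sum>i\<in>I. c i * S (\<tau> i) w)"
  proof
    fix w
    have "(\<Sum>t\<in>T. r t * S t w) = (\<Sum>t\<in>\<tau> ` I. r t * S t w)"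
    proof (rule sum.mono_neutral_left)
      show "T \<subseteq> \<tau> ` I"
      proof
        fix t assume "t \<in> T"
        then have "(\<Sum>i\<in>I. if \<tau> i = t then c i else 0) \<noteq> 0" by (simp add: T_def r_def)
        then obtain i where "i \<in> I" "(if \<tau> i = t then c i else 0) \<noteq> 0"
          by (rule sum.not_neutral_contains_not_neutral)
        then show "t \<in> \<tau> ` I" by (auto split: if_splits)
      qed
      show "\<forall>t\<in>\<tau> ` I - T. r t * S t w = 0" using \<tau> by (auto simp: T_def)
    qed (use I in auto)
    also have "\<dots> = (\<Sum>t\<in>\<tau> ` I. \<Sum>i | i \<in> I \<and> \<tau> i = t. c i * S (\<tau> i) w)"
    proof (rule sum.cong[OF refl])
      fix t
      have "r t = (\<Sum>i | i \<in> I \<and> \<tau> i = t. c i)"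
        unfolding r_def using I by (subst sum.inter_filter[symmetric]) auto
      then show "r t * S t w = (\<Sum>i | i \<in> I \<and> \<tau> i = t. c i * S (\<tau> i) w)"
        by (simp add: sum_distrib_right)
    qed
    also have "\<dots> = (\<Sum>i\<in>I. c i * S (\<tau> i) w)"
      by (rule sum.group) (use I in auto)
    finally show "(\<Sum>t\<in>T. r t * S t w) = (\<Sum>i\<in>I. c i * S (\<tau> i) w)" .
  qed
  finally show ?thesis unfolding p_def S_def .
qed

lemma Smap_sum:
  assumes "finite F" "F \<subseteq> balanced"
  shows "Smap h (\<lambda>z. \<Sum>t\<in>F. c t * zmon t z)
    = (\<lambda>w. \<Sum>t\<in>F. c t * ((2 * h) ^ deg t * of_nat (mfact2 t) * fpair h t w))"
  by (rule Smap_family) (use assms in auto)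

lemma rapid_finite_support:
  assumes F: "finite F" "F \<subseteq> balanced"
  shows "(\<lambda>t. if t \<in> F then c t else 0) \<in> rapid"
  unfolding rapid_def
proof (intro CollectI conjI allI impI)
  fix t show "t \<notin> balanced \<Longrightarrow> (if t \<in> F then c t else 0) = 0" using F by auto
next
  fix \<epsilon> :: real assume \<epsilon>: "0 < \<epsilon> \<and> \<epsilon> < 1"
  show "\<exists>C>0. \<forall>t. cmod (if t \<in> F then c t else 0) \<le> C * fact (deg t) powr \<epsilon>"
  proof (intro exI[of _ "1 + (\<Sum>t\<in>F. cmod (c t))"] conjI allI)
    fix t
    have "cmod (if t \<in> F then c t else 0) \<le> (\<Sum>t\<in>F. cmod (c t))"
      using F(1) by (auto intro: member_le_sum sum_nonneg)
    also have "\<dots> \<le> (1 + (\<Sum>t\<in>F. cmod (c t))) * 1" by simp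
    also have "\<dots> \<le> (1 + (\<Sum>t\<in>F. cmod (c t))) * fact (deg t) powr \<epsilon>"
      using \<epsilon> by (intro mult_left_mono ge_one_powr_ge_zero) (auto simp: fact_ge_1 add_nonneg_nonneg sum_nonneg)
    finally show "cmod (if t \<in> F then c t else 0) \<le> (1 + (\<Sum>t\<in>F. cmod (c t))) * fact (deg t) powr \<epsilon>" .
  qed (simp add: add_pos_nonneg sum_nonneg)
qed

lemma pairing_finite_support:
  assumes F: "finite F" "F \<subseteq> balanced"
  shows "pairing \<Lambda> (\<lambda>t. if t \<in> F then c t else 0) = (\<Sum>t\<in>F. c t * \<Lambda> t)"
proof -
  have "pairing \<Lambda> (\<lambda>t. if t \<in> F then c t else 0) = (\<Sum>\<^sub>\<infinity>t\<in>F. c t * \<Lambda> t)"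
    unfolding pairing_def by (rule infsum_cong_neutral) (use F in auto)
  then show ?thesis using F by simp
qed

text \<open>
  The images of the monomials are nonzero multiples of the basis functions, whose coefficients are
  determined by \<open>pairing_fpair_injective\<close>.
\<close>

lemma inj_on_Smap:
  fixes h :: real
  assumes h: "h \<noteq> 0"
  shows "inj_on (Smap (of_real h)) (invpolys :: 'n::finite cfn set)"
proof (rule inj_onI)
  fix p q :: "'n cfn"
  assume pq: "p \<in> invpolys" "q \<in> invpolys" and eq: "Smap (of_real h) p = Smap (of_real h) q"
  obtain F c where F: "finite F" "F \<subseteq> balanced" and pF: "p = (\<lambda>z. \<Sum>t\<in>F. c t * zmon t z)"
    using pq(1) unfolding invpolys_eq_span by (rule span_image_cases)
  obtain G d where G: "finite G" "G \<subseteq> balanced" and qG: "q = (\<lambda>z. \<Sum>t\<in>G. d t * zmon t z)"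
    using pq(2) unfolding invpolys_eq_span by (rule span_image_cases)
  define H where "H = F \<union> G"
  have H: "finite H" "H \<subseteq> balanced" using F G by (auto simp: H_def)
  define c' where "c' t = (if t \<in> F then c t else 0)" for t
  define d' where "d' t = (if t \<in> G then d t else 0)" for t
  have pH: "p = (\<lambda>z. \<Sum>t\<in>H. c' t * zmon t z)" unfolding pF
    by (rule ext, rule sum.mono_neutral_cong_left) (use H in \<open>auto simp: H_def c'_def\<close>)
  have qH: "q = (\<lambda>z. \<Sum>t\<in>H. d' t * zmon t z)" unfolding qG
    by (rule ext, rule sum.mono_neutral_cong_left) (use H in \<open>auto simp: H_def d'_def\<close>)
  define k where "k t = (c' t - d' t) * ((2 * of_real h) ^ deg t * of_nat (mfact2 t))" for t
  have "(\<Sum>t\<in>H. k t * fpair (of_real h) t w) = 0" for w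
  proof -
    have "(\<Sum>t\<in>H. k t * fpair (of_real h) t w) = Smap (of_real h) p w - Smap (of_real h) q w"
      unfolding pH qH Smap_sum[OF H] by (simp add: k_def sum_subtractf[symmetric] algebra_simps)
    then show ?thesis by (simp add: eq)
  qed
  then have "(\<lambda>t. if t \<in> H then k t else 0) = (\<lambda>_. 0)"
    by (intro pairing_fpair_injective[OF rapid_finite_support[OF H] h])
      (simp add: pairing_finite_support[OF H])
  then have k0: "k t = 0" if "t \<in> H" for t using that by (metis (no_types))
  have "c' t = d' t" if "t \<in> H" for t
    using k0[OF that] h by (simp add: k_def)
  then show "p = q" unfolding pH qH by (intro ext sum.cong) auto
qed

text \<open>
  Dividing by \<open>N t = (2 h) ^ deg t * mfact2 t\<close> lifts a basis function to a monomial; the product of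
  the lifts is given by \<open>wick_zmonom\<close>.
\<close>

lemma tstar_fpair:
  fixes h :: real
  assumes h: "h \<noteq> 0" and F: "finite F" "F \<subseteq> balanced" and G: "finite G" "G \<subseteq> balanced"
  shows "tstar (of_real h) (\<lambda>w. \<Sum>s\<in>F. a s * fpair (of_real h) s w) (\<lambda>w. \<Sum>t\<in>G. b t * fpair (of_real h) t w)
    = (\<lambda>w. \<Sum>s\<in>F. \<Sum>t\<in>G. a s * b t * (\<Sum>K\<in>contractions s t. struct_const s t K * fpair (of_real h) (merge_idx s t K) w))"
proof -
  define N :: "'a pidx \<Rightarrow> complex" where "N t = (2 * of_real h) ^ deg t * of_nat (mfact2 t)" for t
  have N0: "N t \<noteq> 0" for t using h by (simp add: N_def)
  have inv: "the_inv_into invpolys (Smap (of_real h)) (\<lambda>w. \<Sum>s\<in>F. a s * fpair (of_real h) s w)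
      = (\<lambda>z. \<Sum>s\<in>F. a s / N s * zmon s z)" if "finite F" "F \<subseteq> balanced" for F a
  proof (rule the_inv_into_f_eq[OF inj_on_Smap[OF h]])
    show "Smap (of_real h) (\<lambda>z. \<Sum>s\<in>F. a s / N s * zmon s z) = (\<lambda>w. \<Sum>s\<in>F. a s * fpair (of_real h) s w)"
      unfolding Smap_sum[OF that] N_def[symmetric] using N0 by simp
    show "(\<lambda>z. \<Sum>s\<in>F. a s / N s * zmon s z) \<in> invpolys"
      unfolding invpolys_eq_span by (rule span_image_sum[OF that(2)])
  qed
  define I where "I = Sigma F (\<lambda>s. Sigma G (\<lambda>t. contractions s t))"
  have I: "finite I" using F G by (auto simp: I_def)
  define cf where "cf i = (case i of (s, t, K) \<Rightarrow>
    a s / N s * (b t / N t) * ((2 * of_real h) ^ mabs K * contraction (fst s) (snd t) K))" for i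
  define \<tau> where "\<tau> i = (case i of (s, t, K) \<Rightarrow> merge_idx s t K)" for i :: "'a pidx \<times> 'a pidx \<times> 'a option mi"
  have sum_I: "(\<Sum>i\<in>I. f i) = (\<Sum>s\<in>F. \<Sum>t\<in>G. \<Sum>K\<in>contractions s t. f (s, t, K))"
    for f :: "'a pidx \<times> 'a pidx \<times> 'a option mi \<Rightarrow> complex"
    unfolding I_def using F(1) G(1) by (simp add: sum.Sigma split_def)
  have wick: "wick (of_real h) (\<lambda>z. \<Sum>s\<in>F. a s / N s * zmon s z) (\<lambda>z. \<Sum>t\<in>G. b t / N t * zmon t z)
    = (\<lambda>z. \<Sum>i\<in>I. cf i * zmon (\<tau> i) z)"
    unfolding fun_eq_iff sum_I wick_zmonom[OF F(1) G(1)]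
    by (simp add: cf_def \<tau>_def merge_idx_def contractions_def sum_distrib_left mult.assoc)
  have \<tau>: "\<tau> i \<in> balanced" if "i \<in> I" for i
    using that subsetD[OF F(2)] subsetD[OF G(2)] unfolding \<tau>_def I_def
    by (cases i) (auto intro!: merge_degree(1))
  have "tstar (of_real h) (\<lambda>w. \<Sum>s\<in>F. a s * fpair (of_real h) s w) (\<lambda>w. \<Sum>t\<in>G. b t * fpair (of_real h) t w)
    = (\<lambda>w. \<Sum>i\<in>I. cf i * (N (\<tau> i) * fpair (of_real h) (\<tau> i) w))"
    unfolding tstar_def inv[OF F] inv[OF G] wick
    by (subst Smap_family[OF I \<tau>]) (simp_all only: N_def)
  also have "\<dots> = (\<lambda>w. \<Sum>(s, t, K)\<in>I. a s * b t * (struct_const s t K * fpair (of_real h) (merge_idx s t K) w))"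
  proof (intro ext sum.cong refl)
    fix w i assume "i \<in> I"
    moreover obtain A B C D K where i: "i = ((A, B), (C, D), K)" by (metis prod.exhaust)
    ultimately have "((A, B), (C, D), K) \<in> I" by simp
    then have st: "(A, B) \<in> balanced" "(C, D) \<in> balanced" "K \<in> contractions (A, B) (C, D)"
      using F G by (auto simp: I_def)
    have d: "(2 * complex_of_real h) ^ mabs K * (2 * of_real h) ^ deg (merge_idx (A, B) (C, D) K) = (2 * of_real h) ^ mabs A * (2 * of_real h) ^ mabs C"
      using merge_degree(2)[OF st] unfolding power_add[symmetric] by (simp only: fst_conv add.commute)
    have q: "(2 * complex_of_real h) ^ mabs K * N (merge_idx (A, B) (C, D) K) / (N (A, B) * N (C, D))
      = of_nat (mfact2 (merge_idx (A, B) (C, D) K)) / (of_nat (mfact2 (A, B)) * of_nat (mfact2 (C, D)))"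
      using d h by (simp add: N_def mult.assoc[symmetric])
    have "a (A, B) / N (A, B) * (b (C, D) / N (C, D)) * ((2 * complex_of_real h) ^ mabs K * contraction A D K)
        * (N (merge_idx (A, B) (C, D) K) * fpair (of_real h) (merge_idx (A, B) (C, D) K) w)
      = a (A, B) * b (C, D) * contraction A D K * fpair (of_real h) (merge_idx (A, B) (C, D) K) w
        * ((2 * complex_of_real h) ^ mabs K * N (merge_idx (A, B) (C, D) K) / (N (A, B) * N (C, D)))"
      by (simp only: times_divide_eq_right times_divide_eq_left divide_divide_eq_left mult_ac)
    also have "\<dots> = a (A, B) * b (C, D) * (struct_const (A, B) (C, D) K * fpair (of_real h) (merge_idx (A, B) (C, D) K) w)"
      unfolding q struct_const_def by (simp add: mult_ac)
    finally show "cf i * (N (\<tau> i) * fpair (of_real h) (\<tau> i) w)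
        = (case i of (s, t, K) \<Rightarrow> a s * b t * (struct_const s t K * fpair (of_real h) (merge_idx s t K) w))"
      by (simp only: i cf_def \<tau>_def prod.case fst_conv snd_conv)
  qed
  also have "\<dots> = (\<lambda>w. \<Sum>s\<in>F. \<Sum>t\<in>G. a s * b t * (\<Sum>K\<in>contractions s t. struct_const s t K * fpair (of_real h) (merge_idx s t K) w))"
    unfolding sum_I by (simp add: sum_distrib_left)
  finally show ?thesis .
qed

section \<open>The product on coefficient families\<close>

lemma norm_gmet_diag [simp]: "cmod (gmet i i) = 1"
  by (simp add: gmet_def)

lemma binomial_contraction_le:
  fixes a b c d k :: nat
  assumes k: "k \<le> a" "k \<le> d"
  shows "fact k * (a choose k) * (d choose k) * (fact (a - k + c) * fact (b + (d - k)))
    \<le> (2 ^ (a - k + c) * 2 ^ (b + (d - k)) * (fact a * fact b * (fact c * fact d)) :: nat)"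
proof -
  have ca: "fact k * fact (a - k) * (a choose k) = (fact a :: nat)" by (rule binomial_fact_lemma[OF k(1)])
  have cd: "fact k * fact (d - k) * (d choose k) = (fact d :: nat)" by (rule binomial_fact_lemma[OF k(2)])
  have ca': "fact (a - k) * (a choose k) \<le> (fact a :: nat)"
    using mult_le_mono1[OF fact_ge_1[of k], of "fact (a - k) * (a choose k)"] unfolding ca[symmetric]
    by (simp add: mult.assoc)
  have "fact k * (a choose k) * (d choose k) * (fact (a - k + c) * fact (b + (d - k)))
      \<le> fact k * (a choose k) * (d choose k) * ((2 ^ (a - k + c) * (fact (a - k) * fact c)) * (2 ^ (b + (d - k)) * (fact b * fact (d - k))) :: nat)"
    by (intro mult_le_mono order_refl fact_add_le)
  also have "\<dots> = (fact (a - k) * (a choose k)) * (2 ^ (a - k + c) * 2 ^ (b + (d - k)) * fact b * fact c * (fact k * fact (d - k) * (d choose k)))"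
    by (simp add: mult_ac)
  also have "\<dots> \<le> fact a * (2 ^ (a - k + c) * 2 ^ (b + (d - k)) * fact b * fact c * fact d)"
    unfolding cd by (intro mult_le_mono ca' order_refl)
  finally show ?thesis by (simp add: mult_ac)
qed

text \<open>
  Coordinatewise, the factorials of the merged index are those of the factors up to binomial
  coefficients, and these are bounded by powers of \<open>2\<close>.
\<close>

lemma norm_struct_const_le:
  assumes "s \<in> balanced" "t \<in> balanced" "K \<in> contractions s t"
  shows "cmod (struct_const s t K) \<le> 4 ^ deg (merge_idx s t K)"
proof -
  obtain A B C D where st: "s = (A, B)" "t = (C, D)" by (metis prod.exhaust)
  have K: "K i \<le> A i" "K i \<le> D i" for i using assms(3) by (auto simp: contractions_def st le_fun_def)
  define X where "X i = fact (K i) * (A i choose K i) * (D i choose K i) * (fact (A i - K i + C i) * fact (B i + (D i - K i)))" for i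
  define Y where "Y i = (fact (A i) * fact (B i) * (fact (C i) * fact (D i)) :: nat)" for i
  have con: "cmod (contraction A D K) = real (\<Prod>i\<in>UNIV. fact (K i) * (A i choose K i) * (D i choose K i))"
    by (simp add: contraction_def norm_mult norm_power prod_norm[symmetric])
  have mu: "mfact2 (merge_idx s t K) = (\<Prod>i\<in>UNIV. fact (A i - K i + C i) * fact (B i + (D i - K i)))"
    by (simp add: mfact2_def merge_idx_def st mfact_def prod.distrib)
  have my: "mfact2 s * mfact2 t = (\<Prod>i\<in>UNIV. Y i)"
    by (simp add: mfact2_def st mfact_def prod.distrib Y_def)
  have "cmod (struct_const s t K) = real (\<Prod>i\<in>UNIV. X i) / real (\<Prod>i\<in>UNIV. Y i)"
    unfolding my[symmetric] struct_const_def norm_mult norm_divide st fst_conv snd_conv con mu[unfolded st] norm_of_nat of_nat_mult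
    by (simp add: X_def prod.distrib)
  also have "\<dots> \<le> real (\<Prod>i\<in>UNIV. 2 ^ (A i - K i + C i) * 2 ^ (B i + (D i - K i)))"
  proof -
    have "(\<Prod>i\<in>UNIV. X i) \<le> (\<Prod>i\<in>UNIV. 2 ^ (A i - K i + C i) * 2 ^ (B i + (D i - K i)) * Y i)"
      unfolding X_def Y_def using binomial_contraction_le[OF K] by (intro prod_mono) simp
    then have "(\<Prod>i\<in>UNIV. X i) \<le> (\<Prod>i\<in>UNIV. 2 ^ (A i - K i + C i) * 2 ^ (B i + (D i - K i))) * (\<Prod>i\<in>UNIV. Y i)"
      by (simp only: prod.distrib)
    then have "real (\<Prod>i\<in>UNIV. X i) \<le> real ((\<Prod>i\<in>UNIV. 2 ^ (A i - K i + C i) * 2 ^ (B i + (D i - K i))) * (\<Prod>i\<in>UNIV. Y i))"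
      by (simp only: of_nat_le_iff)
    moreover have "real (\<Prod>i\<in>UNIV. Y i) > 0" unfolding Y_def of_nat_0_less_iff by (rule prod_pos) simp
    ultimately show ?thesis by (simp only: of_nat_mult pos_divide_le_eq)
  qed
  also have "\<dots> = 2 ^ mabs (fst (merge_idx s t K)) * 2 ^ mabs (snd (merge_idx s t K))"
    by (simp add: prod.distrib mabs_def power_sum merge_idx_def st)
  also have "\<dots> = 4 ^ deg (merge_idx s t K)"
    using merge_degree(1)[OF assms] by (simp add: balanced_def split_def power_mult_distrib[symmetric])
  finally show ?thesis .
qed

text \<open>
  All terms of all products of two basis functions; \<open>merged\<close> tells to which basis function a term
  belongs.
\<close>

definition mergers :: "('n::finite pidx \<times> 'n pidx \<times> 'n option mi) set" where
  "mergers = Sigma balanced (\<lambda>s. Sigma balanced (\<lambda>t. contractions s t))"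

definition merged :: "'n::finite pidx \<times> 'n pidx \<times> 'n option mi \<Rightarrow> 'n pidx" where
  "merged = (\<lambda>(s, t, K). merge_idx s t K)"

definition cprod :: "('n::finite pidx \<Rightarrow> complex) \<Rightarrow> ('n pidx \<Rightarrow> complex) \<Rightarrow> 'n pidx \<Rightarrow> complex" where
  "cprod a b u = (\<Sum>(s, t, K) | (s, t, K) \<in> mergers \<and> merged (s, t, K) = u. a s * b t * struct_const s t K)"

lemma mergers_degree:
  assumes "(s, t, K) \<in> mergers"
  shows "merged (s, t, K) \<in> balanced" "deg s \<le> deg (merged (s, t, K))" "deg t \<le> deg (merged (s, t, K))"
    "mabs K \<le> deg (merged (s, t, K))"
  using merge_degree[of s t K] assms by (auto simp: mergers_def merged_def)

lemma merged_balanced: "x \<in> mergers \<Longrightarrow> merged x \<in> balanced"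
  by (metis mergers_degree(1) prod.exhaust)

lemma merged_fibre_subset:
  "{x \<in> mergers. merged x = u} \<subseteq> ({A. mabs A \<le> deg u} \<times> {A. mabs A \<le> deg u})
     \<times> ({A. mabs A \<le> deg u} \<times> {A. mabs A \<le> deg u}) \<times> {A. mabs A \<le> deg u}"
proof
  fix x assume x: "x \<in> {x \<in> mergers. merged x = u}"
  obtain A B C D K where ABCDK: "x = ((A, B), (C, D), K)" by (metis prod.exhaust)
  have "mabs A = mabs B" "mabs C = mabs D"
    using x by (auto simp: ABCDK mergers_def balanced_def)
  moreover have "mabs A \<le> deg u" "mabs C \<le> deg u" "mabs K \<le> deg u"
    using mergers_degree(2,3,4)[of "(A, B)" "(C, D)" K] x by (auto simp: ABCDK)
  ultimately show "x \<in> ({A. mabs A \<le> deg u} \<times> {A. mabs A \<le> deg u})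
     \<times> ({A. mabs A \<le> deg u} \<times> {A. mabs A \<le> deg u}) \<times> {A. mabs A \<le> deg u}"
    by (simp add: ABCDK)
qed

lemma finite_merged_fibre: "finite {x \<in> mergers. merged x = u}"
  by (rule finite_subset[OF merged_fibre_subset]) (intro finite_cartesian_product finite_mabs_le)

text \<open>
  All multi-indices of a term have degree at most that of the merged index, and there are only
  geometrically many multi-indices of bounded degree.
\<close>

lemma card_merged_fibre:
  "real (card {x \<in> mergers. merged x = (u :: 'n::finite pidx)}) \<le> ((2 ^ CARD('n option)) ^ 5) ^ deg u"
proof -
  define M where "M = {A :: 'n option mi. mabs A \<le> deg u}"
  have finM: "finite M" unfolding M_def by (rule finite_mabs_le)
  have "card {x \<in> mergers. merged x = u} \<le> card ((M \<times> M) \<times> (M \<times> M) \<times> M)"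
    by (rule card_mono) (use finM merged_fibre_subset[of u] in \<open>auto simp: M_def\<close>)
  also have "\<dots> = card M ^ 5" by (simp add: card_cartesian_product eval_nat_numeral)
  also have "\<dots> \<le> ((2 ^ CARD('n option)) ^ deg u) ^ 5"
    unfolding M_def by (intro power_mono card_mabs_le) auto
  also have "\<dots> = ((2 ^ CARD('n option)) ^ 5) ^ deg u"
    by (simp only: power_mult[symmetric] mult_ac)
  finally have "real (card {x \<in> mergers. merged x = u}) \<le> real (((2 ^ CARD('n option)) ^ 5) ^ deg u)"
    by (simp only: of_nat_le_iff)
  then show ?thesis by simp
qed

lemma cprod_eq: "cprod a b u = (\<Sum>x | x \<in> mergers \<and> merged x = u. a (fst x) * b (fst (snd x)) * struct_const (fst x) (fst (snd x)) (snd (snd x)))"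
  unfolding cprod_def by (rule sum.cong) auto

text \<open>
  The structure constants and the number of contributing index triples grow only geometrically
  in the degree.  One third of the exponent is spent on each factor, and one third absorbs the
  geometric growth.
\<close>

lemma cprod_bound:
  fixes \<epsilon> :: real
  assumes "0 < \<epsilon>"
  obtains M where "M > 0" "\<And>(a :: 'n::finite pidx \<Rightarrow> complex) b Ca Cb (u :: 'n pidx).
    \<lbrakk>\<And>t. cmod (a t) \<le> Ca * fact (deg t) powr (\<epsilon> / 3); \<And>t. cmod (b t) \<le> Cb * fact (deg t) powr (\<epsilon> / 3)\<rbrakk>
    \<Longrightarrow> cmod (cprod a b u) \<le> M * Ca * Cb * fact (deg u) powr \<epsilon>"
proof -
  define W :: real where "W = (2 ^ CARD('n option)) ^ 5"
  define L where "L = 4 * W"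
  have W: "W > 0" by (simp add: W_def)
  then have "L > 0" by (simp add: L_def)
  then obtain M where M: "M > 0" "\<And>n. L ^ n \<le> M * fact n powr (\<epsilon> / 3)"
    using power_le_fact_powr[of L "\<epsilon> / 3"] assms by auto
  show ?thesis
  proof (rule that[OF M(1)])
    fix a b :: "'n pidx \<Rightarrow> complex" and Ca Cb :: real and u :: "'n pidx"
    assume a: "\<And>t. cmod (a t) \<le> Ca * fact (deg t) powr (\<epsilon> / 3)"
      and b: "\<And>t. cmod (b t) \<le> Cb * fact (deg t) powr (\<epsilon> / 3)"
    have Ca: "Ca \<ge> 0" using order_trans[OF norm_ge_zero a[of undefined]] by (simp add: zero_le_mult_iff)
    have Cb: "Cb \<ge> 0" using order_trans[OF norm_ge_zero b[of undefined]] by (simp add: zero_le_mult_iff)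
    define \<Phi> where "\<Phi> = fact (deg u) powr (\<epsilon> / 3)"
    have mono: "fact m powr (\<epsilon> / 3) \<le> \<Phi>" if "m \<le> deg u" for m
      unfolding \<Phi>_def using that assms by (intro powr_mono2 fact_mono) auto
    have "cmod (cprod a b u) \<le> of_nat (card {x \<in> mergers. merged x = u}) * ((Ca * \<Phi>) * (Cb * \<Phi>) * 4 ^ deg u)"
      unfolding cprod_eq
    proof (rule order_trans[OF norm_sum sum_bounded_above])
      fix x assume x: "x \<in> {x \<in> mergers. merged x = u}"
      obtain s t K where xeq: "x = (s, t, K)" by (metis prod.exhaust)
      have m: "(s, t, K) \<in> mergers" "merged (s, t, K) = u" using x by (auto simp: xeq)
      have "cmod (a s) \<le> Ca * \<Phi>"
        using order_trans[OF a mult_left_mono[OF mono Ca]] mergers_degree(2)[OF m(1)] m(2) by simp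
      moreover have "cmod (b t) \<le> Cb * \<Phi>"
        using order_trans[OF b mult_left_mono[OF mono Cb]] mergers_degree(3)[OF m(1)] m(2) by simp
      moreover have "cmod (struct_const s t K) \<le> 4 ^ deg u"
        using norm_struct_const_le[of s t K] m by (auto simp: mergers_def merged_def)
      ultimately show "cmod (a (fst x) * b (fst (snd x)) * struct_const (fst x) (fst (snd x)) (snd (snd x)))
          \<le> (Ca * \<Phi>) * (Cb * \<Phi>) * 4 ^ deg u"
        unfolding xeq fst_conv snd_conv norm_mult using Ca Cb
        by (intro mult_mono) (auto simp: \<Phi>_def)
    qed
    also have "\<dots> \<le> W ^ deg u * ((Ca * \<Phi>) * (Cb * \<Phi>) * 4 ^ deg u)"
      unfolding W_def by (intro mult_right_mono card_merged_fibre) (use Ca Cb in \<open>auto simp: \<Phi>_def\<close>)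
    also have "\<dots> = Ca * Cb * (\<Phi> * \<Phi>) * L ^ deg u" by (simp add: L_def power_mult_distrib)
    also have "\<dots> \<le> Ca * Cb * (\<Phi> * \<Phi>) * (M * \<Phi>)"
      unfolding \<Phi>_def using M Ca Cb by (intro mult_left_mono) auto
    also have "\<dots> = M * Ca * Cb * (\<Phi> * \<Phi> * \<Phi>)" by simp
    also have "\<Phi> * \<Phi> * \<Phi> = fact (deg u) powr \<epsilon>"
      by (simp add: \<Phi>_def powr_add[symmetric])
    finally show "cmod (cprod a b u) \<le> M * Ca * Cb * fact (deg u) powr \<epsilon>" .
  qed
qed

lemma cprod_rapid:
  assumes "a \<in> rapid" "b \<in> rapid"
  shows "cprod a b \<in> rapid"
  unfolding rapid_def
proof (intro CollectI conjI allI impI)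
  fix u :: "'a pidx" assume "u \<notin> balanced"
  then have "{x \<in> mergers. merged x = u} = {}" using merged_balanced by blast
  then show "cprod a b u = 0" unfolding cprod_eq by (simp only: sum.empty)
next
  fix \<epsilon> :: real assume \<epsilon>: "0 < \<epsilon> \<and> \<epsilon> < 1"
  obtain Ca where Ca: "Ca > 0" "\<And>t. cmod (a t) \<le> Ca * fact (deg t) powr (\<epsilon> / 3)"
    using rapid_bound[OF assms(1), of "\<epsilon> / 3"] \<epsilon> by auto
  obtain Cb where Cb: "Cb > 0" "\<And>t. cmod (b t) \<le> Cb * fact (deg t) powr (\<epsilon> / 3)"
    using rapid_bound[OF assms(2), of "\<epsilon> / 3"] \<epsilon> by auto
  obtain M where M: "M > 0" "\<And>(a :: 'a pidx \<Rightarrow> complex) b Ca Cb (u :: 'a pidx).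
    \<lbrakk>\<And>t. cmod (a t) \<le> Ca * fact (deg t) powr (\<epsilon> / 3); \<And>t. cmod (b t) \<le> Cb * fact (deg t) powr (\<epsilon> / 3)\<rbrakk>
    \<Longrightarrow> cmod (cprod a b u) \<le> M * Ca * Cb * fact (deg u) powr \<epsilon>"
    using cprod_bound[of \<epsilon>] \<epsilon> by blast
  show "\<exists>C>0. \<forall>t. cmod (cprod a b t) \<le> C * fact (deg t) powr \<epsilon>"
    using M(2)[OF Ca(2) Cb(2)] M(1) Ca(1) Cb(1) by (intro exI[of _ "M * Ca * Cb"]) auto
qed

lemma summable_on_mergers:
  "(\<lambda>x :: 'n::finite pidx \<times> 'n pidx \<times> 'n option mi. (1/8 :: real) ^ deg (merged x)) summable_on mergers"
proof -
  define p where "p = (\<lambda>t :: 'n pidx. (1/2 :: real) ^ deg t)"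
  define q where "q = (\<lambda>K :: 'n option mi. (1/2 :: real) ^ mabs K)"
  define pq where "pq = (\<lambda>(t, K). p t * q K)"
  have p: "p summable_on balanced" "\<And>t. 0 \<le> p t"
    unfolding p_def by (rule summable_on_balanced) simp_all
  have q: "q summable_on UNIV" "\<And>K. 0 \<le> q K"
    unfolding q_def by (rule summable_on_mi_geometric) simp_all
  have pq: "pq summable_on balanced \<times> UNIV" "\<And>x. 0 \<le> pq x"
    unfolding pq_def using summable_on_prod_nonneg[OF p(1) q(1) p(2) q(2)] p(2) q(2) by auto
  have "(\<lambda>(s, x). p s * pq x) summable_on balanced \<times> (balanced \<times> UNIV)"
    by (rule summable_on_prod_nonneg[OF p(1) pq(1) p(2) pq(2)])
  then have "(\<lambda>(s, x). p s * pq x) summable_on mergers"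
    by (rule summable_on_subset_banach) (auto simp: mergers_def)
  then show ?thesis
  proof (rule summable_on_comparison_test)
    fix x :: "'n pidx \<times> 'n pidx \<times> 'n option mi" assume x: "x \<in> mergers"
    obtain s t K where xeq: "x = (s, t, K)" by (metis prod.exhaust)
    \<comment> \<open>one factor \<open>1/2\<close> for each of \<open>s\<close>, \<open>t\<close> and \<open>K\<close>, whose degrees are at most that of the merged index\<close>
    have "(1/8 :: real) = (1/2) ^ 3" by (simp add: eval_nat_numeral)
    then have "(1/8 :: real) ^ deg (merged x) = (1/2) ^ (3 * deg (merged x))" by (simp only: power_mult)
    also have "\<dots> \<le> (1/2) ^ (deg s + (deg t + mabs K))"
      using mergers_degree(2-4)[of s t K] x by (intro power_decreasing) (auto simp: xeq)
    finally show "(1/8) ^ deg (merged x) \<le> (case x of (s, x) \<Rightarrow> p s * pq x)"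
      unfolding xeq prod.case pq_def p_def q_def power_add .
  qed simp
qed

text \<open>
  Absolute convergence over all terms of the product justifies every rearrangement used later.
\<close>

lemma has_sum_pairing_cprod:
  fixes a b :: "'n::finite pidx \<Rightarrow> complex"
  assumes a: "a \<in> rapid" and b: "b \<in> rapid" and \<Lambda>: "tame \<Lambda>"
  shows "((\<lambda>(s, t, K). a s * b t * struct_const s t K * \<Lambda> (merge_idx s t K)) has_sum pairing \<Lambda> (cprod a b)) mergers"
proof -
  define f where "f = (\<lambda>(s, t, K). a s * b t * struct_const s t K * \<Lambda> (merge_idx s t K))"
  obtain Ca where Ca: "Ca > 0" "\<And>t. cmod (a t) \<le> Ca * fact (deg t) powr (1/4)"
    using rapid_bound[OF a, of "1/4"] by auto
  obtain Cb where Cb: "Cb > 0" "\<And>t. cmod (b t) \<le> Cb * fact (deg t) powr (1/4)"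
    using rapid_bound[OF b, of "1/4"] by auto
  obtain D R where D: "D > 0" "R \<ge> 1" "\<And>t. t \<in> balanced \<Longrightarrow> cmod (\<Lambda> t) \<le> D * R ^ deg t / fact (deg t)"
    using \<Lambda> unfolding tame_def by blast
  obtain M where M: "M > 0" "\<And>n. (4 * R) ^ n * fact n powr (1/2) / fact n \<le> M * (1/8) ^ n"
    using fact_powr_absorb[of "4 * R" "1/8" "1/2"] D(2) by auto
  have bound: "norm (f x) \<le> Ca * Cb * D * M * (1/8) ^ deg (merged x)" if x: "x \<in> mergers" for x
  proof -
    obtain s t K where xeq: "x = (s, t, K)" by (metis prod.exhaust)
    note m = mergers_degree[OF x[unfolded xeq]]
    define N where "N = deg (merged x)"
    define \<Phi> :: real where "\<Phi> = fact N powr (1/4)"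
    have mono: "fact m powr (1/4) \<le> \<Phi>" if "m \<le> N" for m
      unfolding \<Phi>_def using that by (intro powr_mono2 fact_mono) auto
    have "cmod (a s) \<le> Ca * \<Phi>"
      using order_trans[OF Ca(2) mult_left_mono[OF mono less_imp_le[OF Ca(1)]]] m(2) by (simp add: xeq N_def)
    moreover have "cmod (b t) \<le> Cb * \<Phi>"
      using order_trans[OF Cb(2) mult_left_mono[OF mono less_imp_le[OF Cb(1)]]] m(3) by (simp add: xeq N_def)
    moreover have "cmod (struct_const s t K) \<le> 4 ^ N"
      using norm_struct_const_le[of s t K] x by (auto simp: xeq mergers_def merged_def N_def)
    moreover have "cmod (\<Lambda> (merge_idx s t K)) \<le> D * R ^ N / fact N"
      using D(3)[OF m(1)] by (simp add: xeq merged_def N_def)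
    ultimately have "norm (f x) \<le> (Ca * \<Phi>) * (Cb * \<Phi>) * 4 ^ N * (D * R ^ N / fact N)"
      unfolding f_def xeq prod.case norm_mult using Ca Cb
      by (intro mult_mono) (auto simp: \<Phi>_def)
    also have "\<dots> = Ca * Cb * D * ((4 * R) ^ N * (\<Phi> * \<Phi>) / fact N)"
      by (simp add: power_mult_distrib)
    also have "\<Phi> * \<Phi> = fact N powr (1/2)" by (simp add: \<Phi>_def powr_add[symmetric])
    also have "Ca * Cb * D * ((4 * R) ^ N * fact N powr (1/2) / fact N) \<le> Ca * Cb * D * (M * (1/8) ^ N)"
      using Ca(1) Cb(1) D(1) M(2)[of N] by (intro mult_left_mono) auto
    finally show ?thesis by (simp add: N_def mult.assoc)
  qed
  have "(\<lambda>x. norm (f x)) summable_on mergers"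
    by (rule Infinite_Sum.abs_summable_on_comparison_test'[OF _ bound])
      (intro summable_on_cmult_right summable_on_mergers)
  then have sm: "f summable_on mergers" by (rule abs_summable_summable)
  then have "(f has_sum infsum f mergers) mergers" by simp
  then have "((\<lambda>u. \<Sum>\<^sub>\<infinity>x\<in>{x \<in> mergers. merged x = u}. f x) has_sum infsum f mergers) balanced"
    by (rule has_sum_fibres) (use merged_balanced in blast)
  moreover have "(\<Sum>\<^sub>\<infinity>x\<in>{x \<in> mergers. merged x = u}. f x) = cprod a b u * \<Lambda> u" for u
    unfolding infsum_finite[OF finite_merged_fibre] cprod_eq sum_distrib_right
    by (rule sum.cong) (auto simp: f_def merged_def)
  ultimately have "infsum f mergers = pairing \<Lambda> (cprod a b)"
    unfolding pairing_def by (simp add: infsumI)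
  then show ?thesis using sm unfolding f_def[symmetric] by (simp add: has_sum_iff)
qed

text \<open>
  The value of the functional \<open>\<Lambda>\<close> on the product of the basis functions \<open>s\<close> and \<open>t\<close>.
\<close>

definition pair_mult :: "('n::finite pidx \<Rightarrow> complex) \<Rightarrow> 'n pidx \<Rightarrow> 'n pidx \<Rightarrow> complex" where
  "pair_mult \<Lambda> s t = (\<Sum>K\<in>contractions s t. struct_const s t K * \<Lambda> (merge_idx s t K))"

lemma has_sum_pair_mult:
  assumes "a \<in> rapid" "b \<in> rapid" "tame \<Lambda>"
  shows "((\<lambda>(s, t). a s * b t * pair_mult \<Lambda> s t) has_sum pairing \<Lambda> (cprod a b)) (balanced \<times> balanced)"
proof -
  define f where "f = (\<lambda>(s, t, K). a s * b t * struct_const s t K * \<Lambda> (merge_idx s t K))"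
  have f: "(f has_sum pairing \<Lambda> (cprod a b)) mergers"
    unfolding f_def by (rule has_sum_pairing_cprod[OF assms])
  have eq: "mergers = (\<lambda>((s, t), K). (s, t, K)) ` Sigma (balanced \<times> balanced) (\<lambda>(s, t). contractions s t)"
    unfolding mergers_def by (force simp: image_iff)
  have inj: "inj_on (\<lambda>((s, t), K). (s, t, K)) (Sigma (balanced \<times> balanced) (\<lambda>(s, t). contractions s t))"
    by (auto simp: inj_on_def)
  have "((f \<circ> (\<lambda>((s, t), K). (s, t, K))) has_sum pairing \<Lambda> (cprod a b)) (Sigma (balanced \<times> balanced) (\<lambda>(s, t). contractions s t))"
    using f unfolding eq has_sum_reindex[OF inj] .
  then show ?thesis
  proof (rule has_sum_SigmaD)
    fix x :: "'a pidx \<times> 'a pidx" assume "x \<in> balanced \<times> balanced"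
    show "((\<lambda>K. (f \<circ> (\<lambda>((s, t), K). (s, t, K))) (x, K)) has_sum (case x of (s, t) \<Rightarrow> a s * b t * pair_mult \<Lambda> s t)) (case x of (s, t) \<Rightarrow> contractions s t)"
      by (cases x) (auto intro!: has_sum_finiteI simp: f_def pair_mult_def sum_distrib_left mult.assoc)
  qed
qed

subsection \<open>Conjugation\<close>

definition cconj :: "('n::finite pidx \<Rightarrow> complex) \<Rightarrow> 'n pidx \<Rightarrow> complex" where
  "cconj c t = cnj (c (prod.swap t))"

lemma swap_balanced [simp]: "prod.swap t \<in> balanced \<longleftrightarrow> t \<in> balanced"
  by (cases t) (auto simp: balanced_def)

lemma cconj_cconj [simp]: "cconj (cconj c) = c"
  by (simp add: cconj_def fun_eq_iff)

text \<open>
  The degree refers to the first multi-index; balancedness makes it invariant under the swap.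
\<close>

lemma cconj_bound:
  assumes "\<And>t. t \<notin> balanced \<Longrightarrow> c t = 0" "\<And>t. cmod (c t) \<le> C * fact (deg t) powr \<epsilon>"
  shows "cmod (cconj c t) \<le> C * fact (deg t) powr \<epsilon>"
proof (cases "t \<in> balanced")
  case True
  then have "mabs (snd t) = deg t" by (auto simp: balanced_def)
  then show ?thesis using assms(2)[of "prod.swap t"] by (simp add: cconj_def)
next
  case False
  have "0 \<le> C * fact (deg t) powr \<epsilon>" by (rule order_trans[OF norm_ge_zero assms(2)])
  then show ?thesis using False assms(1)[of "prod.swap t"] by (simp add: cconj_def)
qed

lemma cconj_rapid:
  assumes c: "c \<in> rapid"
  shows "cconj c \<in> rapid"
  unfolding rapid_def
proof (intro CollectI conjI allI impI)
  fix t :: "'a pidx" assume "t \<notin> balanced"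
  then show "cconj c t = 0" using rapid_outside[OF c, of "prod.swap t"] by (simp add: cconj_def)
next
  fix \<epsilon> :: real assume "0 < \<epsilon> \<and> \<epsilon> < 1"
  then obtain C where C: "C > 0" "\<And>t. cmod (c t) \<le> C * fact (deg t) powr \<epsilon>"
    using rapid_bound[OF c] by blast
  show "\<exists>C>0. \<forall>t. cmod (cconj c t) \<le> C * fact (deg t) powr \<epsilon>"
    using C(1) cconj_bound[of c C \<epsilon>, OF rapid_outside[OF c] C(2)] by blast
qed

text \<open>
  The constants are real and treat holomorphic and antiholomorphic exponents of the two factors
  symmetrically.
\<close>

lemma struct_const_swap:
  "struct_const (prod.swap t) (prod.swap s) K = cnj (struct_const s t K)"
  "merge_idx (prod.swap t) (prod.swap s) K = prod.swap (merge_idx s t K)"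
  "contractions (prod.swap t) (prod.swap s) = contractions s t"
proof -
  show m: "merge_idx (prod.swap t) (prod.swap s) K = prod.swap (merge_idx s t K)"
    by (simp add: merge_idx_def add.commute)
  show "contractions (prod.swap t) (prod.swap s) = contractions s t"
    by (auto simp: contractions_def)
  have g: "cnj (gmet i i) = gmet i i" for i :: "'a option" by (simp add: gmet_def)
  have "cnj (contraction (fst s) (snd t) K) = contraction (snd t) (fst s) K"
    by (simp add: contraction_def g mult_ac)
  then show "struct_const (prod.swap t) (prod.swap s) K = cnj (struct_const s t K)"
    unfolding struct_const_def m by (simp add: mfact2_def mult_ac)
qed

definition swap_merger :: "'n::finite pidx \<times> 'n pidx \<times> 'n option mi \<Rightarrow> 'n pidx \<times> 'n pidx \<times> 'n option mi" where
  "swap_merger x = (prod.swap (fst (snd x)), prod.swap (fst x), snd (snd x))"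

lemma swap_merger:
  "swap_merger (swap_merger x) = x"
  "swap_merger x \<in> mergers \<longleftrightarrow> x \<in> mergers"
  "merged (swap_merger x) = prod.swap (merged x)"
  by (cases x, cases "snd x", auto simp: swap_merger_def mergers_def merged_def struct_const_swap)+

lemma cprod_cconj: "cconj (cprod a b) = cprod (cconj b) (cconj a)"
proof
  fix u
  have "cconj (cprod a b) u = (\<Sum>x | x \<in> mergers \<and> merged x = prod.swap u.
      cnj (a (fst x) * b (fst (snd x)) * struct_const (fst x) (fst (snd x)) (snd (snd x))))"
    unfolding cconj_def cprod_eq cnj_sum ..
  also have "\<dots> = (\<Sum>x | x \<in> mergers \<and> merged x = u.
      cconj b (fst x) * cconj a (fst (snd x)) * struct_const (fst x) (fst (snd x)) (snd (snd x)))"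
  proof (rule sum.reindex_bij_witness[of _ swap_merger swap_merger])
    fix x
    show "cconj b (fst (swap_merger x)) * cconj a (fst (snd (swap_merger x)))
        * struct_const (fst (swap_merger x)) (fst (snd (swap_merger x))) (snd (snd (swap_merger x)))
      = cnj (a (fst x) * b (fst (snd x)) * struct_const (fst x) (fst (snd x)) (snd (snd x)))"
      unfolding swap_merger_def fst_conv snd_conv struct_const_swap(1) by (simp add: cconj_def mult_ac)
  next
    fix x show "x \<in> {x \<in> mergers. merged x = u} \<Longrightarrow> swap_merger x \<in> {x \<in> mergers. merged x = prod.swap u}"
      using swap_merger(2,3)[of x] by blast
  next
    fix x show "x \<in> {x \<in> mergers. merged x = prod.swap u} \<Longrightarrow> swap_merger x \<in> {x \<in> mergers. merged x = u}"
      using swap_merger(2,3)[of x] by simp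
  qed (rule swap_merger(1))+
  finally show "cconj (cprod a b) u = cprod (cconj b) (cconj a) u" unfolding cprod_eq .
qed

section \<open>The completed algebra in coordinates\<close>

definition series :: "complex \<Rightarrow> ('n::finite pidx \<Rightarrow> complex) \<Rightarrow> 'n cfn" where
  "series h c = (\<lambda>w. pairing (\<lambda>t. fpair h t w) c)"

definition rnorm :: "real \<Rightarrow> ('n::finite pidx \<Rightarrow> complex) \<Rightarrow> real" where
  "rnorm \<epsilon> c = (SUP t\<in>balanced. cmod (c t) / fact (deg t) powr \<epsilon>)"

lemma balanced_nonempty: "(\<lambda>_. 0, \<lambda>_. 0) \<in> balanced"
  by (simp add: balanced_def)

lemma rapidI:
  assumes "\<And>t. t \<notin> balanced \<Longrightarrow> c t = 0"
    and "\<And>\<epsilon>. 0 < \<epsilon> \<Longrightarrow> \<epsilon> < 1 \<Longrightarrow> \<exists>C>0. \<forall>t. cmod (c t) \<le> C * fact (deg t) powr \<epsilon>"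
  shows "c \<in> rapid"
  using assms unfolding rapid_def by blast

lemma rapid_add:
  assumes a: "a \<in> rapid" and b: "b \<in> rapid"
  shows "a + b \<in> rapid"
proof (rule rapidI)
  fix t :: "'a pidx" assume "t \<notin> balanced" then show "(a + b) t = 0"
    using rapid_outside[OF a] rapid_outside[OF b] by simp
next
  fix \<epsilon> :: real assume \<epsilon>: "0 < \<epsilon>" "\<epsilon> < 1"
  obtain A where A: "A > 0" "\<And>t. cmod (a t) \<le> A * fact (deg t) powr \<epsilon>" using rapid_bound[OF a \<epsilon>] by blast
  obtain B where B: "B > 0" "\<And>t. cmod (b t) \<le> B * fact (deg t) powr \<epsilon>" using rapid_bound[OF b \<epsilon>] by blast
  have "cmod ((a + b) t) \<le> (A + B) * fact (deg t) powr \<epsilon>" for t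
    using norm_triangle_ineq[of "a t" "b t"] A(2)[of t] B(2)[of t] by (simp add: distrib_right)
  then show "\<exists>C>0. \<forall>t. cmod ((a + b) t) \<le> C * fact (deg t) powr \<epsilon>"
    using A B by (intro exI[of _ "A + B"]) auto
qed

lemma rapid_scale:
  assumes a: "a \<in> rapid"
  shows "(\<lambda>t. k * a t) \<in> rapid"
proof (rule rapidI)
  fix t :: "'a pidx" assume "t \<notin> balanced" then show "k * a t = 0"
    using rapid_outside[OF a] by simp
next
  fix \<epsilon> :: real assume \<epsilon>: "0 < \<epsilon>" "\<epsilon> < 1"
  obtain A where A: "A > 0" "\<And>t. cmod (a t) \<le> A * fact (deg t) powr \<epsilon>" using rapid_bound[OF a \<epsilon>] by blast
  have "cmod (k * a t) \<le> ((cmod k + 1) * A) * fact (deg t) powr \<epsilon>" for t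
    unfolding norm_mult mult.assoc by (rule mult_mono) (use A(2) in auto)
  then show "\<exists>C>0. \<forall>t. cmod (k * a t) \<le> C * fact (deg t) powr \<epsilon>"
    using A by (intro exI[of _ "(cmod k + 1) * A"]) (simp add: add_nonneg_pos)
qed

lemma rapid_diff:
  assumes "a \<in> rapid" "b \<in> rapid"
  shows "a - b \<in> rapid"
proof -
  have eq: "a - b = a + (\<lambda>t. (- 1) * b t)" by (auto simp: fun_eq_iff)
  show ?thesis unfolding eq by (rule rapid_add[OF assms(1) rapid_scale[OF assms(2)]])
qed

lemma rapid_zero: "0 \<in> rapid"
  by (rule rapidI) (auto intro: exI[of _ 1])

lemma pairing_add:
  assumes "a \<in> rapid" "b \<in> rapid" "tame \<Lambda>"
  shows "pairing \<Lambda> (a + b) = pairing \<Lambda> a + pairing \<Lambda> b"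
  unfolding pairing_def using summable_pairing[OF assms(1,3)] summable_pairing[OF assms(2,3)]
  by (simp add: infsum_add[symmetric] distrib_right)

lemma pairing_scale: "pairing \<Lambda> (\<lambda>t. k * a t) = k * pairing \<Lambda> a"
  unfolding pairing_def by (simp add: infsum_cmult_right'[symmetric] mult.assoc)

lemma pairing_diff:
  assumes "a \<in> rapid" "b \<in> rapid" "tame \<Lambda>"
  shows "pairing \<Lambda> (a - b) = pairing \<Lambda> a - pairing \<Lambda> b"
proof -
  have eq: "a - b = a + (\<lambda>t. (- 1) * b t)" by (auto simp: fun_eq_iff)
  show ?thesis
    unfolding eq pairing_add[OF assms(1) rapid_scale[OF assms(2)] assms(3)] pairing_scale by simp
qed

lemma series_add: "a \<in> rapid \<Longrightarrow> b \<in> rapid \<Longrightarrow> series h (a + b) = series h a + series h b"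
  by (simp add: series_def fun_eq_iff pairing_add tame_fpair)

lemma series_diff: "a \<in> rapid \<Longrightarrow> b \<in> rapid \<Longrightarrow> series h (a - b) = series h a - series h b"
  by (simp add: series_def fun_eq_iff pairing_diff tame_fpair)

lemma series_scale: "series h (\<lambda>t. k * a t) = cscale k (series h a)"
  by (simp add: series_def fun_eq_iff pairing_scale cscale_def)

lemma inj_on_series:
  fixes h :: real
  assumes h: "h \<noteq> 0"
  shows "inj_on (series (of_real h)) rapid"
proof (rule inj_onI)
  fix a b :: "'n::finite pidx \<Rightarrow> complex"
  assume ab: "a \<in> rapid" "b \<in> rapid" and eq: "series (of_real h) a = series (of_real h) b"
  have "pairing (\<lambda>t. fpair (of_real h) t w) (a - b) = 0" for w
    using fun_cong[OF eq, of w] by (simp add: series_def pairing_diff[OF ab tame_fpair])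
  then have "a - b = (\<lambda>_. 0)"
    by (rule pairing_fpair_injective[OF rapid_diff[OF ab] h])
  then show "a = b" by (simp add: fun_eq_iff)
qed

subsection \<open>The seminorms\<close>

lemma rnorm_bdd:
  assumes "c \<in> rapid" "0 < \<epsilon>" "\<epsilon> < 1"
  shows "bdd_above ((\<lambda>t. cmod (c t) / fact (deg t) powr \<epsilon>) ` balanced)"
proof -
  obtain C where "C > 0" "\<And>t. cmod (c t) \<le> C * fact (deg t) powr \<epsilon>" using rapid_bound[OF assms] by blast
  then show ?thesis by (intro bdd_aboveI2[of _ _ C]) (simp add: divide_le_eq)
qed

lemma rnorm_nonneg:
  assumes "c \<in> rapid" "0 < \<epsilon>" "\<epsilon> < 1"
  shows "0 \<le> rnorm \<epsilon> c"
  unfolding rnorm_def using cSUP_upper2[OF rnorm_bdd[OF assms] balanced_nonempty] by simp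

lemma le_rnorm:
  assumes "c \<in> rapid" "0 < \<epsilon>" "\<epsilon> < 1"
  shows "cmod (c t) \<le> rnorm \<epsilon> c * fact (deg t) powr \<epsilon>"
proof (cases "t \<in> balanced")
  case True
  have "cmod (c t) / fact (deg t) powr \<epsilon> \<le> rnorm \<epsilon> c"
    unfolding rnorm_def by (rule cSUP_upper[OF True rnorm_bdd[OF assms]])
  then show ?thesis by (simp add: divide_le_eq)
next
  case False
  then show ?thesis using rapid_outside[OF assms(1)] rnorm_nonneg[OF assms] by simp
qed

lemma rnorm_leI:
  assumes "\<And>t. t \<in> balanced \<Longrightarrow> cmod (c t) \<le> C * fact (deg t) powr \<epsilon>"
  shows "rnorm \<epsilon> c \<le> C"
  unfolding rnorm_def
  by (rule cSUP_least) (use balanced_nonempty assms in \<open>auto simp: divide_le_eq\<close>)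

lemma rnorm_add_le:
  assumes "a \<in> rapid" "b \<in> rapid" "0 < \<epsilon>" "\<epsilon> < 1"
  shows "rnorm \<epsilon> (a + b) \<le> rnorm \<epsilon> a + rnorm \<epsilon> b"
proof (rule rnorm_leI)
  fix t
  show "cmod ((a + b) t) \<le> (rnorm \<epsilon> a + rnorm \<epsilon> b) * fact (deg t) powr \<epsilon>"
    using norm_triangle_ineq[of "a t" "b t"] le_rnorm[OF assms(1,3,4), of t] le_rnorm[OF assms(2,3,4), of t]
    by (simp add: distrib_right)
qed

text \<open>
  A smaller exponent gives a stronger seminorm; so the seminorms form a directed family.
\<close>

lemma rnorm_antimono:
  assumes "c \<in> rapid" "0 < \<delta>" "\<delta> \<le> \<epsilon>" "\<epsilon> < 1"
  shows "rnorm \<epsilon> c \<le> rnorm \<delta> c"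
proof (rule rnorm_leI)
  fix t
  have "cmod (c t) \<le> rnorm \<delta> c * fact (deg t) powr \<delta>" using assms by (intro le_rnorm) auto
  also have "\<dots> \<le> rnorm \<delta> c * fact (deg t) powr \<epsilon>"
    using assms rnorm_nonneg[of c \<delta>] by (intro mult_left_mono powr_mono) (auto simp: fact_ge_1)
  finally show "cmod (c t) \<le> rnorm \<delta> c * fact (deg t) powr \<epsilon>" .
qed

lemma rnorm_cconj: "rnorm \<epsilon> (cconj c) = rnorm \<epsilon> c"
proof -
  have "(\<lambda>t. cmod (cconj c t) / fact (deg t) powr \<epsilon>) ` balanced = (\<lambda>t. cmod (c t) / fact (deg t) powr \<epsilon>) ` prod.swap ` balanced"
    unfolding image_image by (rule image_cong) (auto simp: cconj_def balanced_def)
  also have "prod.swap ` (balanced :: 'a pidx set) = balanced"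
    by (auto simp: balanced_def image_iff)
  finally show ?thesis by (simp add: rnorm_def)
qed

lemma rnorm_cprod_le:
  assumes "0 < \<epsilon>" "\<epsilon> < 1"
  obtains M where "M > 0" "\<And>(a :: 'n::finite pidx \<Rightarrow> complex) b.
    \<lbrakk>a \<in> rapid; b \<in> rapid\<rbrakk> \<Longrightarrow> rnorm \<epsilon> (cprod a b) \<le> M * rnorm (\<epsilon> / 3) a * rnorm (\<epsilon> / 3) b"
proof -
  obtain M where M: "M > 0" "\<And>(a :: 'n pidx \<Rightarrow> complex) b Ca Cb (u :: 'n pidx).
    \<lbrakk>\<And>t. cmod (a t) \<le> Ca * fact (deg t) powr (\<epsilon> / 3); \<And>t. cmod (b t) \<le> Cb * fact (deg t) powr (\<epsilon> / 3)\<rbrakk>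
    \<Longrightarrow> cmod (cprod a b u) \<le> M * Ca * Cb * fact (deg u) powr \<epsilon>"
    using cprod_bound[of \<epsilon>] assms by blast
  show ?thesis
    by (rule that[OF M(1)], rule rnorm_leI, rule M(2)) (rule le_rnorm; use assms in simp)+
qed

lemma norm_pairing_le:
  assumes \<Lambda>: "tame (\<Lambda> :: 'n::finite pidx \<Rightarrow> complex)"
  obtains D where "D > 0" "\<And>c. c \<in> rapid \<Longrightarrow> cmod (pairing \<Lambda> c) \<le> D * rnorm (1/2) c"
proof -
  obtain C R where C: "C > 0" "R \<ge> 1" "\<And>t. t \<in> balanced \<Longrightarrow> cmod (\<Lambda> t) \<le> C * R ^ deg t / fact (deg t)"
    using \<Lambda> unfolding tame_def by blast
  obtain M where M: "M > 0" "\<And>n. R ^ n * fact n powr (1/2) / fact n \<le> M * (1/2) ^ n"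
    using fact_powr_absorb[of R "1/2" "1/2"] C(2) by auto
  define S where "S = (\<Sum>\<^sub>\<infinity>t\<in>(balanced :: 'n pidx set). (1/2 :: real) ^ deg t)"
  have sm: "(\<lambda>t. (1/2 :: real) ^ deg t) summable_on (balanced :: 'n pidx set)"
    by (rule summable_on_balanced) simp_all
  have S0: "S \<ge> 0" unfolding S_def by (rule infsum_nonneg) simp
  show ?thesis
  proof (rule that[of "C * M * (S + 1)"])
    fix c :: "'n pidx \<Rightarrow> complex" assume c: "c \<in> rapid"
    have n0: "rnorm (1/2) c \<ge> 0" by (rule rnorm_nonneg[OF c]) simp_all
    have bd: "norm (c t * \<Lambda> t) \<le> (rnorm (1/2) c * C * M) * (1/2) ^ deg t" if t: "t \<in> balanced" for t
    proof -
      have "norm (c t * \<Lambda> t) \<le> (rnorm (1/2) c * fact (deg t) powr (1/2)) * (C * R ^ deg t / fact (deg t))"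
        unfolding norm_mult using n0 by (intro mult_mono C(3)[OF t] le_rnorm[OF c]) auto
      also have "\<dots> = rnorm (1/2) c * C * (R ^ deg t * fact (deg t) powr (1/2) / fact (deg t))" by simp
      also have "\<dots> \<le> rnorm (1/2) c * C * (M * (1/2) ^ deg t)"
        using n0 C(1) by (intro mult_left_mono M(2)) auto
      finally show ?thesis by (simp only: mult.assoc)
    qed
    have "cmod (pairing \<Lambda> c) \<le> (\<Sum>\<^sub>\<infinity>t\<in>balanced. norm (c t * \<Lambda> t))"
      unfolding pairing_def by (rule norm_infsum_bound[OF norm_summable_pairing[OF c \<Lambda>]])
    also have "\<dots> \<le> (\<Sum>\<^sub>\<infinity>t\<in>(balanced :: 'n pidx set). (rnorm (1/2) c * C * M) * (1/2) ^ deg t)"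
    proof (rule infsum_mono)
      show "(\<lambda>t. norm (c t * \<Lambda> t)) summable_on balanced" by (rule norm_summable_pairing[OF c \<Lambda>])
      show "(\<lambda>t. (rnorm (1/2) c * C * M) * (1/2) ^ deg t) summable_on (balanced :: 'n pidx set)"
        by (rule summable_on_cmult_right[OF sm])
    qed (rule bd)
    also have "\<dots> = (rnorm (1/2) c * C * M) * S" unfolding S_def by (rule infsum_cmult_right')
    also have "\<dots> \<le> (rnorm (1/2) c * C * M) * (S + 1)" using n0 C M by (intro mult_left_mono) auto
    finally show "cmod (pairing \<Lambda> c) \<le> C * M * (S + 1) * rnorm (1/2) c" by (simp add: mult_ac)
  qed (use C M S0 in auto)
qed

definition restrict_coef :: "'n::finite pidx set \<Rightarrow> ('n pidx \<Rightarrow> complex) \<Rightarrow> 'n pidx \<Rightarrow> complex" where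
  "restrict_coef F c = (\<lambda>t. if t \<in> F then c t else 0)"

lemma restrict_coef_rapid:
  assumes c: "c \<in> rapid"
  shows "restrict_coef F c \<in> rapid"
proof (rule rapidI)
  fix \<epsilon> :: real assume "0 < \<epsilon>" "\<epsilon> < 1"
  then obtain C where C: "C > 0" "\<And>t. cmod (c t) \<le> C * fact (deg t) powr \<epsilon>"
    using rapid_bound[OF c] by blast
  have "cmod (restrict_coef F c t) \<le> C * fact (deg t) powr \<epsilon>" for t
    using C(1) C(2)[of t] by (simp add: restrict_coef_def)
  then show "\<exists>C>0. \<forall>t. cmod (restrict_coef F c t) \<le> C * fact (deg t) powr \<epsilon>"
    using C(1) by blast
qed (simp add: restrict_coef_def rapid_outside[OF c])

text \<open>
  Finite truncations converge: the seminorm for \<open>\<epsilon> / 2\<close> is finite, which makes the tail small in the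
  seminorm for \<open>\<epsilon>\<close>.
\<close>

lemma rnorm_restrict_coef:
  fixes c :: "'n::finite pidx \<Rightarrow> complex"
  assumes c: "c \<in> rapid" and \<epsilon>: "0 < \<epsilon>" "\<epsilon> < 1" and e: "e > 0"
  obtains F0 where "finite F0" "F0 \<subseteq> balanced"
    "\<And>F. F0 \<subseteq> F \<Longrightarrow> rnorm \<epsilon> (restrict_coef F c - c) \<le> e"
proof -
  obtain C where C: "C > 0" "\<And>t. cmod (c t) \<le> C * fact (deg t) powr (\<epsilon> / 2)"
    using rapid_bound[OF c, of "\<epsilon> / 2"] \<epsilon> by auto
  \<comment> \<open>beyond degree \<open>N\<close> the half of the exponent that was saved makes the coefficients small\<close>
  obtain D where D: "D > 0" "\<And>n. 2 ^ n \<le> D * fact n powr (\<epsilon> / 2)"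
    using power_le_fact_powr[of 2 "\<epsilon> / 2"] \<epsilon> by auto
  obtain N where N: "C * D / e < 2 ^ N" using real_arch_pow[of 2] by auto
  show ?thesis
  proof (rule that[of "{t :: 'n pidx. t \<in> balanced \<and> deg t \<le> N}"])
    show "finite {t :: 'n pidx. t \<in> balanced \<and> deg t \<le> N}" by (rule finite_balanced_deg_le)
    fix F :: "'n pidx set" assume F: "{t \<in> balanced. deg t \<le> N} \<subseteq> F"
    show "rnorm \<epsilon> (restrict_coef F c - c) \<le> e"
    proof (rule rnorm_leI)
      fix t :: "'n pidx" assume t: "t \<in> balanced"
      show "cmod ((restrict_coef F c - c) t) \<le> e * fact (deg t) powr \<epsilon>"
      proof (cases "t \<in> F")
        case True
        then show ?thesis using e by (simp add: restrict_coef_def)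
      next
        case False
        then have "N \<le> deg t" using t F by force
        then have "C * D / e \<le> 2 ^ deg t" using N by (smt (verit) power_increasing)
        also have "\<dots> \<le> D * fact (deg t) powr (\<epsilon> / 2)" by (rule D(2))
        finally have "C \<le> e * fact (deg t) powr (\<epsilon> / 2)" using D(1) e by (simp add: field_simps)
        then have "C * fact (deg t) powr (\<epsilon> / 2) \<le> e * fact (deg t) powr (\<epsilon> / 2) * fact (deg t) powr (\<epsilon> / 2)"
          by (rule mult_right_mono) simp
        also have "\<dots> = e * fact (deg t) powr \<epsilon>" by (simp add: powr_add[symmetric])
        finally show ?thesis using C(2)[of t] False by (simp add: restrict_coef_def)
      qed
    qed
  qed auto
qed

subsection \<open>Identification with the given function spaces\<close>

definition pull_coef :: "('n::finite mi \<times> 'n mi \<times> nat \<Rightarrow> complex) \<Rightarrow> 'n pidx \<Rightarrow> complex" where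
  "pull_coef c t = (if t \<in> balanced then c (triple_of t) else 0)"

definition push_coef :: "('n::finite pidx \<Rightarrow> complex) \<Rightarrow> 'n mi \<times> 'n mi \<times> nat \<Rightarrow> complex" where
  "push_coef c \<tau> = (if \<tau> \<in> triples then c (the_inv_into balanced triple_of \<tau>) else 0)"

lemma triples_eq: "triples = triple_of ` (balanced :: 'n::finite pidx set)"
  using bij_betw_triple_of bij_betw_imp_surj_on by metis

lemma push_coef_triple_of: "t \<in> balanced \<Longrightarrow> push_coef c (triple_of t) = c t"
  unfolding push_coef_def triples_eq
  by (simp add: the_inv_into_f_f[OF bij_betw_imp_inj_on[OF bij_betw_triple_of]])

lemma weight_image:
  "(\<lambda>(P, Q, \<alpha>). cmod (c (P, Q, \<alpha>)) / fact \<alpha> powr \<epsilon>) ` triples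
    = (\<lambda>t. cmod (c (triple_of t)) / fact (deg t) powr \<epsilon>) ` balanced"
  unfolding triples_eq image_image by (rule image_cong) (auto simp: triple_of_def split_def)

lemma pull_coef_rapid:
  assumes c: "c \<in> admissible"
  shows "pull_coef c \<in> rapid"
proof (rule rapidI)
  fix \<epsilon> :: real assume "0 < \<epsilon>" "\<epsilon> < 1"
  then have "bdd_above ((\<lambda>t. cmod (c (triple_of t)) / fact (deg t) powr \<epsilon>) ` balanced)"
    using c unfolding admissible_def weight_image by simp
  then obtain M where M: "\<And>t. t \<in> balanced \<Longrightarrow> cmod (c (triple_of t)) / fact (deg t) powr \<epsilon> \<le> M"
    by (auto simp: bdd_above_def)
  show "\<exists>C>0. \<forall>t. cmod (pull_coef c t) \<le> C * fact (deg t) powr \<epsilon>"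
  proof (intro exI[of _ "\<bar>M\<bar> + 1"] conjI allI)
    fix t :: "'a pidx"
    show "cmod (pull_coef c t) \<le> (\<bar>M\<bar> + 1) * fact (deg t) powr \<epsilon>"
    proof (cases "t \<in> balanced")
      case True
      have "cmod (c (triple_of t)) \<le> M * fact (deg t) powr \<epsilon>" using M[OF True] by (simp add: divide_le_eq)
      also have "\<dots> \<le> (\<bar>M\<bar> + 1) * fact (deg t) powr \<epsilon>" by (rule mult_right_mono) auto
      finally show ?thesis using True by (simp add: pull_coef_def)
    qed (simp add: pull_coef_def)
  qed simp
qed (simp add: pull_coef_def)

lemma push_coef_admissible:
  assumes c: "c \<in> rapid"
  shows "push_coef c \<in> admissible"
  unfolding admissible_def weight_image
proof (intro CollectI conjI allI impI)
  fix \<epsilon> :: real assume "0 < \<epsilon> \<and> \<epsilon> < 1"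
  then show "bdd_above ((\<lambda>t. cmod (push_coef c (triple_of t)) / fact (deg t) powr \<epsilon>) ` balanced)"
    using rnorm_bdd[OF c, of \<epsilon>] by (simp add: push_coef_triple_of cong: image_cong)
qed (simp add: push_coef_def)

lemma fseries_eq_series: "fseries h c = series h (pull_coef c)"
proof
  fix w
  have "fseries h c w = (\<Sum>\<^sub>\<infinity>t\<in>balanced. c (triple_of t) * fbas h (triple_of t) w)"
    unfolding fseries_def by (rule infsum_reindex_bij_betw[OF bij_betw_triple_of, symmetric])
  also have "\<dots> = series h (pull_coef c) w"
    unfolding series_def pairing_def by (rule infsum_cong) (simp add: pull_coef_def fpair_def)
  finally show "fseries h c w = series h (pull_coef c) w" .
qed

lemma pull_push: "c \<in> rapid \<Longrightarrow> pull_coef (push_coef c) = c"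
  using rapid_outside[of c] by (auto simp: fun_eq_iff pull_coef_def push_coef_triple_of)

lemma push_pull: "c \<in> admissible \<Longrightarrow> push_coef (pull_coef c) = c"
proof
  fix \<tau> assume c: "c \<in> admissible"
  show "push_coef (pull_coef c) \<tau> = c \<tau>"
  proof (cases "\<tau> \<in> triples")
    case True
    then obtain t where "t \<in> balanced" "\<tau> = triple_of t" unfolding triples_eq by blast
    then show ?thesis by (simp add: push_coef_triple_of pull_coef_def)
  next
    case False
    have "\<forall>t. t \<notin> triples \<longrightarrow> c t = 0" using c unfolding admissible_def by blast
    then have "c \<tau> = 0" using False by blast
    then show ?thesis using False by (simp add: push_coef_def)
  qed
qed

lemma halg_eq: "halg h = series h ` (rapid :: ('n::finite pidx \<Rightarrow> complex) set)"
proof -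
  have eq: "rapid = pull_coef ` (admissible :: ('n mi \<times> 'n mi \<times> nat \<Rightarrow> complex) set)"
  proof (intro equalityI subsetI)
    fix c :: "'n pidx \<Rightarrow> complex" assume "c \<in> rapid"
    then show "c \<in> pull_coef ` admissible"
      using pull_push push_coef_admissible by (metis image_eqI)
  qed (use pull_coef_rapid in blast)
  show ?thesis unfolding eq by (simp add: halg_def image_image fseries_eq_series)
qed

definition rcoef :: "complex \<Rightarrow> 'n::finite cfn \<Rightarrow> 'n pidx \<Rightarrow> complex" where
  "rcoef h = the_inv_into rapid (series h)"

lemma rcoef_series:
  fixes h :: real
  assumes "h \<noteq> 0" "c \<in> rapid"
  shows "rcoef (of_real h) (series (of_real h) c) = c"
  unfolding rcoef_def by (rule the_inv_into_f_f[OF inj_on_series assms(2)]) (rule assms(1))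

lemma hnorm_series:
  fixes h :: real
  assumes h: "h \<noteq> 0" and c: "c \<in> rapid"
  shows "hnorm (of_real h) \<epsilon> (series (of_real h) c) = rnorm \<epsilon> c"
proof -
  have inj: "inj_on (fseries (of_real h)) (admissible :: ('n::finite mi \<times> 'n mi \<times> nat \<Rightarrow> complex) set)"
  proof (rule inj_onI)
    fix a b :: "'n mi \<times> 'n mi \<times> nat \<Rightarrow> complex"
    assume ab: "a \<in> admissible" "b \<in> admissible" and "fseries (of_real h) a = fseries (of_real h) b"
    then have "pull_coef a = pull_coef b"
      unfolding fseries_eq_series using inj_onD[OF inj_on_series[OF h]] pull_coef_rapid by blast
    then show "a = b" using push_pull ab by metis
  qed
  have "hcoef (of_real h) (series (of_real h) c) = push_coef c"
    unfolding hcoef_def by (rule the_inv_into_f_eq[OF inj])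
      (simp_all add: fseries_eq_series pull_push[OF c] push_coef_admissible[OF c])
  then have "hnorm (of_real h) \<epsilon> (series (of_real h) c) = Sup ((\<lambda>t. cmod (push_coef c (triple_of t)) / fact (deg t) powr \<epsilon>) ` balanced)"
    unfolding hnorm_def weight_image by simp
  also have "\<dots> = rnorm \<epsilon> c"
    unfolding rnorm_def by (rule arg_cong[where f = Sup], rule image_cong) (simp_all add: push_coef_triple_of)
  finally show ?thesis .
qed

lemma alg_eq_span: "alg h = cfun.span (fpair h ` (balanced :: 'n::finite pidx set))"
proof -
  have "fpair h ` (balanced :: 'n pidx set) = fbas h ` triples"
    unfolding triples_eq image_image by (rule image_cong) (auto simp: fpair_def fun_eq_iff)
  then show ?thesis unfolding alg_def by (simp only:)
qed

lemma alg_cases: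
  assumes "a \<in> alg h"
  obtains F c where "finite F" "F \<subseteq> balanced" "a = (\<lambda>w. \<Sum>t\<in>F. c t * fpair h t w)"
proof -
  have "a \<in> cfun.span (fpair h ` balanced)" using assms by (simp add: alg_eq_span)
  then show ?thesis by (rule span_image_cases) (use that in blast)
qed

lemma series_restrict_coef:
  assumes "finite F" "F \<subseteq> balanced"
  shows "series h (restrict_coef F c) = (\<lambda>w. \<Sum>t\<in>F. c t * fpair h t w)"
  unfolding series_def restrict_coef_def by (rule ext, rule pairing_finite_support[OF assms])

lemma restrict_coef_finite_rapid:
  "finite F \<Longrightarrow> F \<subseteq> balanced \<Longrightarrow> restrict_coef F c \<in> rapid"
  unfolding restrict_coef_def by (rule rapid_finite_support)

lemma series_restrict_coef_alg:
  assumes "finite F" "F \<subseteq> balanced"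
  shows "series h (restrict_coef F c) \<in> alg h"
  unfolding series_restrict_coef[OF assms] alg_eq_span by (rule span_image_sum[OF assms(2)])

section \<open>Topology of the completion\<close>

lemma series_zero: "series h 0 = 0"
  by (simp add: series_def pairing_def fun_eq_iff)

lemma rnorm_zero: "rnorm \<epsilon> 0 \<le> 0"
  by (rule rnorm_leI) simp

context
  fixes h :: real
  assumes h: "h \<noteq> 0"
begin

lemma hnorm_zero: "hnorm (of_real h) \<epsilon> (0 :: 'n::finite cfn) \<le> 0"
proof -
  have "hnorm (of_real h) \<epsilon> (0 :: 'n cfn) = rnorm \<epsilon> (0 :: 'n pidx \<Rightarrow> complex)"
    using hnorm_series[OF h rapid_zero] by (simp only: series_zero)
  then show ?thesis by (simp add: rnorm_zero)
qed

lemma topspace_htop: "topspace (htop (of_real h)) = (halg (of_real h) :: 'n::finite cfn set)"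
proof -
  have "a \<in> \<Union> {{b \<in> halg (of_real h). hnorm (of_real h) \<epsilon> (b - a) < r} | a \<epsilon> r. a \<in> halg (of_real h) \<and> 0 < \<epsilon> \<and> \<epsilon> < 1 \<and> 0 < r}"
    if a: "a \<in> halg (of_real h)" for a :: "'n cfn"
  proof -
    have "hnorm (of_real h) (1/2) (a - a) \<le> 0" using hnorm_zero by simp
    then have "a \<in> {b \<in> halg (of_real h). hnorm (of_real h) (1/2) (b - a) < 1}" using a by simp
    moreover have "{b \<in> halg (of_real h). hnorm (of_real h) (1/2) (b - a) < 1} \<in>
        {{b \<in> halg (of_real h). hnorm (of_real h) \<epsilon> (b - a) < r} | a \<epsilon> r. a \<in> halg (of_real h) \<and> 0 < \<epsilon> \<and> \<epsilon> < 1 \<and> 0 < r}"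
      using a by (intro CollectI exI[of _ a] exI[of _ "1/2"] exI[of _ 1]) simp
    ultimately show ?thesis by (rule UnionI[rotated])
  qed
  then show ?thesis unfolding htop_def topology_generated_by_topspace by blast
qed

lemma hnorm_diff:
  assumes "c \<in> rapid" "d \<in> rapid"
  shows "hnorm (of_real h) \<epsilon> (series (of_real h) d - series (of_real h) c) = rnorm \<epsilon> (d - c)"
  using hnorm_series[OF h rapid_diff[OF assms(2,1)]] by (simp add: series_diff[OF assms(2,1)])

text \<open>
  The seminorm balls are given as a subbasis only; as the seminorms are directed, single balls
  suffice.
\<close>

lemma openin_htop_imp:
  fixes c :: "'n::finite pidx \<Rightarrow> complex"
  assumes "openin (htop (of_real h)) U" "c \<in> rapid" "series (of_real h) c \<in> U"
  obtains \<epsilon> r where "0 < \<epsilon>" "\<epsilon> < 1" "0 < r"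
    "\<And>d. d \<in> rapid \<Longrightarrow> rnorm \<epsilon> (d - c) < r \<Longrightarrow> series (of_real h) d \<in> U"
proof -
  let ?S = "{{b \<in> halg (of_real h). hnorm (of_real h) \<epsilon> (b - a) < r} | (a :: 'n cfn) \<epsilon> r. a \<in> halg (of_real h) \<and> 0 < \<epsilon> \<and> \<epsilon> < 1 \<and> 0 < r}"
  have nb: "\<exists>\<epsilon> r. 0 < \<epsilon> \<and> \<epsilon> < 1 \<and> 0 < r \<and> (\<forall>d\<in>rapid. rnorm \<epsilon> (d - c) < r \<longrightarrow> series (of_real h) d \<in> U)"
    if "generate_topology_on ?S U" "c \<in> rapid" "series (of_real h) c \<in> U" for U and c :: "'n pidx \<Rightarrow> complex"
    using that
  proof (induction arbitrary: c)
    case Empty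
    then show ?case by simp
  next
    case (Int U V)
    obtain \<epsilon>1 r1 where 1: "0 < \<epsilon>1" "\<epsilon>1 < 1" "0 < r1" "\<forall>d\<in>rapid. rnorm \<epsilon>1 (d - c) < r1 \<longrightarrow> series (of_real h) d \<in> U"
      using Int.IH(1)[of c] Int.prems by blast
    obtain \<epsilon>2 r2 where 2: "0 < \<epsilon>2" "\<epsilon>2 < 1" "0 < r2" "\<forall>d\<in>rapid. rnorm \<epsilon>2 (d - c) < r2 \<longrightarrow> series (of_real h) d \<in> V"
      using Int.IH(2)[of c] Int.prems by blast
    show ?case
    proof (rule exI[of _ "min \<epsilon>1 \<epsilon>2"], rule exI[of _ "min r1 r2"], intro conjI ballI impI)
      fix d :: "'n pidx \<Rightarrow> complex" assume d: "d \<in> rapid" and lt: "rnorm (min \<epsilon>1 \<epsilon>2) (d - c) < min r1 r2"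
      have dc: "d - c \<in> rapid" using d Int.prems(1) by (rule rapid_diff)
      have "rnorm \<epsilon>1 (d - c) \<le> rnorm (min \<epsilon>1 \<epsilon>2) (d - c)" "rnorm \<epsilon>2 (d - c) \<le> rnorm (min \<epsilon>1 \<epsilon>2) (d - c)"
        using 1 2 by (auto intro!: rnorm_antimono[OF dc])
      then show "series (of_real h) d \<in> U \<inter> V" using 1(4) 2(4) d lt by auto
    qed (use 1 2 in auto)
  next
    case (UN K)
    then obtain k where k: "k \<in> K" "series (of_real h) c \<in> k" by blast
    from UN.IH[OF k(1) UN.prems(1) k(2)] k(1) show ?case by blast
  next
    case (Basis s)
    then obtain a \<epsilon> r where s: "s = {b \<in> halg (of_real h). hnorm (of_real h) \<epsilon> (b - a) < r}"
      and a: "a \<in> halg (of_real h)" and \<epsilon>: "0 < \<epsilon>" "\<epsilon> < 1" "0 < r" by blast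
    obtain a' where a': "a' \<in> rapid" "a = series (of_real h) a'" using a unfolding halg_eq by blast
    have lt: "rnorm \<epsilon> (c - a') < r"
      using Basis.prems(2) unfolding s a'(2) by (simp add: hnorm_diff[OF a'(1) Basis.prems(1)])
    show ?case
    proof (rule exI[of _ \<epsilon>], rule exI[of _ "r - rnorm \<epsilon> (c - a')"], intro conjI ballI impI)
      fix d :: "'n pidx \<Rightarrow> complex" assume d: "d \<in> rapid" and dl: "rnorm \<epsilon> (d - c) < r - rnorm \<epsilon> (c - a')"
      have "d - a' = (d - c) + (c - a')" by simp
      then have "rnorm \<epsilon> (d - a') \<le> rnorm \<epsilon> (d - c) + rnorm \<epsilon> (c - a')"
        using rnorm_add_le[OF rapid_diff[OF d Basis.prems(1)] rapid_diff[OF Basis.prems(1) a'(1)] \<epsilon>(1,2)] by metis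
      then have "rnorm \<epsilon> (d - a') < r" using dl by simp
      then show "series (of_real h) d \<in> s"
        unfolding s a'(2) using d by (simp add: hnorm_diff[OF a'(1) d] halg_eq)
    qed (use \<epsilon> lt in auto)
  qed
  have "generate_topology_on ?S U"
    using assms(1) unfolding htop_def openin_topology_generated_by_iff .
  from nb[OF this assms(2,3)] that show ?thesis by metis
qed

lemma openin_htopI:
  assumes U: "U \<subseteq> halg (of_real h)"
    and nb: "\<And>c. c \<in> rapid \<Longrightarrow> series (of_real h) c \<in> U \<Longrightarrow>
      \<exists>\<epsilon> r. 0 < \<epsilon> \<and> \<epsilon> < 1 \<and> 0 < r \<and> (\<forall>d\<in>rapid. rnorm \<epsilon> (d - c) < r \<longrightarrow> series (of_real h) d \<in> U)"
  shows "openin (htop (of_real h)) (U :: 'n::finite cfn set)"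
  unfolding openin_subopen[of _ U]
proof
  fix a assume aU: "a \<in> U"
  then obtain c where c: "c \<in> rapid" "a = series (of_real h) c" using U unfolding halg_eq by blast
  obtain \<epsilon> r where \<epsilon>: "0 < \<epsilon>" "\<epsilon> < 1" "0 < r" and d: "\<And>d. d \<in> rapid \<Longrightarrow> rnorm \<epsilon> (d - c) < r \<Longrightarrow> series (of_real h) d \<in> U"
    using nb[OF c(1)] aU c(2) by blast
  have a: "a \<in> halg (of_real h)" using aU U by blast
  define B where "B = {b \<in> halg (of_real h). hnorm (of_real h) \<epsilon> (b - a) < r}"
  have "openin (htop (of_real h)) B"
    unfolding htop_def B_def openin_topology_generated_by_iff
    by (rule generate_topology_on.Basis) (use a \<epsilon> in blast)
  moreover have "a \<in> B"
    using a \<epsilon>(3) le_less_trans[OF hnorm_zero \<epsilon>(3), of \<epsilon>] unfolding B_def by simp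
  moreover have "B \<subseteq> U"
  proof
    fix b assume b: "b \<in> B"
    then obtain d' where d': "d' \<in> rapid" "b = series (of_real h) d'" unfolding B_def halg_eq by blast
    have "rnorm \<epsilon> (d' - c) < r" using b unfolding B_def c(2) d'(2) by (simp add: hnorm_diff[OF c(1) d'(1)])
    then show "b \<in> U" using d[OF d'(1)] d'(2) by simp
  qed
  ultimately show "\<exists>T. openin (htop (of_real h)) T \<and> a \<in> T \<and> T \<subseteq> U" by blast
qed

lemma limitin_series:
  fixes c :: "'n::finite pidx \<Rightarrow> complex"
  assumes c: "c \<in> rapid" and f: "\<forall>\<^sub>F x in F. f x \<in> rapid"
    and lim: "\<And>\<epsilon> e. 0 < \<epsilon> \<Longrightarrow> \<epsilon> < 1 \<Longrightarrow> 0 < e \<Longrightarrow> \<forall>\<^sub>F x in F. rnorm \<epsilon> (f x - c) < e"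
  shows "limitin (htop (of_real h)) (\<lambda>x. series (of_real h) (f x)) (series (of_real h) c) F"
  unfolding limitin_def
proof (intro conjI allI impI)
  show "series (of_real h) c \<in> topspace (htop (of_real h))" using c by (simp add: topspace_htop halg_eq)
  fix U assume U: "openin (htop (of_real h)) U \<and> series (of_real h) c \<in> U"
  obtain \<epsilon> r where \<epsilon>: "0 < \<epsilon>" "\<epsilon> < 1" "0 < r" and d: "\<And>d. d \<in> rapid \<Longrightarrow> rnorm \<epsilon> (d - c) < r \<Longrightarrow> series (of_real h) d \<in> U"
    using openin_htop_imp[of U c] U c by blast
  show "\<forall>\<^sub>F x in F. series (of_real h) (f x) \<in> U"
    using f lim[OF \<epsilon>] by eventually_elim (rule d)
qed

lemma limitin_restrict_coef:
  assumes c: "c \<in> rapid"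
  shows "limitin (htop (of_real h)) (\<lambda>F. series (of_real h) (restrict_coef F c)) (series (of_real h) c) (finite_subsets_at_top balanced)"
proof (rule limitin_series[OF c])
  show "\<forall>\<^sub>F F in finite_subsets_at_top balanced. restrict_coef F c \<in> rapid"
    by (intro always_eventually allI restrict_coef_rapid c)
  fix \<epsilon> e :: real assume \<epsilon>: "0 < \<epsilon>" "\<epsilon> < 1" and e: "0 < e"
  obtain F0 where F0: "finite F0" "F0 \<subseteq> balanced" "\<And>F. F0 \<subseteq> F \<Longrightarrow> rnorm \<epsilon> (restrict_coef F c - c) \<le> e / 2"
    using rnorm_restrict_coef[OF c \<epsilon>, of "e / 2"] e by auto
  show "\<forall>\<^sub>F F in finite_subsets_at_top balanced. rnorm \<epsilon> (restrict_coef F c - c) < e"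
    unfolding eventually_finite_subsets_at_top
  proof (intro exI[of _ F0] conjI allI impI)
    fix F assume "finite F \<and> F0 \<subseteq> F \<and> F \<subseteq> balanced"
    then have "rnorm \<epsilon> (restrict_coef F c - c) \<le> e / 2" using F0(3) by blast
    then show "rnorm \<epsilon> (restrict_coef F c - c) < e" using e by simp
  qed (use F0 in auto)
qed

lemma openin_eval_preimage:
  fixes V :: "complex set"
  assumes V: "open V"
  shows "openin (htop (of_real h)) {a \<in> halg (of_real h). a (w :: 'n::finite pt) \<in> V}"
proof (rule openin_htopI)
  fix c :: "'n pidx \<Rightarrow> complex" assume c: "c \<in> rapid" and "series (of_real h) c \<in> {a \<in> halg (of_real h). a w \<in> V}"
  then have "series (of_real h) c w \<in> V" by simp
  then obtain e where e: "e > 0" "ball (series (of_real h) c w) e \<subseteq> V" by (rule openE[OF V])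
  obtain D where D: "D > 0" "\<And>c. c \<in> rapid \<Longrightarrow> cmod (pairing (\<lambda>t. fpair (of_real h) t w) c) \<le> D * rnorm (1/2) c"
    using norm_pairing_le[OF tame_fpair[of "of_real h" w]] by blast
  show "\<exists>\<epsilon> r. 0 < \<epsilon> \<and> \<epsilon> < 1 \<and> 0 < r \<and> (\<forall>d\<in>rapid. rnorm \<epsilon> (d - c) < r \<longrightarrow> series (of_real h) d \<in> {a \<in> halg (of_real h). a w \<in> V})"
  proof (rule exI[of _ "1/2"], rule exI[of _ "e / D"], intro conjI ballI impI CollectI)
    fix d :: "'n pidx \<Rightarrow> complex" assume d: "d \<in> rapid" and lt: "rnorm (1/2) (d - c) < e / D"
    have "series (of_real h) d w - series (of_real h) c w = pairing (\<lambda>t. fpair (of_real h) t w) (d - c)"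
      unfolding series_def by (rule pairing_diff[OF d c tame_fpair, symmetric])
    then have "cmod (series (of_real h) d w - series (of_real h) c w) \<le> D * rnorm (1/2) (d - c)"
      using D(2)[OF rapid_diff[OF d c]] by simp
    also have "\<dots> < D * (e / D)" using lt D(1) by (rule mult_strict_left_mono)
    also have "\<dots> = e" using D(1) by simp
    finally have "series (of_real h) d w \<in> ball (series (of_real h) c w) e"
      by (simp add: dist_norm norm_minus_commute)
    then show "series (of_real h) d w \<in> V" using e(2) by blast
    show "series (of_real h) d \<in> halg (of_real h)" using d by (simp add: halg_eq)
  qed (use D e in auto)
qed auto

text \<open>Evaluations at points are continuous and separate functions.\<close>

lemma Hausdorff_htop: "Hausdorff_space (htop (of_real h) :: 'n::finite cfn topology)"
  unfolding Hausdorff_space_def topspace_htop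
proof (intro allI impI)
  fix a b :: "'n cfn" assume ab: "a \<in> halg (of_real h) \<and> b \<in> halg (of_real h) \<and> a \<noteq> b"
  then obtain w where "a w \<noteq> b w" by (auto simp: fun_eq_iff)
  then obtain U V :: "complex set" where UV: "open U" "open V" "a w \<in> U" "b w \<in> V" "U \<inter> V = {}"
    using hausdorff[of "a w" "b w"] by blast
  show "\<exists>U V. openin (htop (of_real h)) U \<and> openin (htop (of_real h)) V \<and> a \<in> U \<and> b \<in> V \<and> disjnt U V"
    by (intro exI[of _ "{a \<in> halg (of_real h). a w \<in> U}"] exI[of _ "{a \<in> halg (of_real h). a w \<in> V}"] conjI openin_eval_preimage UV)
      (use ab UV in \<open>auto simp: disjnt_def\<close>)
qed

subsection \<open>The completed product\<close>

lemma cprod_diff_left: "cprod (a - a') b = cprod a b - cprod a' b"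
  unfolding cprod_eq fun_eq_iff by (simp add: sum_subtractf[symmetric] algebra_simps)

lemma cprod_diff_right: "cprod a (b - b') = cprod a b - cprod a b'"
  unfolding cprod_eq fun_eq_iff by (simp add: sum_subtractf[symmetric] algebra_simps)

text \<open>The candidate for the product of the completion, defined on coefficients.\<close>

definition hmul :: "'n::finite cfn \<Rightarrow> 'n cfn \<Rightarrow> 'n cfn" where
  "hmul a b = series (of_real h) (cprod (rcoef (of_real h) a) (rcoef (of_real h) b))"

lemma hmul_series: "c \<in> rapid \<Longrightarrow> d \<in> rapid \<Longrightarrow> hmul (series (of_real h) c) (series (of_real h) d) = series (of_real h) (cprod c d)"
  by (simp add: hmul_def rcoef_series[OF h])

text \<open>
  This is the usual argument for a bilinear map that is bounded with respect to suitable
  seminorms, by \<open>rnorm_cprod_le\<close>.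
\<close>

lemma continuous_hmul:
  "continuous_map (prod_topology (htop (of_real h)) (htop (of_real h))) (htop (of_real h))
     (\<lambda>(a, b). hmul a (b :: 'n::finite cfn))"
  unfolding continuous_map_def
proof (intro conjI allI impI)
  show "(\<lambda>(a, b). hmul a b) \<in> topspace (prod_topology (htop (of_real h)) (htop (of_real h))) \<rightarrow> topspace (htop (of_real h))"
    unfolding topspace_prod_topology topspace_htop halg_eq
    by (auto simp: hmul_series intro!: imageI cprod_rapid)
  fix U :: "'n cfn set" assume U: "openin (htop (of_real h)) U"
  show "openin (prod_topology (htop (of_real h)) (htop (of_real h)))
      {x \<in> topspace (prod_topology (htop (of_real h)) (htop (of_real h))). (case x of (a, b) \<Rightarrow> hmul a b) \<in> U}"
    unfolding openin_prod_topology_alt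
  proof (intro allI impI)
    fix x y assume "(x, y) \<in> {x \<in> topspace (prod_topology (htop (of_real h)) (htop (of_real h))). (case x of (a, b) \<Rightarrow> hmul a b) \<in> U}"
    then obtain a b where a: "a \<in> rapid" "x = series (of_real h) a" and b: "b \<in> rapid" "y = series (of_real h) b"
      and abU: "series (of_real h) (cprod a b) \<in> U"
      unfolding topspace_prod_topology topspace_htop halg_eq by (auto simp: hmul_series)
    obtain \<epsilon> r where \<epsilon>: "0 < \<epsilon>" "\<epsilon> < 1" "0 < r" and r: "\<And>d. d \<in> rapid \<Longrightarrow> rnorm \<epsilon> (d - cprod a b) < r \<Longrightarrow> series (of_real h) d \<in> U"
      using openin_htop_imp[OF U cprod_rapid[OF a(1) b(1)] abU] by blast
    obtain M where M: "M > 0" "\<And>(a :: 'n pidx \<Rightarrow> complex) b.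
      \<lbrakk>a \<in> rapid; b \<in> rapid\<rbrakk> \<Longrightarrow> rnorm \<epsilon> (cprod a b) \<le> M * rnorm (\<epsilon> / 3) a * rnorm (\<epsilon> / 3) b"
      using rnorm_cprod_le[OF \<epsilon>(1,2)] by blast
    have \<delta>: "0 < \<epsilon> / 3" "\<epsilon> / 3 < 1" using \<epsilon> by auto
    define A where "A = rnorm (\<epsilon> / 3) a"
    define B where "B = rnorm (\<epsilon> / 3) b"
    have A0: "A \<ge> 0" and B0: "B \<ge> 0" unfolding A_def B_def by (rule rnorm_nonneg[OF _ \<delta>], fact a b)+
    \<comment> \<open>on the balls of radius \<open>s\<close> the product varies by at most \<open>M s (B + 1) + M A s\<close>\<close>
    define s where "s = min 1 (r / (2 * M * (A + B + 1)))"
    define k where "k = M * (A + B + 1)"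
    have k: "k > 0" unfolding k_def using M(1) A0 B0 by (intro mult_pos_pos) auto
    have s: "s = min 1 (r / (2 * k))" by (simp add: s_def k_def mult.assoc)
    have s0: "0 < s" "s \<le> 1" using k \<epsilon>(3) by (simp_all add: s)
    have "s \<le> r / (2 * k)" by (simp add: s)
    then have "s * k \<le> r / 2" using k by (simp add: field_simps)
    then have sr: "M * s * (A + B + 1) \<le> r / 2" by (simp add: k_def mult_ac)
    define N where "N c = {x \<in> halg (of_real h). \<forall>d\<in>rapid. x = series (of_real h) d \<longrightarrow> rnorm (\<epsilon> / 3) (d - c) < s}"
      for c :: "'n pidx \<Rightarrow> complex"
    have N_iff: "series (of_real h) d \<in> N c \<longleftrightarrow> rnorm (\<epsilon> / 3) (d - c) < s" if "d \<in> rapid" for c d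
      using that inj_onD[OF inj_on_series[OF h]] by (auto simp: N_def halg_eq)
    have N_open: "openin (htop (of_real h)) (N c)" if c: "c \<in> rapid" for c
    proof (rule openin_htopI)
      fix d :: "'n pidx \<Rightarrow> complex" assume d: "d \<in> rapid" and "series (of_real h) d \<in> N c"
      then have lt: "rnorm (\<epsilon> / 3) (d - c) < s" using N_iff by blast
      show "\<exists>\<epsilon> r. 0 < \<epsilon> \<and> \<epsilon> < 1 \<and> 0 < r \<and> (\<forall>e\<in>rapid. rnorm \<epsilon> (e - d) < r \<longrightarrow> series (of_real h) e \<in> N c)"
      proof (rule exI[of _ "\<epsilon> / 3"], rule exI[of _ "s - rnorm (\<epsilon> / 3) (d - c)"], intro conjI ballI impI)
        fix e :: "'n pidx \<Rightarrow> complex" assume e: "e \<in> rapid" and el: "rnorm (\<epsilon> / 3) (e - d) < s - rnorm (\<epsilon> / 3) (d - c)"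
        have "e - c = (e - d) + (d - c)" by simp
        then have "rnorm (\<epsilon> / 3) (e - c) \<le> rnorm (\<epsilon> / 3) (e - d) + rnorm (\<epsilon> / 3) (d - c)"
          using rnorm_add_le[OF rapid_diff[OF e d] rapid_diff[OF d c] \<delta>] by metis
        then show "series (of_real h) e \<in> N c" using el N_iff[OF e] by simp
      qed (use \<delta> lt in auto)
    qed (auto simp: N_def)
    have "hmul x' y' \<in> U" if x': "x' \<in> N a" and y': "y' \<in> N b" for x' y'
    proof -
      obtain a' b' where a': "a' \<in> rapid" "x' = series (of_real h) a'" and b': "b' \<in> rapid" "y' = series (of_real h) b'"
        using x' y' unfolding N_def halg_eq by blast
      have la: "rnorm (\<epsilon> / 3) (a' - a) < s" using x' N_iff[OF a'(1)] a'(2) by simp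
      have lb: "rnorm (\<epsilon> / 3) (b' - b) < s" using y' N_iff[OF b'(1)] b'(2) by simp
      have b'_le: "rnorm (\<epsilon> / 3) b' \<le> B + 1"
      proof -
        have "b' = (b' - b) + b" by simp
        then have "rnorm (\<epsilon> / 3) b' \<le> rnorm (\<epsilon> / 3) (b' - b) + B"
          unfolding B_def using rnorm_add_le[OF rapid_diff[OF b'(1) b(1)] b(1) \<delta>] by metis
        then show ?thesis using lb s0 by simp
      qed
      have da: "a' - a \<in> rapid" and db: "b' - b \<in> rapid" using rapid_diff a a' b b' by auto
      have eq: "cprod a' b' - cprod a b = cprod (a' - a) b' + cprod a (b' - b)"
        by (simp add: cprod_diff_left cprod_diff_right)
      have "rnorm \<epsilon> (cprod a' b' - cprod a b) \<le> rnorm \<epsilon> (cprod (a' - a) b') + rnorm \<epsilon> (cprod a (b' - b))"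
        unfolding eq by (rule rnorm_add_le[OF cprod_rapid[OF da b'(1)] cprod_rapid[OF a(1) db] \<epsilon>(1,2)])
      also have "\<dots> \<le> M * rnorm (\<epsilon> / 3) (a' - a) * rnorm (\<epsilon> / 3) b' + M * A * rnorm (\<epsilon> / 3) (b' - b)"
        unfolding A_def by (intro add_mono M(2) da b'(1) a(1) db)
      also have "\<dots> \<le> M * s * (B + 1) + M * A * s"
        using M(1) A0 B0 s0 la lb b'_le rnorm_nonneg[OF b'(1) \<delta>] rnorm_nonneg[OF da \<delta>] rnorm_nonneg[OF db \<delta>]
        by (intro add_mono mult_mono) auto
      also have "\<dots> = M * s * (A + B + 1)" by (simp add: algebra_simps)
      also have "\<dots> < r" using sr \<epsilon>(3) by simp
      finally show ?thesis
        unfolding a'(2) b'(2) hmul_series[OF a'(1) b'(1)] by (rule r[OF cprod_rapid[OF a'(1) b'(1)]])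
    qed
    moreover have "rnorm (\<epsilon> / 3) (0 :: 'n pidx \<Rightarrow> complex) < s"
      using rnorm_zero s0(1) by (rule le_less_trans)
    then have "x \<in> N a" "y \<in> N b"
      using N_iff[OF a(1), of a] N_iff[OF b(1), of b] a(2) b(2) by simp_all
    moreover have "N a \<subseteq> halg (of_real h)" "N b \<subseteq> halg (of_real h)" by (auto simp: N_def)
    ultimately show "\<exists>V W. openin (htop (of_real h)) V \<and> openin (htop (of_real h)) W \<and> x \<in> V \<and> y \<in> W \<and>
        V \<times> W \<subseteq> {x \<in> topspace (prod_topology (htop (of_real h)) (htop (of_real h))). (case x of (a, b) \<Rightarrow> hmul a b) \<in> U}"
      using N_open[OF a(1)] N_open[OF b(1)]
      by (intro exI[of _ "N a"] exI[of _ "N b"]) (auto simp: topspace_htop)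
  qed
qed

lemma series_cprod_finite:
  fixes F G :: "'n::finite pidx set"
  assumes F: "finite F" "F \<subseteq> balanced" and G: "finite G" "G \<subseteq> balanced"
  shows "series (of_real h) (cprod (restrict_coef F a) (restrict_coef G b))
    = tstar (of_real h) (series (of_real h) (restrict_coef F a)) (series (of_real h) (restrict_coef G b))"
proof
  fix w :: "'n pt"
  define \<Lambda> where "\<Lambda> = (\<lambda>t. fpair (of_real h) t w)"
  have "((\<lambda>(s, t). restrict_coef F a s * restrict_coef G b t * pair_mult \<Lambda> s t)
      has_sum pairing \<Lambda> (cprod (restrict_coef F a) (restrict_coef G b))) (balanced \<times> balanced)"
    unfolding \<Lambda>_def by (intro has_sum_pair_mult restrict_coef_finite_rapid tame_fpair assms)
  then have "((\<lambda>(s, t). a s * b t * pair_mult \<Lambda> s t)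
      has_sum pairing \<Lambda> (cprod (restrict_coef F a) (restrict_coef G b))) (F \<times> G)"
    by (rule has_sum_cong_neutral[THEN iffD1, rotated -1]) (use F G in \<open>auto simp: restrict_coef_def split: if_splits\<close>)
  then have "pairing \<Lambda> (cprod (restrict_coef F a) (restrict_coef G b)) = (\<Sum>(s, t)\<in>F \<times> G. a s * b t * pair_mult \<Lambda> s t)"
    using F G by (simp add: has_sum_finite_iff)
  also have "\<dots> = (\<Sum>s\<in>F. \<Sum>t\<in>G. a s * b t * pair_mult \<Lambda> s t)" by (simp add: sum.cartesian_product)
  finally show "series (of_real h) (cprod (restrict_coef F a) (restrict_coef G b)) w
    = tstar (of_real h) (series (of_real h) (restrict_coef F a)) (series (of_real h) (restrict_coef G b)) w"
    unfolding series_restrict_coef[OF F] series_restrict_coef[OF G] tstar_fpair[OF h F G]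
    by (simp add: series_def \<Lambda>_def pair_mult_def)
qed

lemma hmul_alg:
  assumes "a \<in> alg (of_real h)" "b \<in> alg (of_real h)"
  shows "hmul a b = tstar (of_real h) a b"
proof -
  obtain F c where F: "finite F" "F \<subseteq> balanced" "a = (\<lambda>w. \<Sum>t\<in>F. c t * fpair (of_real h) t w)"
    by (rule alg_cases[OF assms(1)])
  obtain G d where G: "finite G" "G \<subseteq> balanced" "b = (\<lambda>w. \<Sum>t\<in>G. d t * fpair (of_real h) t w)"
    by (rule alg_cases[OF assms(2)])
  have a: "a = series (of_real h) (restrict_coef F c)" and b: "b = series (of_real h) (restrict_coef G d)"
    by (simp_all add: F(3) G(3) series_restrict_coef[OF F(1,2)] series_restrict_coef[OF G(1,2)])
  show ?thesis
    unfolding a b hmul_series[OF restrict_coef_finite_rapid[OF F(1,2)] restrict_coef_finite_rapid[OF G(1,2)]]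
    by (rule series_cprod_finite[OF F(1,2) G(1,2)])
qed

text \<open>
  A continuous extension of the product exists, by the explicit formula on coefficients, and it
  is unique because finite combinations are dense and the topology is Hausdorff.
\<close>

lemma hstar_series:
  fixes c d :: "'n::finite pidx \<Rightarrow> complex"
  assumes c: "c \<in> rapid" and d: "d \<in> rapid"
  shows "hstar (of_real h) (series (of_real h) c) (series (of_real h) d) = series (of_real h) (cprod c d)"
proof -
  define m where "m = (hstar (of_real h) :: 'n cfn \<Rightarrow> 'n cfn \<Rightarrow> 'n cfn)"
  have "continuous_map (prod_topology (htop (of_real h)) (htop (of_real h))) (htop (of_real h)) (\<lambda>(a, b). m a b) \<and>
     (\<forall>a\<in>alg (of_real h). \<forall>b\<in>alg (of_real h). m a b = tstar (of_real h) a b)"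
    unfolding m_def hstar_def by (rule someI[of _ hmul]) (use continuous_hmul hmul_alg in blast)
  then have cont: "continuous_map (prod_topology (htop (of_real h)) (htop (of_real h))) (htop (of_real h)) (\<lambda>(a, b). m a b)"
    and m_alg: "\<And>a b. a \<in> alg (of_real h) \<Longrightarrow> b \<in> alg (of_real h) \<Longrightarrow> m a b = tstar (of_real h) a b" by blast+
  define f where "f F = (series (of_real h) (restrict_coef F c), series (of_real h) (restrict_coef F d))" for F
  define A where "A = finite_subsets_at_top (balanced :: 'n pidx set)"
  have lim: "limitin (prod_topology (htop (of_real h)) (htop (of_real h))) f (series (of_real h) c, series (of_real h) d) A"
    unfolding limitin_pairwise f_def o_def fst_conv snd_conv A_def by (intro conjI limitin_restrict_coef c d)
  have "\<forall>\<^sub>F F in A. ((\<lambda>(a, b). hmul a b) \<circ> f) F = ((\<lambda>(a, b). m a b) \<circ> f) F"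
    unfolding A_def
  proof (rule eventually_finite_subsets_at_top_weakI)
    fix F :: "'n pidx set" assume "finite F" "F \<subseteq> balanced"
    then have "series (of_real h) (restrict_coef F c) \<in> alg (of_real h)" "series (of_real h) (restrict_coef F d) \<in> alg (of_real h)"
      by (auto intro: series_restrict_coef_alg)
    then show "((\<lambda>(a, b). hmul a b) \<circ> f) F = ((\<lambda>(a, b). m a b) \<circ> f) F"
      by (simp add: f_def hmul_alg m_alg)
  qed
  from limitin_transform_eventually[OF this continuous_map_limit[OF continuous_hmul lim]]
  have "limitin (htop (of_real h)) ((\<lambda>(a, b). m a b) \<circ> f) (hmul (series (of_real h) c) (series (of_real h) d)) A"
    by (simp only: prod.case)
  moreover have "limitin (htop (of_real h)) ((\<lambda>(a, b). m a b) \<circ> f) (m (series (of_real h) c) (series (of_real h) d)) A"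
    using continuous_map_limit[OF cont lim] by (simp only: prod.case)
  ultimately have "m (series (of_real h) c) (series (of_real h) d) = hmul (series (of_real h) c) (series (of_real h) d)"
    by (intro limitin_Hausdorff_unique[OF _ _ _ Hausdorff_htop]) (auto simp: A_def)
  then show ?thesis by (simp add: m_def hmul_series[OF c d])
qed

subsection \<open>The involution\<close>

text \<open>
  For real \<open>h\<close> the Pochhammer symbol and the power of \<open>y\<close> are real, and conjugation exchanges the
  exponents of the monomial.
\<close>

lemma cnj_series:
  assumes c: "c \<in> rapid"
  shows "cnj (series (of_real h) c w) = series (of_real h) (cconj c) w"
proof -
  have f: "cnj (fpair (of_real h) t w) = fpair (of_real h) (prod.swap t) w" if t: "t \<in> balanced" for t
  proof (cases "w \<in> Cplus")
    case True
    obtain A B where AB: "t = (A, B)" by fastforce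
    have tb: "(A, B) \<in> balanced" "(B, A) \<in> balanced" "mabs A = mabs B" using t by (auto simp: AB balanced_def)
    have "complex_of_real (ypot w) / (2 * of_real h) = of_real (ypot w / (2 * h))" by simp
    then have "cnj (pochhammer (complex_of_real (ypot w) / (2 * of_real h)) n) = pochhammer (complex_of_real (ypot w) / (2 * of_real h)) n" for n
      by (simp only: pochhammer_of_real complex_cnj_complex_of_real)
    moreover have "cnj (zmonom A B w) = zmonom B A w" by (simp add: zmonom_def mult.commute)
    ultimately show ?thesis using True by (simp add: AB fpair_eq tb mult_ac)
  qed (simp add: fpair_outside)
  have "cnj (series (of_real h) c w) = (\<Sum>\<^sub>\<infinity>t\<in>balanced. cnj (c t) * fpair (of_real h) (prod.swap t) w)"
    unfolding series_def pairing_def infsum_cnj[symmetric] by (rule infsum_cong) (simp add: f)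
  also have "\<dots> = series (of_real h) (cconj c) w"
    unfolding series_def pairing_def
    by (rule infsum_reindex_bij_witness[of _ prod.swap prod.swap]) (auto simp: cconj_def balanced_def)
  finally show ?thesis .
qed

end

section \<open>Functionals living on the hyperboloid\<close>

text \<open>
  On the cone the basis functions satisfy
  \<open>\<Sum>i. - g\<^sub>i\<^sub>i (A\<^sub>i + 1) (B\<^sub>i + 1) f\<^sub>(\<^sub>A\<^sub>+\<^sub>e\<^sub>i\<^sub>,\<^sub>B\<^sub>+\<^sub>e\<^sub>i\<^sub>) = (y / (2 h) + \<bar>A\<bar>) f\<^sub>(\<^sub>A\<^sub>,\<^sub>B\<^sub>)\<close>, so multiplication by \<open>y\<close> is a
  finite recursion.  The condition says that the functional cannot distinguish \<open>y / (2 h)\<close> from \<open>x\<close>.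
\<close>

definition level :: "complex \<Rightarrow> ('n::finite pidx \<Rightarrow> complex) \<Rightarrow> bool" where
  "level x \<Lambda> \<longleftrightarrow> (\<forall>A B. mabs A = mabs B \<longrightarrow>
     (\<Sum>i\<in>UNIV. - gmet i i * (of_nat (Suc (A i)) * of_nat (Suc (B i)) * \<Lambda> (A + unit_mi i, B + unit_mi i)))
       = (x + of_nat (mabs A)) * \<Lambda> (A, B))"

lemma mfact_add_unit: "mfact (A + unit_mi i) = Suc (A i) * mfact A"
proof -
  have "(\<Prod>j\<in>UNIV - {i}. fact ((A + unit_mi i) j)) = (\<Prod>j\<in>UNIV - {i}. fact (A j) :: nat)"
    by (rule prod.cong) (auto simp: unit_mi_def)
  then show ?thesis unfolding mfact_def prod.remove[of UNIV i "\<lambda>j. fact (_ j)", OF finite UNIV_I]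
    by (simp add: algebra_simps)
qed

lemma zmonom_add_unit: "zmonom (A + unit_mi i) (B + unit_mi i) z = z $ i * cnj (z $ i) * zmonom A B z"
proof -
  have "(\<Prod>j\<in>UNIV. f j ^ (A + unit_mi i) j) = f i * (\<Prod>j\<in>UNIV. f j ^ A j)" for f :: "'a option \<Rightarrow> complex" and A
  proof -
    have "(\<Prod>j\<in>UNIV - {i}. f j ^ (A + unit_mi i) j) = (\<Prod>j\<in>UNIV - {i}. f j ^ A j)"
      by (rule prod.cong) (auto simp: unit_mi_def)
    then show ?thesis by (simp add: prod.remove[of UNIV i])
  qed
  then show ?thesis unfolding zmonom_def by (simp add: mult_ac)
qed

lemma level_fpair:
  fixes w :: "'n::finite pt"
  assumes w: "ypot w = 1"
  shows "level (1 / (2 * h)) (\<lambda>t. fpair h t w)"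
  unfolding level_def
proof (intro allI impI)
  fix A B :: "'n option mi" assume AB: "mabs A = mabs B"
  define x where "x = 1 / (2 * h)"
  define q where "q = zmonom A B w / (of_nat (mfact A) * of_nat (mfact B))"
  have wC: "w \<in> Cplus" using w by (simp add: Cplus_def)
  have f0: "fpair h (A, B) w = pochhammer x (mabs A) * q"
    using AB fpair_eq[of A B w h] wC w by (simp add: balanced_def x_def q_def)
  have cancel: "a * b * (p * (z * q) / (a * m * (b * n))) = p * (q / (m * n)) * z" if "a \<noteq> 0" "b \<noteq> 0"
    for a b p q z m n :: complex using that by simp
  have nz: "complex_of_nat (Suc k) \<noteq> 0" for k by (simp del: of_nat_Suc)
  have fi: "of_nat (Suc (A i)) * of_nat (Suc (B i)) * fpair h (A + unit_mi i, B + unit_mi i) w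
      = pochhammer x (Suc (mabs A)) * q * (w $ i * cnj (w $ i))" for i
  proof -
    have "(A + unit_mi i, B + unit_mi i) \<in> balanced" using AB by (simp add: balanced_def)
    from fpair_eq[OF this wC, of h] w
    have "fpair h (A + unit_mi i, B + unit_mi i) w = pochhammer x (Suc (mabs A)) * (w $ i * cnj (w $ i) * zmonom A B w)
        / (of_nat (Suc (A i) * mfact A) * of_nat (Suc (B i) * mfact B))"
      unfolding mfact_add_unit zmonom_add_unit by (simp add: x_def)
    then show ?thesis unfolding q_def of_nat_mult by (simp only: cancel[OF nz nz])
  qed
  have "(\<Sum>i\<in>UNIV. - gmet i i * (of_nat (Suc (A i)) * of_nat (Suc (B i)) * fpair h (A + unit_mi i, B + unit_mi i) w))
      = pochhammer x (Suc (mabs A)) * q * (\<Sum>i\<in>UNIV. - gmet i i * (w $ i * cnj (w $ i)))"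
    unfolding fi sum_distrib_left by (simp add: mult_ac)
  also have "(\<Sum>i\<in>UNIV. - gmet i i * (w $ i * cnj (w $ i))) = of_real (ypot w)"
    by (simp add: sum_UNIV_option gmet_def ypot_def complex_norm_square[symmetric] sum_negf)
  also have "pochhammer x (Suc (mabs A)) * q * of_real (ypot w) = (1 / (2 * h) + of_nat (mabs A)) * fpair h (A, B) w"
    unfolding f0 w pochhammer_Suc by (simp add: x_def mult_ac)
  finally show "(\<Sum>i\<in>UNIV. - gmet i i * (of_nat (Suc (A i)) * of_nat (Suc (B i)) * fpair h (A + unit_mi i, B + unit_mi i) w))
      = (1 / (2 * h) + of_nat (mabs A)) * fpair h (A, B) w" .
qed

text \<open>
  Pascal's rule in the coordinate \<open>i\<close>: the additional variable is either left alone or contracted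
  with one of the \<open>D i - (K i - 1)\<close> variables that are still free.
\<close>

lemma contraction_add_unit:
  "contraction (A + unit_mi i) D K = contraction A D K
    + (if 0 < K i then gmet i i * (of_nat (D i) - of_nat (K i - 1)) * contraction A D (K - unit_mi i) else 0)"
proof -
  define F where "F A K j = gmet j j ^ K j * fact (K j) * of_nat (A j choose K j) * complex_of_nat (D j choose K j)"
    for A K :: "'a option mi" and j
  have con: "contraction A D K = F A K i * (\<Prod>j\<in>UNIV - {i}. F A K j)" for A K
    unfolding contraction_def F_def[symmetric] by (rule prod.remove) auto
  have r1: "(\<Prod>j\<in>UNIV - {i}. F (A + unit_mi i) K j) = (\<Prod>j\<in>UNIV - {i}. F A K j)"
    by (rule prod.cong) (auto simp: F_def unit_mi_def)
  have r2: "(\<Prod>j\<in>UNIV - {i}. F A (K - unit_mi i) j) = (\<Prod>j\<in>UNIV - {i}. F A K j)"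
    by (rule prod.cong) (auto simp: F_def unit_mi_def)
  have key: "F (A + unit_mi i) K i = F A K i
      + (if 0 < K i then gmet i i * (of_nat (D i) - of_nat (K i - 1)) * F A (K - unit_mi i) i else 0)"
  proof (cases "K i")
    case 0
    then show ?thesis by (simp add: F_def)
  next
    case (Suc k)
    have "Suc k * (D i choose Suc k) = (D i - k) * (D i choose k)"
      using binomial_absorption[of k "D i"] binomial_absorb_comp[of "D i" k] by simp
    then have "of_nat (Suc k) * complex_of_nat (D i choose Suc k) = of_nat (D i - k) * of_nat (D i choose k)"
      by (metis of_nat_mult)
    also have "\<dots> = (of_nat (D i) - of_nat k) * of_nat (D i choose k)"
      by (cases "k \<le> D i") (simp_all add: of_nat_diff)
    finally have D: "of_nat (Suc k) * complex_of_nat (D i choose Suc k) = (of_nat (D i) - of_nat k) * of_nat (D i choose k)" .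
    have "F (A + unit_mi i) K i - F A K i
        = gmet i i ^ Suc k * fact k * of_nat (A i choose k) * (of_nat (Suc k) * of_nat (D i choose Suc k))"
      using Suc by (simp add: F_def algebra_simps)
    also have "\<dots> = gmet i i * (of_nat (D i) - of_nat k) * F A (K - unit_mi i) i"
      unfolding D using Suc by (simp add: F_def mult_ac)
    finally show ?thesis using Suc by (simp add: algebra_simps)
  qed
  show ?thesis unfolding con r1 r2 key by (simp add: algebra_simps)
qed

lemma contraction_nonzero: "contraction A D K \<noteq> 0 \<Longrightarrow> K \<le> A"
  using contraction_eq_0 by blast

lemma gmet_square: "gmet i i * gmet i i = 1"
  by (simp add: gmet_def)

text \<open>
  Behind this is that \<open>(y f\<^sub>s) * f\<^sub>t = y (f\<^sub>s * f\<^sub>t)\<close>: the function \<open>y\<close> is central and the product with it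
  is pointwise.  In the indices, raising the exponents of the first factor by \<open>e\<^sub>i\<close> raises those of
  each term of the product, and creates new terms in which the additional variable is contracted.
  The latter account for the difference between the degree of a term and that of \<open>f\<^sub>s\<close>.
\<close>

lemma level_pair_mult:
  fixes \<Lambda> :: "'n::finite pidx \<Rightarrow> complex"
  assumes \<Lambda>: "level x \<Lambda>" and t: "t \<in> balanced"
  shows "level x (\<lambda>s. pair_mult \<Lambda> s t)"
  unfolding level_def
proof (intro allI impI)
  fix A B :: "'n option mi" assume AB: "mabs A = mabs B"
  obtain C D where t_eq: "t = (C, D)" by fastforce
  have CD: "mabs C = mabs D" using t by (simp add: t_eq balanced_def)
  define G where "G A B = of_nat (mfact A) * of_nat (mfact B) * \<Lambda> (A, B)" for A B
  define S where "S A B = (\<Sum>K | K \<le> D. contraction A D K * G (A - K + C) (B + (D - K)))" for A B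
  have finD: "finite {K. K \<le> D}" by (rule finite_mi_below)
  have pm: "pair_mult \<Lambda> (A, B) t = S A B / (of_nat (mfact A) * of_nat (mfact B) * of_nat (mfact2 t))" for A B
  proof -
    have "pair_mult \<Lambda> (A, B) t = (\<Sum>K | K \<le> D. contraction A D K * G (A - K + C) (B + (D - K))
        / (of_nat (mfact A) * of_nat (mfact B) * of_nat (mfact2 t)))"
      unfolding pair_mult_def
      by (rule sum.mono_neutral_cong_left[OF finD])
        (auto dest: contraction_nonzero simp: contractions_def t_eq struct_const_def merge_idx_def mfact2_def G_def mult_ac)
    then show ?thesis by (simp add: S_def sum_divide_distrib)
  qed
  have G: "(\<Sum>i\<in>UNIV. - gmet i i * G (A + unit_mi i) (B + unit_mi i)) = (x + of_nat (mabs A)) * G A B"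
    if "mabs A = mabs B" for A B
  proof -
    have "(\<Sum>i\<in>UNIV. - gmet i i * G (A + unit_mi i) (B + unit_mi i))
        = of_nat (mfact A) * of_nat (mfact B) * (\<Sum>i\<in>UNIV. - gmet i i * (of_nat (Suc (A i)) * of_nat (Suc (B i)) * \<Lambda> (A + unit_mi i, B + unit_mi i)))"
      unfolding G_def mfact_add_unit sum_distrib_left of_nat_mult by (simp only: mult_ac)
    also have "\<dots> = (x + of_nat (mabs A)) * G A B"
      using \<Lambda> that unfolding level_def G_def by (simp add: mult_ac)
    finally show ?thesis .
  qed
  have main: "(\<Sum>i\<in>UNIV. - gmet i i * S (A + unit_mi i) (B + unit_mi i)) = (x + of_nat (mabs A)) * S A B"
  proof -
    define T where "T i K = G (A + unit_mi i - K + C) (B + unit_mi i + (D - K))" for i K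
    have "S (A + unit_mi i) (B + unit_mi i) = (\<Sum>K | K \<le> D. contraction A D K * G (A - K + C + unit_mi i) (B + (D - K) + unit_mi i))
        + (\<Sum>K | K \<le> D. gmet i i * (of_nat (D i) - of_nat (K i)) * contraction A D K * G (A - K + C) (B + (D - K)))" for i
    proof -
      have "S (A + unit_mi i) (B + unit_mi i) = (\<Sum>K | K \<le> D. contraction A D K * T i K)
          + (\<Sum>K | K \<le> D. if 0 < K i then gmet i i * (of_nat (D i) - of_nat (K i - 1)) * contraction A D (K - unit_mi i) * T i K else 0)"
        unfolding S_def contraction_add_unit T_def[symmetric] sum.distrib[symmetric]
        by (rule sum.cong) (auto simp: distrib_right)
      also have "(\<Sum>K | K \<le> D. contraction A D K * T i K)
          = (\<Sum>K | K \<le> D. contraction A D K * G (A - K + C + unit_mi i) (B + (D - K) + unit_mi i))"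
      proof (rule sum.cong[OF refl])
        fix K assume "K \<in> {K. K \<le> D}"
        show "contraction A D K * T i K = contraction A D K * G (A - K + C + unit_mi i) (B + (D - K) + unit_mi i)"
        proof (cases "K \<le> A")
          case True
          have "A + unit_mi i - K + C = A - K + C + unit_mi i"
          proof
            fix j have "K j \<le> A j" using True by (simp add: le_fun_def)
            then show "(A + unit_mi i - K + C) j = (A - K + C + unit_mi i) j" by simp
          qed
          moreover have "B + unit_mi i + (D - K) = B + (D - K) + unit_mi i" by (simp add: add_ac)
          ultimately show ?thesis by (simp add: T_def)
        qed (simp add: contraction_eq_0)
      qed
      also have "(\<Sum>K | K \<le> D. if 0 < K i then gmet i i * (of_nat (D i) - of_nat (K i - 1)) * contraction A D (K - unit_mi i) * T i K else 0)
          = (\<Sum>K | K \<le> D \<and> 0 < K i. gmet i i * (of_nat (D i) - of_nat (K i - 1)) * contraction A D (K - unit_mi i) * T i K)"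
        using finD by (simp add: sum.inter_filter[symmetric])
      also have "\<dots> = (\<Sum>K | K \<le> D \<and> K i < D i. gmet i i * (of_nat (D i) - of_nat (K i)) * contraction A D K * G (A - K + C) (B + (D - K)))"
      proof (rule sum.reindex_bij_witness[of _ "\<lambda>K. K + unit_mi i" "\<lambda>K. K - unit_mi i"])
        fix K assume K: "K \<in> {K. K \<le> D \<and> 0 < K i}"
        then show eq: "K - unit_mi i + unit_mi i = K" by (simp add: diff_add_unit_mi)
        have le: "K j \<le> D j" for j using K by (auto simp: le_fun_def)
        have "K i - 1 < D i" using le[of i] K by (simp, linarith)
        moreover have "(K - unit_mi i) j \<le> D j" for j using le[of j] by simp
        ultimately show "K - unit_mi i \<in> {K. K \<le> D \<and> K i < D i}" by (simp add: le_fun_def)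
        have e1: "A + unit_mi i - K = A - (K - unit_mi i)"
          using K by (auto simp: fun_eq_iff unit_mi_def)
        have e2: "B + unit_mi i + (D - K) = B + (D - (K - unit_mi i))"
        proof
          fix j show "(B + unit_mi i + (D - K)) j = (B + (D - (K - unit_mi i))) j"
            using K le[of j] by (auto simp: unit_mi_def)
        qed
        show "gmet i i * (of_nat (D i) - of_nat ((K - unit_mi i) i)) * contraction A D (K - unit_mi i) * G (A - (K - unit_mi i) + C) (B + (D - (K - unit_mi i)))
            = gmet i i * (of_nat (D i) - of_nat (K i - 1)) * contraction A D (K - unit_mi i) * T i K"
          unfolding T_def e1 e2 by simp
      next
        fix K assume K: "K \<in> {K. K \<le> D \<and> K i < D i}"
        show "K + unit_mi i - unit_mi i = K" by simp
        show "K + unit_mi i \<in> {K. K \<le> D \<and> 0 < K i}"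
          using K by (auto simp: le_fun_def unit_mi_def)
      qed
      also have "\<dots> = (\<Sum>K | K \<le> D. gmet i i * (of_nat (D i) - of_nat (K i)) * contraction A D K * G (A - K + C) (B + (D - K)))"
        by (rule sum.mono_neutral_left[OF finD]) (auto simp: le_fun_def not_less intro!: antisym)
      finally show ?thesis .
    qed
    then have "(\<Sum>i\<in>UNIV. - gmet i i * S (A + unit_mi i) (B + unit_mi i))
        = (\<Sum>i\<in>UNIV. \<Sum>K | K \<le> D. contraction A D K * (- gmet i i * G (A - K + C + unit_mi i) (B + (D - K) + unit_mi i)
            - (gmet i i * gmet i i) * (of_nat (D i) - of_nat (K i)) * G (A - K + C) (B + (D - K))))"
      by (simp add: sum_distrib_left sum.distrib[symmetric] sum_subtractf[symmetric] sum_negf[symmetric] algebra_simps)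
    also have "\<dots> = (\<Sum>K | K \<le> D. contraction A D K * ((\<Sum>i\<in>UNIV. - gmet i i * G (A - K + C + unit_mi i) (B + (D - K) + unit_mi i))
            - (\<Sum>i\<in>UNIV. of_nat (D i) - of_nat (K i)) * G (A - K + C) (B + (D - K))))"
      unfolding gmet_square by (subst sum.swap) (simp add: sum_distrib_left sum_distrib_right sum_subtractf[symmetric])
    also have "\<dots> = (\<Sum>K | K \<le> D. contraction A D K * ((x + of_nat (mabs A)) * G (A - K + C) (B + (D - K))))"
    proof (rule sum.cong[OF refl])
      fix K assume K: "K \<in> {K. K \<le> D}"
      show "contraction A D K * ((\<Sum>i\<in>UNIV. - gmet i i * G (A - K + C + unit_mi i) (B + (D - K) + unit_mi i))
            - (\<Sum>i\<in>UNIV. of_nat (D i) - of_nat (K i)) * G (A - K + C) (B + (D - K)))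
          = contraction A D K * ((x + of_nat (mabs A)) * G (A - K + C) (B + (D - K)))"
      proof (cases "K \<le> A")
        case True
        then have KA: "mabs K \<le> mabs A" by (rule mabs_mono)
        have KD: "mabs K \<le> mabs D" using K by (auto intro: mabs_mono)
        have deg1: "mabs (A - K + C) = mabs A - mabs K + mabs D" using True by (simp add: mabs_diff CD)
        have deg2: "mabs (B + (D - K)) = mabs A + (mabs D - mabs K)" using K by (simp add: mabs_diff AB)
        have "mabs (A - K + C) = mabs (B + (D - K))" unfolding deg1 deg2 using KA KD by simp
        from G[OF this] have e1: "(\<Sum>i\<in>UNIV. - gmet i i * G (A - K + C + unit_mi i) (B + (D - K) + unit_mi i))
            = (x + (of_nat (mabs A) - of_nat (mabs K) + of_nat (mabs D))) * G (A - K + C) (B + (D - K))"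
          unfolding deg1 using KA by (simp add: of_nat_diff)
        have e2: "(\<Sum>i\<in>UNIV. complex_of_nat (D i) - of_nat (K i)) = of_nat (mabs D) - of_nat (mabs K)"
          by (simp add: sum_subtractf mabs_def)
        show ?thesis unfolding e1 e2 by (simp add: algebra_simps)
      qed (simp add: contraction_eq_0)
    qed
    also have "\<dots> = (x + of_nat (mabs A)) * S A B" by (simp add: S_def sum_distrib_left mult_ac)
    finally show ?thesis .
  qed
  have cancel: "a * b * (p / (a * m * (b * n) * k)) = p / (m * n * k)" if "a \<noteq> 0" "b \<noteq> 0"
    for a b p m n k :: complex using that by simp
  have nz: "complex_of_nat (Suc k) \<noteq> 0" for k by (simp del: of_nat_Suc)
  have "of_nat (Suc (A i)) * of_nat (Suc (B i)) * pair_mult \<Lambda> (A + unit_mi i, B + unit_mi i) t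
      = S (A + unit_mi i) (B + unit_mi i) / (of_nat (mfact A) * of_nat (mfact B) * of_nat (mfact2 t))" for i
    unfolding pm mfact_add_unit of_nat_mult by (rule cancel[OF nz nz])
  then have "(\<Sum>i\<in>UNIV. - gmet i i * (of_nat (Suc (A i)) * of_nat (Suc (B i)) * pair_mult \<Lambda> (A + unit_mi i, B + unit_mi i) t))
      = (\<Sum>i\<in>UNIV. - gmet i i * S (A + unit_mi i) (B + unit_mi i)) / (of_nat (mfact A) * of_nat (mfact B) * of_nat (mfact2 t))"
    by (simp only: sum_divide_distrib times_divide_eq_right)
  also have "\<dots> = (x + of_nat (mabs A)) * pair_mult \<Lambda> (A, B) t" unfolding main pm by simp
  finally show "(\<Sum>i\<in>UNIV. - gmet i i * (of_nat (Suc (A i)) * of_nat (Suc (B i)) * pair_mult \<Lambda> (A + unit_mi i, B + unit_mi i) t))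
      = (x + of_nat (mabs A)) * pair_mult \<Lambda> (A, B) t" .
qed

lemma tame_pair_mult:
  fixes \<Lambda> :: "'n::finite pidx \<Rightarrow> complex"
  assumes \<Lambda>: "tame \<Lambda>" and t: "t \<in> balanced"
  shows "tame (\<lambda>s. pair_mult \<Lambda> s t)"
proof -
  obtain C R where C: "C > 0" "R \<ge> 1" "\<And>t. t \<in> balanced \<Longrightarrow> cmod (\<Lambda> t) \<le> C * R ^ deg t / fact (deg t)"
    using \<Lambda> unfolding tame_def by blast
  define n where "n = card {K. K \<le> snd t}"
  show ?thesis
  proof (rule tameI[of "(real n + 1) * C * (4 * R) ^ deg t" "4 * R"])
    fix s :: "'n pidx" assume s: "s \<in> balanced"
    have "cmod (pair_mult \<Lambda> s t) \<le> of_nat (card (contractions s t)) * (C * (4 * R) ^ (deg s + deg t) / fact (deg s))"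
      unfolding pair_mult_def
    proof (rule order_trans[OF norm_sum sum_bounded_above])
      fix K assume K: "K \<in> contractions s t"
      define N where "N = deg (merge_idx s t K)"
      note m = merge_degree[OF s t K]
      have N: "deg s \<le> N" "N \<le> deg s + deg t" using m by (auto simp: N_def)
      have "cmod (struct_const s t K * \<Lambda> (merge_idx s t K)) \<le> 4 ^ N * (C * R ^ N / fact N)"
        unfolding norm_mult N_def by (intro mult_mono norm_struct_const_le[OF s t K] C(3)[OF m(1)]) auto
      also have "\<dots> = C * (4 * R) ^ N / fact N" by (simp add: power_mult_distrib)
      also have "\<dots> \<le> C * (4 * R) ^ (deg s + deg t) / fact (deg s)"
        using C N by (intro frac_le mult_left_mono power_increasing fact_mono) auto
      finally show "cmod (struct_const s t K * \<Lambda> (merge_idx s t K)) \<le> C * (4 * R) ^ (deg s + deg t) / fact (deg s)" .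
    qed
    also have "\<dots> \<le> (real n + 1) * (C * (4 * R) ^ (deg s + deg t) / fact (deg s))"
    proof (rule mult_right_mono)
      have "card (contractions s t) \<le> n" unfolding n_def
        by (rule card_mono[OF finite_mi_below]) (auto simp: contractions_def)
      then show "real (card (contractions s t)) \<le> real n + 1" by simp
    qed (use C in auto)
    finally show "cmod (pair_mult \<Lambda> s t) \<le> (real n + 1) * C * (4 * R) ^ deg t * (4 * R) ^ deg s / fact (deg s)"
      by (simp add: power_add mult_ac)
  qed (use C in \<open>auto intro!: mult_pos_pos add_nonneg_pos\<close>)
qed

section \<open>Reduction modulo the functions vanishing on the hyperboloid\<close>

definition top_mi :: "nat \<Rightarrow> 'n option mi" where
  "top_mi m = (\<lambda>i. if i = None then m else 0)"

definition drop_top :: "'n option mi \<Rightarrow> 'n option mi" where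
  "drop_top L = L(None := 0)"

lemma mabs_top_mi [simp]: "mabs (top_mi m :: 'n::finite option mi) = m"
  by (simp add: mabs_def top_mi_def)

lemma mfact_top_mi [simp]: "mfact (top_mi m :: 'n::finite option mi) = fact m"
  by (simp add: mfact_option top_mi_def mfact_def)

lemma drop_top_split: "mabs L = mabs (drop_top L) + L None" "mfact L = mfact (drop_top L) * fact (L None)"
  for L :: "'n::finite option mi"
proof -
  have "drop_top L \<circ> Some = L \<circ> Some" "drop_top L None = 0" by (auto simp: drop_top_def)
  then show "mabs L = mabs (drop_top L) + L None" "mfact L = mfact (drop_top L) * fact (L None)"
    using mabs_option[of L] mabs_option[of "drop_top L"] mfact_option[of L] mfact_option[of "drop_top L"] by simp_all
qed

text \<open>
  The multinomial theorem for the powers of \<open>\<bar>z\<^sub>0\<bar>\<^sup>2 = 1 + \<bar>z\<^sub>1\<bar>\<^sup>2 + \<dots> + \<bar>z\<^sub>n\<bar>\<^sup>2\<close>.  The entry of \<open>L\<close> at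
  \<open>None\<close> counts how often the summand \<open>1\<close> is chosen.
\<close>

lemma multinomial_reduction:
  fixes G :: "'n::finite option mi \<Rightarrow> 'n option mi \<Rightarrow> complex"
  assumes rec: "\<And>A B. mabs A = mabs B \<Longrightarrow>
      G (A + unit_mi None) (B + unit_mi None) = G A B + (\<Sum>i\<in>UNIV. G (A + unit_mi (Some i)) (B + unit_mi (Some i)))"
    and AB: "mabs A = mabs B"
  shows "G (A + top_mi m) (B + top_mi m)
    = (\<Sum>L | mabs L = m. fact m / of_nat (mfact L) * G (A + drop_top L) (B + drop_top L))"
  using AB
proof (induction m arbitrary: A B)
  case 0
  have "{L :: 'n option mi. mabs L = 0} = {\<lambda>_. 0}" by (auto simp: mabs_def)
  moreover have "C + top_mi 0 = C" "C + drop_top (\<lambda>_. 0) = C" for C :: "'n option mi"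
    by (auto simp: top_mi_def drop_top_def fun_eq_iff)
  ultimately show ?case by (simp only:) (simp add: mfact_def)
next
  case (Suc m)
  define \<phi> where "\<phi> L = fact m / of_nat (mfact L) * G (A + drop_top L) (B + drop_top L)" for L
  have top: "C + top_mi (Suc m) = C + unit_mi None + top_mi m" for C :: "'n option mi"
    by (auto simp: top_mi_def unit_mi_def)
  have add: "C + unit_mi None + drop_top L = C + drop_top L + unit_mi None" for C L :: "'n option mi"
    by (simp add: add_ac)
  have d0: "C + drop_top (L + unit_mi None) = C + drop_top L" for C L :: "'n option mi"
    by (auto simp: drop_top_def unit_mi_def fun_eq_iff)
  have di: "C + drop_top (L + unit_mi (Some i)) = C + drop_top L + unit_mi (Some i)" for C L :: "'n option mi" and i
    by (auto simp: drop_top_def unit_mi_def fun_eq_iff)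
  have \<phi>: "of_nat (Suc (L j)) * \<phi> (L + unit_mi j)
      = fact m / of_nat (mfact L) * G (A + drop_top (L + unit_mi j)) (B + drop_top (L + unit_mi j))" for L j
    unfolding \<phi>_def mfact_add_unit of_nat_mult by (simp del: of_nat_Suc)
  have "G (A + top_mi (Suc m)) (B + top_mi (Suc m))
      = (\<Sum>L | mabs L = m. fact m / of_nat (mfact L) * G (A + drop_top L + unit_mi None) (B + drop_top L + unit_mi None))"
    unfolding top using Suc.IH[of "A + unit_mi None" "B + unit_mi None"] Suc.prems by (simp only: mabs_add mabs_unit_mi add)
  also have "\<dots> = (\<Sum>L | mabs L = m. \<Sum>j\<in>UNIV. of_nat (Suc (L j)) * \<phi> (L + unit_mi j))"
  proof (rule sum.cong[OF refl])
    fix L :: "'n option mi"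
    have "G (A + drop_top L + unit_mi None) (B + drop_top L + unit_mi None)
        = G (A + drop_top L) (B + drop_top L) + (\<Sum>i\<in>UNIV. G (A + drop_top L + unit_mi (Some i)) (B + drop_top L + unit_mi (Some i)))"
      by (rule rec) (simp add: Suc.prems)
    then show "fact m / of_nat (mfact L) * G (A + drop_top L + unit_mi None) (B + drop_top L + unit_mi None)
        = (\<Sum>j\<in>UNIV. of_nat (Suc (L j)) * \<phi> (L + unit_mi j))"
      unfolding \<phi> sum_UNIV_option d0 di by (simp only: distrib_left sum_distrib_left)
  qed
  also have "\<dots> = (\<Sum>j\<in>UNIV. \<Sum>L | mabs L = m. of_nat (Suc (L j)) * \<phi> (L + unit_mi j))"
    by (rule sum.swap)
  also have "\<dots> = of_nat (Suc m) * (\<Sum>L | mabs L = Suc m. \<phi> L)" by (rule sum_mabs_Suc)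
  also have "\<dots> = (\<Sum>L | mabs L = Suc m. fact (Suc m) / of_nat (mfact L) * G (A + drop_top L) (B + drop_top L))"
    by (simp add: \<phi>_def sum_distrib_left mult.assoc)
  finally show ?case .
qed

text \<open>
  The exponent of \<open>\<bar>z\<^sub>0\<bar>\<^sup>2\<close> in the monomial, which \<open>red_idx\<close> replaces by the choice \<open>L\<close> of summands
  of \<open>(1 + \<bar>z\<^sub>1\<bar>\<^sup>2 + \<dots> + \<bar>z\<^sub>n\<bar>\<^sup>2) ^ top_part t\<close>.
\<close>

definition top_part :: "'n::finite pidx \<Rightarrow> nat" where
  "top_part t = min (fst t None) (snd t None)"

definition red_idx :: "'n::finite pidx \<Rightarrow> 'n option mi \<Rightarrow> 'n pidx" where
  "red_idx t L = (fst t - top_mi (top_part t) + drop_top L, snd t - top_mi (top_part t) + drop_top L)"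

definition red_coef :: "complex \<Rightarrow> 'n::finite pidx \<Rightarrow> 'n option mi \<Rightarrow> complex" where
  "red_coef x t L = pochhammer x (deg t) / of_nat (mfact2 t) * (fact (mabs L) / of_nat (mfact L))
     * (of_nat (mfact2 (red_idx t L)) / pochhammer x (deg (red_idx t L)))"

definition reductions :: "('n::finite pidx \<times> 'n option mi) set" where
  "reductions = Sigma balanced (\<lambda>t. {L. mabs L = top_part t})"

definition reduced :: "'n::finite pidx set" where
  "reduced = {u \<in> balanced. top_part u = 0}"

text \<open>
  Infinitely many indices \<open>t\<close> reduce to the same \<open>u\<close>, since the summand \<open>1\<close> may be chosen any number
  of times.
\<close>

definition reduce :: "complex \<Rightarrow> ('n::finite pidx \<Rightarrow> complex) \<Rightarrow> 'n pidx \<Rightarrow> complex" where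
  "reduce x a u = (\<Sum>\<^sub>\<infinity>p\<in>{p \<in> reductions. case_prod red_idx p = u}. a (fst p) * case_prod (red_coef x) p)"

lemma sub_top_add: "fst t - top_mi (top_part t) + top_mi (top_part t) = fst t"
  "snd t - top_mi (top_part t) + top_mi (top_part t) = snd t"
  by (auto simp: top_mi_def top_part_def fun_eq_iff)

lemma reductions_degree:
  assumes "(t, L) \<in> reductions"
  shows "red_idx t L \<in> reduced" "deg t = deg (red_idx t L) + L None" "mabs L \<le> deg t"
    "mabs (drop_top L) \<le> deg (red_idx t L)"
proof -
  have t: "t \<in> balanced" and L: "mabs L = top_part t" using assms by (auto simp: reductions_def)
  have d: "mabs (fst t - top_mi (top_part t)) + top_part t = mabs (fst t)"
    "mabs (snd t - top_mi (top_part t)) + top_part t = mabs (snd t)"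
    using arg_cong[OF sub_top_add(1)[of t], of mabs] arg_cong[OF sub_top_add(2)[of t], of mabs] by simp_all
  have "mabs (fst t) = mabs (snd t)" using t by (auto simp: balanced_def)
  then have "red_idx t L \<in> balanced" using d by (simp add: red_idx_def balanced_def)
  moreover have "top_part (red_idx t L) = 0"
    by (auto simp: top_part_def red_idx_def top_mi_def drop_top_def)
  ultimately show "red_idx t L \<in> reduced" by (simp add: reduced_def)
  show "deg t = deg (red_idx t L) + L None"
    using d(1) L drop_top_split(1)[of L] by (simp add: red_idx_def)
  show "mabs L \<le> deg t" using d(1) L by simp
  show "mabs (drop_top L) \<le> deg (red_idx t L)" by (simp add: red_idx_def)
qed

lemma red_idx_reduced: "p \<in> reductions \<Longrightarrow> case_prod red_idx p \<in> reduced"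
  using reductions_degree(1) by (cases p) simp

lemma reduced_balanced: "u \<in> reduced \<Longrightarrow> u \<in> balanced"
  by (simp add: reduced_def)

text \<open>
  The level relation solved for the term with \<open>\<bar>z\<^sub>0\<bar>\<^sup>2\<close> and iterated until one of the exponents of
  \<open>z\<^sub>0\<close> and \<open>cnj z\<^sub>0\<close> is used up.  Dividing the functional by the Pochhammer symbol and the factorials
  brings the relation into the form of \<open>multinomial_reduction\<close>.
\<close>

lemma level_reduction:
  fixes \<Lambda> :: "'n::finite pidx \<Rightarrow> complex"
  assumes \<Lambda>: "level x \<Lambda>" and x: "\<And>n. pochhammer x n \<noteq> 0" and t: "t \<in> balanced"
  shows "\<Lambda> t = (\<Sum>L | mabs L = top_part t. red_coef x t L * \<Lambda> (red_idx t L))"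
proof -
  define G where "G A B = of_nat (mfact A) * of_nat (mfact B) / pochhammer x (mabs A) * \<Lambda> (A, B)" for A B
  have rec: "G (A + unit_mi None) (B + unit_mi None) = G A B + (\<Sum>i\<in>UNIV. G (A + unit_mi (Some i)) (B + unit_mi (Some i)))"
    if AB: "mabs A = mabs B" for A B
  proof -
    define k where "k = of_nat (mfact A) * of_nat (mfact B) / pochhammer x (Suc (mabs A))"
    have xa: "x + of_nat (mabs A) \<noteq> 0" using x[of "Suc (mabs A)"] by (auto simp: pochhammer_Suc)
    have Gi: "G (A + unit_mi i) (B + unit_mi i) = k * (of_nat (Suc (A i)) * of_nat (Suc (B i)) * \<Lambda> (A + unit_mi i, B + unit_mi i))" for i
      unfolding G_def k_def mfact_add_unit of_nat_mult by (simp add: mult_ac del: of_nat_Suc)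
    have "k * (\<Sum>i\<in>UNIV. - gmet i i * (of_nat (Suc (A i)) * of_nat (Suc (B i)) * \<Lambda> (A + unit_mi i, B + unit_mi i)))
        = k * ((x + of_nat (mabs A)) * \<Lambda> (A, B))"
      using \<Lambda> AB unfolding level_def by simp
    also have "\<dots> = G A B" using x[of "mabs A"] xa by (simp add: k_def G_def pochhammer_Suc)
    also have "k * (\<Sum>i\<in>UNIV. - gmet i i * (of_nat (Suc (A i)) * of_nat (Suc (B i)) * \<Lambda> (A + unit_mi i, B + unit_mi i)))
        = (\<Sum>i\<in>UNIV. - gmet i i * G (A + unit_mi i) (B + unit_mi i))"
      unfolding Gi sum_distrib_left by (simp only: mult_ac)
    also have "\<dots> = G (A + unit_mi None) (B + unit_mi None) - (\<Sum>i\<in>UNIV. G (A + unit_mi (Some i)) (B + unit_mi (Some i)))"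
      unfolding sum_UNIV_option by (simp add: gmet_def sum_negf)
    finally show ?thesis by (simp add: algebra_simps)
  qed
  define m where "m = top_part t"
  define A B where "A = fst t - top_mi m" and "B = snd t - top_mi m"
  have tA: "A + top_mi m = fst t" and tB: "B + top_mi m = snd t" unfolding A_def B_def m_def by (rule sub_top_add)+
  have "mabs A + m = mabs B + m"
    using arg_cong[OF tA, of mabs] arg_cong[OF tB, of mabs] t by (auto simp: balanced_def)
  then have AB: "mabs A = mabs B" by simp
  have "G (fst t) (snd t) = (\<Sum>L | mabs L = m. fact m / of_nat (mfact L) * G (A + drop_top L) (B + drop_top L))"
    using multinomial_reduction[of G, OF rec AB, of m] unfolding tA tB .
  moreover have "\<Lambda> t = pochhammer x (deg t) / of_nat (mfact2 t) * G (fst t) (snd t)"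
    using x by (simp add: G_def mfact2_def less_imp_neq[symmetric])
  moreover have "pochhammer x (deg t) / of_nat (mfact2 t) * (fact m / of_nat (mfact L) * G (A + drop_top L) (B + drop_top L))
      = red_coef x t L * \<Lambda> (red_idx t L)" if "mabs L = m" for L
    using that by (simp add: red_coef_def red_idx_def G_def mfact2_def A_def B_def m_def mult.assoc)
  ultimately show ?thesis by (simp add: sum_distrib_left m_def)
qed

lemma mfact_add_le: "mfact (A + B) \<le> 2 ^ mabs (A + B) * (mfact A * mfact B)"
proof -
  have "mfact (A + B) \<le> (\<Prod>i\<in>UNIV. 2 ^ (A i + B i) * (fact (A i) * fact (B i)))"
    unfolding mfact_def by (rule prod_mono) (simp add: fact_add_le)
  also have "\<dots> = 2 ^ mabs (A + B) * (mfact A * mfact B)"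
    by (simp add: mfact_def mabs_def prod.distrib power_sum del: power_add)
  finally show ?thesis .
qed

lemma mfact_mult_le: "mfact A * mfact B \<le> mfact (A + B)"
proof -
  have "mfact A * mfact B = (\<Prod>i\<in>UNIV. fact (A i) * fact (B i))" by (simp add: mfact_def prod.distrib)
  also have "\<dots> \<le> mfact (A + B)" unfolding mfact_def by (rule prod_mono) (simp add: fact_mult_le)
  finally show ?thesis .
qed

text \<open>
  The two factorials of the removed power of \<open>\<bar>z\<^sub>0\<bar>\<^sup>2\<close> beat the growth of the Pochhammer
  symbol by one factorial; this makes the sums over all sources of a reduced index converge.
\<close>

lemma norm_red_coef_le:
  assumes x: "cmod x \<le> real X" "\<And>n. pochhammer x n \<noteq> 0" and tL: "(t, L) \<in> reductions"
  shows "cmod (red_coef x t L) \<le> 2 ^ X * 8 ^ deg t / fact (L None)"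
proof -
  define N where "N = deg (red_idx t L)"
  define l where "l = L None"
  define m where "m = mabs L"
  define K where "K = drop_top L"
  define A B where "A = fst t - top_mi m" and "B = snd t - top_mi m"
  note d = reductions_degree[OF tL]
  have m: "m = top_part t" using tL by (simp add: reductions_def m_def)
  have degt: "deg t = N + l" using d(2) by (simp add: N_def l_def)
  have red: "red_idx t L = (A + K, B + K)" by (simp add: red_idx_def A_def B_def K_def m)
  have N2: "mabs (A + K) = N" "mabs (B + K) = N"
    using d(1) by (auto simp: N_def red reduced_def balanced_def)
  have nat_bound: "mfact2 (red_idx t L) * fact m * (fact l * fact l) \<le> 4 ^ N * (mfact2 t * mfact L)"
  proof -
    have L: "mfact L = mfact K * fact l" using drop_top_split(2)[of L] by (simp add: K_def l_def)
    have Lm: "mfact L \<le> fact m" unfolding m_def by (rule mfact_le_fact_mabs)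
    have fA: "mfact A * fact m \<le> mfact (fst t)"
      using mfact_mult_le[of A "top_mi m"] sub_top_add(1)[of t] by (simp add: A_def m)
    have fB: "mfact B * fact m \<le> mfact (snd t)"
      using mfact_mult_le[of B "top_mi m"] sub_top_add(2)[of t] by (simp add: B_def m)
    have "mfact2 (red_idx t L) * fact m * (fact l * fact l)
        \<le> ((2 ^ N * (mfact A * mfact K)) * (2 ^ N * (mfact B * mfact K))) * fact m * (fact l * fact l)"
      unfolding red mfact2_def fst_conv snd_conv using mfact_add_le[of A K] mfact_add_le[of B K]
      by (intro mult_le_mono order_refl) (simp_all only: N2)
    also have "\<dots> = 4 ^ N * ((mfact A * mfact L) * (mfact B * fact m) * mfact L)"
      unfolding L by (simp add: mult_ac power_mult_distrib[symmetric])
    also have "\<dots> \<le> 4 ^ N * ((mfact A * fact m) * (mfact B * fact m) * mfact L)"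
      by (intro mult_le_mono order_refl Lm)
    also have "\<dots> \<le> 4 ^ N * (mfact (fst t) * mfact (snd t) * mfact L)"
      by (intro mult_le_mono order_refl fA fB)
    finally show ?thesis by (simp add: mfact2_def)
  qed
  have poch: "pochhammer x (N + l) / pochhammer x N = pochhammer (x + of_nat N) l"
    using x(2)[of N] by (simp add: pochhammer_product')
  have "cmod (x + of_nat N) \<le> real (X + N)"
    using norm_triangle_ineq[of x "of_nat N"] x(1) by simp
  from norm_pochhammer_le[OF this, of l]
  have p: "cmod (pochhammer (x + of_nat N) l) \<le> 2 ^ (X + N + l) * fact l" .
  have "red_coef x t L = pochhammer x (N + l) / pochhammer x N
      * (of_nat (mfact2 (red_idx t L)) * fact m / (of_nat (mfact2 t) * of_nat (mfact L)))"
    unfolding red_coef_def degt N_def[symmetric] m_def[symmetric] by (simp add: mult_ac)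
  then have "cmod (red_coef x t L) = cmod (pochhammer (x + of_nat N) l)
      * (real (mfact2 (red_idx t L) * fact m) / real (mfact2 t * mfact L))"
    unfolding poch by (simp add: norm_mult norm_divide)
  also have "\<dots> \<le> (2 ^ (X + N + l) * fact l) * (4 ^ N / (fact l * fact l))"
  proof (rule mult_mono[OF p])
    have "real (mfact2 (red_idx t L) * fact m * (fact l * fact l)) \<le> real (4 ^ N * (mfact2 t * mfact L))"
      using nat_bound by (simp only: of_nat_le_iff)
    moreover have "0 < real (mfact2 t * mfact L)" by simp
    ultimately show "real (mfact2 (red_idx t L) * fact m) / real (mfact2 t * mfact L) \<le> 4 ^ N / (fact l * fact l)"
      by (simp add: field_simps)
  qed auto
  also have "\<dots> = 2 ^ X * (2 ^ l * 8 ^ N) / fact l"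
    by (simp add: power_add power_mult_distrib[symmetric] field_simps)
  also have "\<dots> \<le> 2 ^ X * (8 ^ l * 8 ^ N) / fact l"
    by (intro divide_right_mono mult_left_mono mult_right_mono power_mono) auto
  finally show ?thesis by (simp add: degt l_def power_add mult_ac)
qed

text \<open>
  Applying \<open>level_reduction\<close> to every basis function gives an absolutely summable double family,
  which is then summed along the reduced indices first.
\<close>

lemma has_sum_reduce:
  fixes a \<Lambda> :: "'n::finite pidx \<Rightarrow> complex"
  assumes a: "a \<in> rapid" and x: "\<And>n. pochhammer x n \<noteq> 0" and \<Lambda>: "level x \<Lambda>" "tame \<Lambda>"
  shows "pairing \<Lambda> (reduce x a) = pairing \<Lambda> a"
proof -
  define f where "f p = a (fst p) * case_prod (red_coef x) p * \<Lambda> (case_prod red_idx p)" for p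
  obtain X where X: "cmod x \<le> real X" using real_arch_simple by blast
  obtain Ca where Ca: "Ca > 0" "\<And>t. cmod (a t) \<le> Ca * fact (deg t) powr (1/2)"
    using rapid_bound[OF a, of "1/2"] by auto
  obtain D R where D: "D > 0" "R \<ge> 1" "\<And>t. t \<in> balanced \<Longrightarrow> cmod (\<Lambda> t) \<le> D * R ^ deg t / fact (deg t)"
    using \<Lambda>(2) unfolding tame_def by blast
  obtain M where M: "M > 0" "\<And>n. (16 * R) ^ n * fact n powr (1/2) / fact n \<le> M * (1/4) ^ n"
    using fact_powr_absorb[of "16 * R" "1/4" "1/2"] D(2) by auto
  have bound: "norm (f p) \<le> Ca * D * 2 ^ X * M * ((1/2) ^ deg (fst p) * (1/2) ^ mabs (snd p))" if p: "p \<in> reductions" for p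
  proof -
    obtain t L where tL: "p = (t, L)" by fastforce
    note d = reductions_degree[OF p[unfolded tL]]
    define N where "N = deg (red_idx t L)"
    define l where "l = L None"
    define \<alpha> where "\<alpha> = deg t"
    have \<alpha>: "\<alpha> = N + l" using d(2) by (simp add: \<alpha>_def N_def l_def)
    have "norm (f p) \<le> (Ca * fact \<alpha> powr (1/2)) * (2 ^ X * 8 ^ \<alpha> / fact l) * (D * R ^ N / fact N)"
      unfolding f_def tL fst_conv prod.case norm_mult
      using Ca D d(1) norm_red_coef_le[OF X x p[unfolded tL]]
      by (intro mult_mono) (auto simp: \<alpha>_def l_def N_def reduced_def)
    also have "\<dots> = Ca * D * 2 ^ X * (8 ^ \<alpha> * fact \<alpha> powr (1/2) * R ^ N) * (1 / (fact l * fact N))" by simp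
    also have "\<dots> \<le> Ca * D * 2 ^ X * (8 ^ \<alpha> * fact \<alpha> powr (1/2) * R ^ \<alpha>) * (2 ^ \<alpha> / fact \<alpha>)"
    proof (rule mult_mono)
      show "Ca * D * 2 ^ X * (8 ^ \<alpha> * fact \<alpha> powr (1/2) * R ^ N) \<le> Ca * D * 2 ^ X * (8 ^ \<alpha> * fact \<alpha> powr (1/2) * R ^ \<alpha>)"
        using Ca D by (intro mult_left_mono power_increasing) (auto simp: \<alpha>)
      have "real (fact \<alpha>) \<le> real (2 ^ \<alpha> * (fact N * fact l))"
        unfolding \<alpha> of_nat_le_iff by (rule fact_add_le)
      then show "1 / (fact l * fact N) \<le> (2 ^ \<alpha> / fact \<alpha> :: real)" by (simp add: field_simps)
    qed (use Ca D in auto)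
    also have "\<dots> = Ca * D * 2 ^ X * ((16 * R) ^ \<alpha> * fact \<alpha> powr (1/2) / fact \<alpha>)"
    proof -
      have "(16 :: real) ^ \<alpha> = 8 ^ \<alpha> * 2 ^ \<alpha>" by (simp add: power_mult_distrib[symmetric])
      then show ?thesis by (simp add: power_mult_distrib)
    qed
    also have "\<dots> \<le> Ca * D * 2 ^ X * (M * (1/4) ^ \<alpha>)" using Ca D M by (intro mult_left_mono) auto
    also have "(1/4 :: real) ^ \<alpha> = (1/2) ^ \<alpha> * (1/2) ^ \<alpha>" by (simp add: power_mult_distrib[symmetric])
    also have "Ca * D * 2 ^ X * (M * ((1/2) ^ \<alpha> * (1/2) ^ \<alpha>)) \<le> Ca * D * 2 ^ X * (M * ((1/2) ^ \<alpha> * (1/2) ^ mabs L))"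
      using Ca D M d(3) by (intro mult_left_mono power_decreasing) (auto simp: \<alpha>_def)
    finally show ?thesis by (simp add: tL \<alpha>_def mult.assoc)
  qed
  define p2 where "p2 = (\<lambda>t :: 'n pidx. (1/2 :: real) ^ deg t)"
  define q2 where "q2 = (\<lambda>L :: 'n option mi. (1/2 :: real) ^ mabs L)"
  have p2: "p2 summable_on balanced" "\<And>t. 0 \<le> p2 t"
    unfolding p2_def by (rule summable_on_balanced) simp_all
  have q2: "q2 summable_on UNIV" "\<And>K. 0 \<le> q2 K"
    unfolding q2_def by (rule summable_on_mi_geometric) simp_all
  have "(\<lambda>(t, L). p2 t * q2 L) summable_on balanced \<times> UNIV"
    by (rule summable_on_prod_nonneg[OF p2(1) q2(1) p2(2) q2(2)])
  then have "(\<lambda>(t, L). p2 t * q2 L) summable_on reductions"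
    by (rule summable_on_subset_banach) (auto simp: reductions_def)
  then have "(\<lambda>p. (Ca * D * 2 ^ X * M) * (case p of (t, L) \<Rightarrow> p2 t * q2 L)) summable_on reductions"
    by (rule summable_on_cmult_right)
  then have "(\<lambda>p. norm (f p)) summable_on reductions"
    by (rule Infinite_Sum.abs_summable_on_comparison_test') (use bound in \<open>auto simp: p2_def q2_def split_def\<close>)
  then have sm: "f summable_on reductions" by (rule abs_summable_summable)
  have "((\<lambda>u. \<Sum>\<^sub>\<infinity>p\<in>{p \<in> reductions. case_prod red_idx p = u}. f p) has_sum infsum f reductions) balanced"
    by (rule has_sum_fibres) (use has_sum_infsum[OF sm] red_idx_reduced reduced_balanced in blast)+
  moreover have "(\<Sum>\<^sub>\<infinity>p\<in>{p \<in> reductions. case_prod red_idx p = u}. f p) = reduce x a u * \<Lambda> u" for u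
    unfolding reduce_def infsum_cmult_left'[symmetric] by (rule infsum_cong) (auto simp: f_def)
  ultimately have "pairing \<Lambda> (reduce x a) = infsum f reductions"
    unfolding pairing_def by (simp add: infsumI)
  also have "\<dots> = (\<Sum>\<^sub>\<infinity>t\<in>balanced. \<Sum>\<^sub>\<infinity>L\<in>{L. mabs L = top_part t}. f (t, L))"
    unfolding reductions_def by (rule infsum_Sigma_banach[symmetric]) (use sm in \<open>simp add: reductions_def\<close>)
  also have "\<dots> = (\<Sum>\<^sub>\<infinity>t\<in>balanced. a t * \<Lambda> t)"
  proof (rule infsum_cong)
    fix t :: "'n pidx" assume t: "t \<in> balanced"
    show "(\<Sum>\<^sub>\<infinity>L\<in>{L. mabs L = top_part t}. f (t, L)) = a t * \<Lambda> t"
      unfolding infsum_finite[OF finite_mabs_eq] level_reduction[OF \<Lambda>(1) x t] sum_distrib_left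
      by (simp add: f_def mult.assoc)
  qed
  finally show ?thesis by (simp add: pairing_def)
qed

lemma reduce_outside: "u \<notin> reduced \<Longrightarrow> reduce x a u = 0"
proof -
  assume "u \<notin> reduced"
  then have "{p \<in> reductions. case_prod red_idx p = u} = {}" using red_idx_reduced by blast
  then show ?thesis by (simp only: reduce_def infsum_empty)
qed

text \<open>
  From the reduced index and \<open>L\<close> the original index is recovered, so a fibre is controlled by the
  geometric series over \<open>L\<close>.
\<close>

lemma inj_on_red_fibre: "inj_on snd {p \<in> reductions. case_prod red_idx p = u}"
proof (rule inj_onI)
  fix p q :: "'a pidx \<times> 'a option mi"
  assume p: "p \<in> {p \<in> reductions. case_prod red_idx p = u}" and q: "q \<in> {p \<in> reductions. case_prod red_idx p = u}"
    and eq: "snd p = snd q"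
  obtain t L where pt: "p = (t, L)" by fastforce
  obtain s where qs: "q = (s, L)" using eq pt by (cases q) auto
  have m: "top_part t = mabs L" "top_part s = mabs L" using p q by (auto simp: pt qs reductions_def)
  have "red_idx t L = red_idx s L" using p q by (simp add: pt qs)
  then have "fst t - top_mi (mabs L) = fst s - top_mi (mabs L)" "snd t - top_mi (mabs L) = snd s - top_mi (mabs L)"
    by (simp_all add: red_idx_def m)
  then have "fst t = fst s" "snd t = snd s"
    using sub_top_add[of t] sub_top_add[of s] unfolding m by metis+
  then show "p = q" by (simp add: pt qs prod_eq_iff)
qed

lemma reduce_rapid:
  fixes a :: "'n::finite pidx \<Rightarrow> complex"
  assumes a: "a \<in> rapid" and x: "\<And>n. pochhammer x n \<noteq> 0"
  shows "reduce x a \<in> rapid"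
proof (rule rapidI)
  fix u :: "'n pidx" assume "u \<notin> balanced"
  then show "reduce x a u = 0" by (intro reduce_outside) (simp add: reduced_def)
next
  fix \<epsilon> :: real assume \<epsilon>: "0 < \<epsilon>" "\<epsilon> < 1"
  \<comment> \<open>one half of the exponent bounds the coefficients of \<open>a\<close>, the other absorbs \<open>32 ^ N\<close>\<close>
  define \<delta> where "\<delta> = \<epsilon> / 2"
  have \<delta>: "0 < \<delta>" "\<delta> < 1" "\<delta> + \<delta> = \<epsilon>" using \<epsilon> by (auto simp: \<delta>_def)
  obtain X where X: "cmod x \<le> real X" using real_arch_simple by blast
  obtain Ca where Ca: "Ca > 0" "\<And>t. cmod (a t) \<le> Ca * fact (deg t) powr \<delta>"
    using rapid_bound[OF a \<delta>(1,2)] by blast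
  \<comment> \<open>\<open>8 ^ (N + l) * 2 ^ (N + l)\<close> comes from the reduction coefficient and from splitting \<open>fact (N + l)\<close>,
    and \<open>(1/2) ^ l \<le> 2 ^ N * (1/2) ^ mabs L\<close> turns \<open>16 ^ N\<close> into \<open>32 ^ N\<close>\<close>
  obtain M where M: "M > 0" "\<And>n. 16 ^ n * fact n powr \<delta> / fact n \<le> M * (1/2) ^ n"
    using fact_powr_absorb[of 16 "1/2" \<delta>] \<delta> by auto
  obtain D where D: "D > 0" "\<And>n. 32 ^ n \<le> D * fact n powr \<delta>"
    using power_le_fact_powr[of 32 \<delta>] \<delta> by auto
  define S where "S = (\<Sum>\<^sub>\<infinity>L\<in>(UNIV :: 'n option mi set). (1/2 :: real) ^ mabs L)"
  have sm: "(\<lambda>L :: 'n option mi. (1/2 :: real) ^ mabs L) summable_on UNIV"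
    by (rule summable_on_mi_geometric) simp_all
  have S0: "S \<ge> 0" unfolding S_def by (rule infsum_nonneg) simp
  define W where "W = Ca * 2 ^ X * M * D * (S + 1)"
  have "cmod (reduce x a u) \<le> W * fact (deg u) powr \<epsilon>" for u
  proof -
    define P where "P = {p \<in> reductions. case_prod red_idx p = u}"
    define N where "N = deg u"
    define c where "c = Ca * 2 ^ X * M * 32 ^ N * fact N powr \<delta>"
    have c0: "c \<ge> 0" using Ca M by (simp add: c_def)
    define f where "f p = a (fst p) * case_prod (red_coef x) p" for p
    have bound: "norm (f p) \<le> c * (1/2) ^ mabs (snd p)" if p: "p \<in> P" for p
    proof -
      obtain t L where tL: "p = (t, L)" by fastforce
      have pr: "(t, L) \<in> reductions" and u: "red_idx t L = u" using p by (auto simp: P_def tL)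
      note d = reductions_degree[OF pr]
      define l where "l = L None"
      have deg: "deg t = N + l" using d(2) by (simp add: u N_def l_def)
      have "mabs L \<le> N + l" using d(3) deg by simp
      have "fact (N + l) powr \<delta> \<le> (2 ^ (N + l) * (fact N * fact l)) powr \<delta>"
        using \<delta> of_nat_mono[OF fact_add_le[of N l], where 'a = real] by (intro powr_mono2) auto
      also have "\<dots> = (2 ^ (N + l)) powr \<delta> * (fact N powr \<delta> * fact l powr \<delta>)"
        by (simp add: powr_mult)
      also have "\<dots> \<le> 2 ^ (N + l) * (fact N powr \<delta> * fact l powr \<delta>)"
      proof (rule mult_right_mono)
        have "(2 ^ (N + l) :: real) powr \<delta> \<le> (2 ^ (N + l)) powr 1"
          using \<delta> by (intro powr_mono) (auto simp del: powr_one_gt_zero_iff)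
        then show "(2 ^ (N + l) :: real) powr \<delta> \<le> 2 ^ (N + l)" by simp
      qed auto
      finally have fp: "fact (N + l) powr \<delta> \<le> 2 ^ (N + l) * (fact N powr \<delta> * fact l powr \<delta> :: real)" .
      have "norm (f p) \<le> (Ca * fact (N + l) powr \<delta>) * (2 ^ X * 8 ^ (N + l) / fact l)"
        unfolding f_def tL fst_conv prod.case norm_mult
        using Ca(1) Ca(2)[of t] norm_red_coef_le[OF X x pr] unfolding deg l_def[symmetric]
        by (intro mult_mono) auto
      also have "\<dots> \<le> (Ca * (2 ^ (N + l) * (fact N powr \<delta> * fact l powr \<delta>))) * (2 ^ X * 8 ^ (N + l) / fact l)"
        using Ca(1) fp by (intro mult_right_mono mult_left_mono) auto
      also have "\<dots> = Ca * 2 ^ X * fact N powr \<delta> * 16 ^ N * (16 ^ l * fact l powr \<delta> / fact l)"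
      proof -
        have "(16 :: real) ^ n = 8 ^ n * 2 ^ n" for n by (simp add: power_mult_distrib[symmetric])
        then show ?thesis by (simp add: power_add mult_ac)
      qed
      also have "\<dots> \<le> Ca * 2 ^ X * fact N powr \<delta> * 16 ^ N * (M * (1/2) ^ l)"
        using Ca M by (intro mult_left_mono) auto
      also have "\<dots> \<le> Ca * 2 ^ X * fact N powr \<delta> * 16 ^ N * (M * (2 ^ N * (1/2) ^ mabs L))"
      proof (intro mult_left_mono)
        have "(1/2 :: real) ^ (N + l) \<le> (1/2) ^ mabs L" using \<open>mabs L \<le> N + l\<close> by (intro power_decreasing) auto
        then have "2 ^ N * ((1/2 :: real) ^ (N + l)) \<le> 2 ^ N * (1/2) ^ mabs L" by (rule mult_left_mono) simp
        moreover have "2 ^ N * ((1/2 :: real) ^ (N + l)) = (1/2) ^ l"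
          by (simp add: power_add power_divide)
        ultimately show "(1/2 :: real) ^ l \<le> 2 ^ N * (1/2) ^ mabs L" by simp
      qed (use Ca M in auto)
      also have "\<dots> = c * (1/2) ^ mabs L"
      proof -
        have "(32 :: real) ^ N = 16 ^ N * 2 ^ N" by (simp add: power_mult_distrib[symmetric])
        then show ?thesis by (simp add: c_def mult_ac)
      qed
      finally show ?thesis by (simp add: tL)
    qed
    have inj: "inj_on snd P" unfolding P_def by (rule inj_on_red_fibre)
    have smP: "(\<lambda>L :: 'n option mi. (1/2 :: real) ^ mabs L) summable_on (snd ` P)"
      by (rule summable_on_subset_banach[OF sm]) simp
    then have smP': "(\<lambda>p. (1/2 :: real) ^ mabs (snd p)) summable_on P"
      using summable_on_reindex[OF inj, of "\<lambda>L. (1/2 :: real) ^ mabs L"] by (simp add: o_def)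
    have nf: "(\<lambda>p. norm (f p)) summable_on P"
      by (rule Infinite_Sum.abs_summable_on_comparison_test'[OF summable_on_cmult_right[OF smP'] bound])
    have "cmod (reduce x a u) \<le> (\<Sum>\<^sub>\<infinity>p\<in>P. norm (f p))"
      unfolding reduce_def P_def[symmetric] f_def[symmetric] by (rule norm_infsum_bound[OF nf])
    also have "\<dots> \<le> (\<Sum>\<^sub>\<infinity>p\<in>P. c * (1/2) ^ mabs (snd p))"
      by (rule infsum_mono[OF nf summable_on_cmult_right[OF smP'] bound])
    also have "\<dots> = c * (\<Sum>\<^sub>\<infinity>p\<in>P. (1/2) ^ mabs (snd p))" by (rule infsum_cmult_right')
    also have "(\<Sum>\<^sub>\<infinity>p\<in>P. (1/2 :: real) ^ mabs (snd p)) = (\<Sum>\<^sub>\<infinity>L\<in>snd ` P. (1/2) ^ mabs L)"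
      using infsum_reindex[OF inj, of "\<lambda>L. (1/2 :: real) ^ mabs L"] by (simp add: o_def)
    also have "\<dots> \<le> S" unfolding S_def by (rule infsum_mono2[OF smP sm]) auto
    finally have "cmod (reduce x a u) \<le> c * S" using c0 by (simp add: mult_left_mono)
    also have "\<dots> \<le> c * (S + 1)" using c0 by (intro mult_left_mono) auto
    also have "\<dots> = Ca * 2 ^ X * M * (S + 1) * fact N powr \<delta> * 32 ^ N" by (simp add: c_def mult_ac)
    also have "\<dots> \<le> Ca * 2 ^ X * M * (S + 1) * fact N powr \<delta> * (D * fact N powr \<delta>)"
      using Ca M S0 D by (intro mult_left_mono) auto
    also have "\<dots> = W * (fact N powr \<delta> * fact N powr \<delta>)" by (simp add: W_def mult_ac)
    also have "fact N powr \<delta> * fact N powr \<delta> = (fact N powr \<epsilon> :: real)"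
      using \<delta>(3) by (simp add: powr_add[symmetric])
    finally show ?thesis by (simp add: N_def)
  qed
  moreover have "W > 0" using Ca M D S0 by (simp add: W_def)
  ultimately show "\<exists>C>0. \<forall>t. cmod (reduce x a t) \<le> C * fact (deg t) powr \<epsilon>" by blast
qed

section \<open>The quotient algebra\<close>

text \<open>
  The index of the Schauder basis: of the two zeroth exponents the smaller one is \<open>0\<close>.
\<close>

definition red_pair :: "'n::finite mi \<times> 'n mi \<Rightarrow> 'n pidx" where
  "red_pair p = (lift_mi (max (mabs (fst p)) (mabs (snd p))) (fst p), lift_mi (max (mabs (fst p)) (mabs (snd p))) (snd p))"

lemma triple_of_red_pair: "triple_of (red_pair (P, Q)) = (P, Q, max (mabs P) (mabs Q))"
  by (simp add: triple_of_def red_pair_def mabs_lift_mi)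

lemma bij_red_pair: "bij_betw red_pair UNIV (reduced :: 'n::finite pidx set)"
proof (rule bij_betw_byWitness[where f' = "\<lambda>(A, B). (A \<circ> Some, B \<circ> Some)"])
  show "\<forall>u\<in>(reduced :: 'n pidx set). red_pair ((\<lambda>(A, B). (A \<circ> Some, B \<circ> Some)) u) = u"
  proof
    fix u :: "'n pidx" assume u: "u \<in> reduced"
    obtain A B where AB: "u = (A, B)" by fastforce
    have "mabs A = mabs B" "A None = 0 \<or> B None = 0"
      using u by (auto simp: AB reduced_def balanced_def top_part_def min_def split: if_splits)
    then have "max (mabs (A \<circ> Some)) (mabs (B \<circ> Some)) = mabs A" "mabs A = mabs B"
      by (auto simp: mabs_option[of A] mabs_option[of B])
    then show "red_pair ((\<lambda>(A, B). (A \<circ> Some, B \<circ> Some)) u) = u"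
      by (simp add: AB red_pair_def lift_mi_restrict)
  qed
qed (auto simp: red_pair_def reduced_def balanced_def top_part_def mabs_lift_mi max_def)

lemma red_pair_reduced: "red_pair p \<in> reduced"
  using bij_betwE[OF bij_red_pair] by blast

lemma red_pair_balanced: "red_pair p \<in> balanced"
  by (rule reduced_balanced[OF red_pair_reduced])

lemma inj_red_pair: "inj red_pair"
  by (rule bij_betw_imp_inj_on[OF bij_red_pair])

lemma has_sum_reduced_iff:
  fixes f :: "'n::finite pidx \<Rightarrow> complex"
  assumes "\<And>u. u \<notin> reduced \<Longrightarrow> f u = 0"
  shows "(f has_sum S) balanced \<longleftrightarrow> ((\<lambda>p. f (red_pair p)) has_sum S) UNIV"
proof -
  have "(f has_sum S) balanced \<longleftrightarrow> (f has_sum S) reduced"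
    by (rule has_sum_cong_neutral) (use assms reduced_balanced in auto)
  also have "\<dots> \<longleftrightarrow> ((\<lambda>p. f (red_pair p)) has_sum S) UNIV"
    by (rule has_sum_reindex_bij_betw[OF bij_red_pair, symmetric])
  finally show ?thesis .
qed

text \<open>
  On \<open>y = 1\<close> the coordinates \<open>z\<^sub>1, \<dots>, z\<^sub>n\<close> are free and \<open>z\<^sub>0\<close> may be taken
  to be \<open>sqrt (1 + \<bar>z\<bar>\<^sup>2)\<close>.  In a reduced monomial its exponent is \<open>\<bar>\<bar>P\<bar> - \<bar>Q\<bar>\<bar>\<close>, so it depends
  on \<open>P - Q\<close> only and cannot create relations between the monomials.
\<close>

lemma hyperboloid_independence:
  fixes c :: "'n::finite mi \<times> 'n mi \<Rightarrow> complex"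
  assumes x: "\<And>n. pochhammer (1 / (2 * h)) n \<noteq> 0"
    and zero: "\<And>w. ypot w = 1 \<Longrightarrow> ((\<lambda>p. c p * fpair h (red_pair p) w) has_sum 0) UNIV"
  shows "c p = 0"
proof -
  define k where "k p = pochhammer (1 / (2 * h)) (deg (red_pair p)) / of_nat (mfact2 (red_pair p))" for p :: "'n mi \<times> 'n mi"
  have k0: "k p \<noteq> 0" for p using x by (simp add: k_def)
  define b where "b P Q = c (P, Q) * k (P, Q)" for P Q
  define \<rho> where "\<rho> D r = complex_of_real (sqrt (1 + (\<Sum>i\<in>UNIV. (r i)\<^sup>2))) ^ nat \<bar>\<Sum>i\<in>UNIV. D i\<bar>"
    for D :: "'n \<Rightarrow> int" and r :: "'n \<Rightarrow> real"
  have "b P Q = 0" for P Q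
  proof (rule monomial_independence[where \<delta> = 1 and \<rho> = \<rho>])
    fix D :: "'n \<Rightarrow> int" and r :: "'n \<Rightarrow> real"
    have "0 < 1 + (\<Sum>i\<in>UNIV. (r i)\<^sup>2)" by (rule add_pos_nonneg) (auto intro: sum_nonneg)
    then show "\<rho> D r \<noteq> 0" by (simp add: \<rho>_def)
  next
    fix v :: "'n \<Rightarrow> complex"
    define s where "s = sqrt (1 + (\<Sum>i\<in>UNIV. (cmod (v i))\<^sup>2))"
    have s2: "s\<^sup>2 = 1 + (\<Sum>i\<in>UNIV. (cmod (v i))\<^sup>2)"
      unfolding s_def by (rule real_sqrt_pow2, rule add_nonneg_nonneg) (simp_all add: sum_nonneg)
    define w :: "'n pt" where "w = (\<chi> i. case i of None \<Rightarrow> complex_of_real s | Some j \<Rightarrow> v j)"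
    have w: "ypot w = 1" using s2 by (simp add: ypot_def w_def)
    then have wC: "w \<in> Cplus" by (simp add: Cplus_def)
    have "((\<lambda>p. c p * fpair h (red_pair p) w) has_sum 0) UNIV" by (rule zero[OF w])
    moreover have "c p * fpair h (red_pair p) w = (case p of (P, Q) \<Rightarrow>
        b P Q * \<rho> (\<lambda>i. int (P i) - int (Q i)) (\<lambda>i. cmod (v i)) * ((\<Prod>i\<in>UNIV. v i ^ P i) * (\<Prod>i\<in>UNIV. cnj (v i) ^ Q i)))" for p
    proof -
      obtain P Q where p: "p = (P, Q)" by fastforce
      define M where "M = max (mabs P) (mabs Q)"
      have e: "(M - mabs P) + (M - mabs Q) = nat \<bar>\<Sum>i\<in>UNIV. int (P i) - int (Q i)\<bar>"
      proof -
        have "(\<Sum>i\<in>UNIV. int (P i) - int (Q i)) = int (mabs P) - int (mabs Q)"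
          by (simp add: sum_subtractf mabs_def)
        then show ?thesis by (auto simp: M_def max_def)
      qed
      have "zmonom (lift_mi M P) (lift_mi M Q) w = of_real s ^ ((M - mabs P) + (M - mabs Q)) * ((\<Prod>i\<in>UNIV. v i ^ P i) * (\<Prod>i\<in>UNIV. cnj (v i) ^ Q i))"
        by (simp add: zmonom_def prod_UNIV_option w_def power_add mult_ac)
      also have "of_real s ^ ((M - mabs P) + (M - mabs Q)) = \<rho> (\<lambda>i. int (P i) - int (Q i)) (\<lambda>i. cmod (v i))"
        unfolding e by (simp add: \<rho>_def s_def)
      finally have z: "zmonom (lift_mi M P) (lift_mi M Q) w = \<rho> (\<lambda>i. int (P i) - int (Q i)) (\<lambda>i. cmod (v i)) * ((\<Prod>i\<in>UNIV. v i ^ P i) * (\<Prod>i\<in>UNIV. cnj (v i) ^ Q i))" .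
      have rp: "red_pair p = (lift_mi M P, lift_mi M Q)" by (simp add: red_pair_def p M_def)
      have "fpair h (red_pair p) w = k p * zmonom (lift_mi M P) (lift_mi M Q) w"
        using fpair_eq[of "lift_mi M P" "lift_mi M Q" w h] red_pair_balanced[of p] wC w
        by (simp add: rp k_def mfact2_def)
      then show ?thesis by (simp add: p b_def z mult_ac)
    qed
    ultimately show "((\<lambda>(P, Q). b P Q * \<rho> (\<lambda>i. int (P i) - int (Q i)) (\<lambda>i. cmod (v i)) * ((\<Prod>i\<in>UNIV. v i ^ P i) * (\<Prod>i\<in>UNIV. cnj (v i) ^ Q i))) has_sum 0) UNIV"
      by (simp only: split_def)
  qed simp
  then show ?thesis using k0[of p] by (cases p) (auto simp: b_def)
qed

lemma disc_point:
  fixes v :: "complex ^ 'n::finite"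
  assumes "v \<in> disc"
  shows "dproj (hyp_pt (\<lambda>i. v $ i)) = v" "ypot (hyp_pt (\<lambda>i. v $ i)) = 1"
proof -
  have "(norm v)\<^sup>2 = (\<Sum>i\<in>UNIV. (cmod (v $ i))\<^sup>2)"
    unfolding norm_vec_def L2_set_def by (rule real_sqrt_pow2) (auto intro: sum_nonneg)
  then have lt: "(\<Sum>i\<in>UNIV. (cmod (v $ i))\<^sup>2) < 1" using assms by (simp add: disc_def)
  show "ypot (hyp_pt (\<lambda>i. v $ i)) = 1" by (rule ypot_hyp_pt[OF lt])
  show "dproj (hyp_pt (\<lambda>i. v $ i)) = v"
    using lt by (simp add: dproj_def hyp_pt_def vec_eq_iff)
qed

text \<open>
  Two points over the same point of the disc differ by a scalar, and \<open>y = 1\<close> makes it a phase.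
\<close>

lemma same_projection_phase:
  fixes w w' :: "'n::finite pt"
  assumes "ypot w = 1" "ypot w' = 1" "dproj w = dproj w'"
  obtains u where "cmod u = 1" "w' = (\<chi> i. u * w $ i)"
proof -
  have nz: "z $ None \<noteq> 0" if "ypot z = 1" for z :: "'n pt"
  proof
    assume "z $ None = 0"
    then have "ypot z \<le> 0" by (simp add: ypot_def sum_nonneg)
    then show False using that by simp
  qed
  define u where "u = w' $ None / w $ None"
  have "w' $ i = u * w $ i" for i
  proof (cases i)
    case None
    then show ?thesis using nz[OF assms(1)] by (simp add: u_def)
  next
    case (Some j)
    have "dproj w $ j = dproj w' $ j" using assms(3) by simp
    then have "w $ Some j / w $ None = w' $ Some j / w' $ None" by (simp add: dproj_def)
    then show ?thesis using nz[OF assms(1)] nz[OF assms(2)] Some by (simp add: u_def field_simps)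
  qed
  then have eq: "w' = (\<chi> i. u * w $ i)" by (simp add: vec_eq_iff)
  have "(cmod u)\<^sup>2 = 1" using assms(1,2) unfolding eq ypot_scale by simp
  then have "cmod u = 1" using norm_ge_zero[of u] by (simp add: power2_eq_1_iff)
  then show ?thesis using eq by (rule that)
qed

text \<open>
  Balanced monomials are invariant under phases; hence classes can be evaluated at points of the
  disc.
\<close>

lemma series_phase:
  assumes "cmod u = 1"
  shows "series h c (\<chi> i. u * w $ i) = series h c w"
proof -
  define w' where "w' = (\<chi> i. u * w $ i)"
  have y: "ypot w' = ypot w" using assms by (simp add: w'_def ypot_scale)
  have uu: "u * cnj u = 1" using assms by (simp add: complex_norm_square[symmetric])
  have "fpair h t w' = fpair h t w" if t: "t \<in> balanced" for t
  proof (cases "w \<in> Cplus")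
    case True
    obtain A B where AB: "t = (A, B)" by fastforce
    have "mabs A = mabs B" using t by (simp add: AB balanced_def)
    then have "zmonom A B w' = zmonom A B w"
      unfolding w'_def zmonom_scale by (simp add: power_mult_distrib[symmetric] uu)
    moreover have "w' \<in> Cplus" using True y by (simp add: Cplus_def)
    ultimately show ?thesis using True t y by (simp add: AB fpair_eq)
  next
    case False
    then have "w' \<notin> Cplus" using y by (simp add: Cplus_def)
    then show ?thesis using False by (simp add: fpair_outside)
  qed
  then show ?thesis unfolding series_def pairing_def w'_def[symmetric] by (intro infsum_cong) simp
qed

lemma topspace_quotient_topology: "topspace (quotient_topology T q) = q ` topspace T"
proof -
  have "{x \<in> topspace T. q x \<in> q ` topspace T} = topspace T" by auto
  then have "openin (quotient_topology T q) (q ` topspace T)"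
    unfolding openin_quotient_topology by simp
  moreover have "topspace (quotient_topology T q) \<subseteq> q ` topspace T"
    using openin_topspace[of "quotient_topology T q"] unfolding openin_quotient_topology by blast
  ultimately show ?thesis using openin_subset by blast
qed

definition conj_fn :: "'n::finite cfn \<Rightarrow> 'n cfn" where
  "conj_fn a = (\<lambda>w. cnj (a w))"

text \<open>
  Here \<open>x\<close> is the value of \<open>y / (2 h)\<close> on the hyperboloid \<open>y = 1\<close>; that its Pochhammer symbols do not
  vanish is what it means for a nonzero \<open>h\<close> to be allowed.
\<close>

locale allowed_parameter =
  fixes h :: real and H x :: complex
  assumes h: "h \<noteq> 0" and H: "H = of_real h" and x: "x = 1 / (2 * H)"
    and poch: "\<And>n. pochhammer x n \<noteq> 0"
begin

lemma halg_series: "halg H = series H ` (rapid :: ('n::finite pidx \<Rightarrow> complex) set)"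
  by (rule halg_eq)

lemma series_halg [simp]: "c \<in> rapid \<Longrightarrow> series H c \<in> halg H"
  by (simp add: halg_series)

lemma series_reduce:
  assumes "c \<in> rapid" "ypot w = 1"
  shows "series H (reduce x c) w = series H c w"
  unfolding series_def x
  by (rule has_sum_reduce[OF assms(1) poch[unfolded x] level_fpair[OF assms(2)] tame_fpair])

lemma reduced_eqI:
  fixes c d :: "'n::finite pidx \<Rightarrow> complex"
  assumes cd: "c \<in> rapid" "d \<in> rapid" and out: "\<And>u. u \<notin> reduced \<Longrightarrow> c u = 0" "\<And>u. u \<notin> reduced \<Longrightarrow> d u = 0"
    and eq: "\<And>w. ypot w = 1 \<Longrightarrow> series H c w = series H d w"
  shows "c = d"
proof
  fix u :: "'n pidx"
  have z: "(c - d) (red_pair p) = 0" for p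
  proof (rule hyperboloid_independence[of H "\<lambda>p. (c - d) (red_pair p)", OF poch[unfolded x]])
    fix w :: "'n pt" assume w: "ypot w = 1"
    have "series H (c - d) w = 0" using eq[OF w] by (simp add: series_diff[OF cd])
    then have "((\<lambda>t. (c - d) t * fpair H t w) has_sum 0) balanced"
      using summable_pairing[OF rapid_diff[OF cd] tame_fpair, of H w] by (simp add: series_def pairing_def has_sum_iff)
    then show "((\<lambda>p. (c - d) (red_pair p) * fpair H (red_pair p) w) has_sum 0) UNIV"
      by (subst (asm) has_sum_reduced_iff) (simp_all add: out)
  qed
  show "c u = d u"
  proof (cases "u \<in> reduced")
    case True
    then obtain p where "u = red_pair p" using bij_betw_imp_surj_on[OF bij_red_pair] by blast
    then show ?thesis using z[of p] by simp
  qed (simp add: out)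
qed

lemma reduce_zero:
  assumes "c \<in> rapid" "\<And>w. ypot w = 1 \<Longrightarrow> series H c w = 0"
  shows "reduce x c = 0"
  by (rule reduced_eqI[OF reduce_rapid[OF assms(1) poch] rapid_zero])
    (simp_all add: reduce_outside series_reduce assms series_zero)

text \<open>Both sides are reduced families with the same values on \<open>y = 1\<close>.\<close>

lemma reduce_cconj:
  assumes c: "c \<in> rapid"
  shows "reduce x (cconj c) = cconj (reduce x c)"
proof (rule reduced_eqI)
  show "reduce x (cconj c) \<in> rapid" by (rule reduce_rapid[OF cconj_rapid[OF c] poch])
  show "cconj (reduce x c) \<in> rapid" by (rule cconj_rapid[OF reduce_rapid[OF c poch]])
  fix u :: "'a pidx" assume u: "u \<notin> reduced"
  then show "reduce x (cconj c) u = 0" by (rule reduce_outside)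
  have "prod.swap u \<notin> reduced" using u by (auto simp: reduced_def top_part_def min.commute)
  then show "cconj (reduce x c) u = 0" by (simp add: cconj_def reduce_outside)
next
  fix w :: "'a pt" assume w: "ypot w = 1"
  have "series H (reduce x (cconj c)) w = series H (cconj c) w" by (rule series_reduce[OF cconj_rapid[OF c] w])
  also have "\<dots> = cnj (series H c w)" unfolding H by (rule cnj_series[OF h c, symmetric])
  also have "\<dots> = cnj (series H (reduce x c) w)" by (simp add: series_reduce[OF c w])
  also have "\<dots> = series H (cconj (reduce x c)) w"
    unfolding H by (rule cnj_series[OF h]) (rule reduce_rapid[OF c poch])
  finally show "series H (reduce x (cconj c)) w = series H (cconj (reduce x c)) w" .
qed

subsection \<open>The vanishing ideal\<close>

lemma fs_Jideal: "c \<in> rapid \<Longrightarrow> series H c \<in> Jideal H \<longleftrightarrow> (\<forall>w. ypot w = 1 \<longrightarrow> series H c w = 0)"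
  by (simp add: Jideal_def)

text \<open>
  At a point of the hyperboloid, \<open>a \<mapsto> (a * f\<^sub>t) w\<close> is a functional on \<open>y = 1\<close>, so it only
  depends on the reduction of \<open>a\<close>, which is zero for \<open>a\<close> in the vanishing ideal.
\<close>

lemma cprod_Jideal:
  fixes c d :: "'n::finite pidx \<Rightarrow> complex"
  assumes c: "c \<in> rapid" "series H c \<in> Jideal H" and d: "d \<in> rapid"
  shows "series H (cprod c d) \<in> Jideal H"
proof -
  have red0: "reduce x c = 0" using c by (intro reduce_zero) (simp_all add: fs_Jideal)
  have "series H (cprod c d) w = 0" if w: "ypot w = 1" for w
  proof -
    define \<Lambda> where "\<Lambda> = (\<lambda>t. fpair H t w)"
    have \<Lambda>: "level x \<Lambda>" "tame \<Lambda>" unfolding \<Lambda>_def x by (rule level_fpair[OF w], rule tame_fpair)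
    define f where "f s t = c s * d t * pair_mult \<Lambda> s t" for s t
    have f: "((\<lambda>(s, t). f s t) has_sum pairing \<Lambda> (cprod c d)) (balanced \<times> balanced)"
      unfolding f_def by (rule has_sum_pair_mult[OF c(1) d \<Lambda>(2)])
    have "((\<lambda>(t, s). f s t) has_sum pairing \<Lambda> (cprod c d)) (balanced \<times> balanced)"
      using f by (subst has_sum_swap) (simp add: split_def)
    then have "((\<lambda>t. 0) has_sum pairing \<Lambda> (cprod c d)) (balanced :: 'n pidx set)"
    proof (rule has_sum_SigmaD)
      fix t :: "'n pidx" assume t: "t \<in> balanced"
      have "((\<lambda>s. c s * pair_mult \<Lambda> s t) has_sum pairing (\<lambda>s. pair_mult \<Lambda> s t) c) balanced"
        unfolding pairing_def by (rule has_sum_infsum) (rule summable_pairing[OF c(1) tame_pair_mult[OF \<Lambda>(2) t]])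
      also have "pairing (\<lambda>s. pair_mult \<Lambda> s t) c = pairing (\<lambda>s. pair_mult \<Lambda> s t) (reduce x c)"
        by (rule has_sum_reduce[OF c(1) poch level_pair_mult[OF \<Lambda>(1) t] tame_pair_mult[OF \<Lambda>(2) t], symmetric])
      also have "\<dots> = 0" by (simp add: red0 pairing_def)
      finally have "((\<lambda>s. d t * (c s * pair_mult \<Lambda> s t)) has_sum d t * 0) balanced"
        by (rule has_sum_cmult_right)
      then show "((\<lambda>s. (\<lambda>(t, s). f s t) (t, s)) has_sum 0) balanced" by (simp add: f_def mult_ac)
    qed
    then show ?thesis using has_sum_unique[OF _ has_sum_0_simp] by (auto simp: series_def \<Lambda>_def)
  qed
  then show ?thesis by (simp add: fs_Jideal cprod_rapid c(1) d)
qed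

lemma conj_series: "c \<in> rapid \<Longrightarrow> conj_fn (series H c) = series H (cconj c)"
  unfolding conj_fn_def H by (intro ext cnj_series h)

lemma conj_Jideal: "a \<in> Jideal H \<Longrightarrow> conj_fn a \<in> Jideal H"
  unfolding Jideal_def
proof safe
  assume "a \<in> halg H"
  then obtain c where c: "c \<in> rapid" "a = series H c" by (auto simp: halg_series)
  show "conj_fn a \<in> halg H" unfolding c(2) conj_series[OF c(1)] by (rule series_halg[OF cconj_rapid[OF c(1)]])
qed (simp add: conj_fn_def)

lemma hstar_series': "c \<in> rapid \<Longrightarrow> d \<in> rapid \<Longrightarrow> hstar H (series H c) (series H d) = series H (cprod c d)"
  unfolding H by (rule hstar_series[OF h])

lemma star_involution_halg: "star_involution (halg H) (+) cscale (hstar H) (conj_fn :: 'n::finite cfn \<Rightarrow> _)"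
  unfolding star_involution_def
proof (intro conjI ballI allI)
  fix a b :: "'n cfn" assume ab: "a \<in> halg H" "b \<in> halg H"
  obtain c where c: "c \<in> rapid" "a = series H c" using ab(1) by (auto simp: halg_series)
  obtain d where d: "d \<in> rapid" "b = series H d" using ab(2) by (auto simp: halg_series)
  show "conj_fn (a + b) = conj_fn a + conj_fn b" by (simp add: conj_fn_def fun_eq_iff)
  show "conj_fn (hstar H a b) = hstar H (conj_fn b) (conj_fn a)"
    by (simp add: c d hstar_series' conj_series cprod_rapid cconj_rapid cprod_cconj)
next
  fix a :: "'n cfn" assume "a \<in> halg H"
  then show "conj_fn a \<in> halg H" by (auto simp: halg_series conj_series cconj_rapid)
  show "conj_fn (conj_fn a) = a" by (simp add: conj_fn_def)
  fix k show "conj_fn (cscale k a) = cscale (cnj k) (conj_fn a)" by (simp add: conj_fn_def cscale_def)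
qed

lemma Jideal_left:
  assumes a: "a \<in> Jideal H" and b: "b \<in> halg H"
  shows "hstar H a b \<in> Jideal H"
proof -
  have "a \<in> halg H" using a by (simp add: Jideal_def)
  then obtain c where c: "c \<in> rapid" "a = series H c" by (auto simp: halg_series)
  obtain d where d: "d \<in> rapid" "b = series H d" using b by (auto simp: halg_series)
  show ?thesis
    unfolding c(2) d(2) hstar_series'[OF c(1) d(1)]
    by (rule cprod_Jideal[OF c(1) a[unfolded c(2)] d(1)])
qed

text \<open>
  Conjugation reverses products and preserves the ideal, so multiplication from the left reduces to
  multiplication from the right.
\<close>

lemma Jideal_right:
  assumes a: "a \<in> Jideal H" and b: "b \<in> halg H"
  shows "hstar H b a \<in> Jideal H"
proof -
  note inv = star_involution_halg[unfolded star_involution_def]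
  have ah: "a \<in> halg H" using a by (simp add: Jideal_def)
  have "hstar H b a \<in> halg H" using ah b by (auto simp: halg_series hstar_series' cprod_rapid)
  then have "hstar H b a = conj_fn (hstar H (conj_fn a) (conj_fn b))" using inv ah b by metis
  then show ?thesis using Jideal_left[OF conj_Jideal[OF a]] conj_Jideal inv b by metis
qed

lemma halg_closed:
  assumes "a \<in> halg H" "b \<in> halg H"
  shows "a + b \<in> halg H" "a - b \<in> halg H" "cscale k a \<in> halg H" "conj_fn a \<in> halg H" "hstar H a b \<in> halg H"
  using assms unfolding halg_series
  by (auto simp: series_add[symmetric] series_diff[symmetric] series_scale[symmetric] conj_series hstar_series'
      intro!: imageI rapid_add rapid_diff rapid_scale cconj_rapid cprod_rapid)

lemma zero_halg: "0 \<in> halg H"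
  using series_halg[OF rapid_zero] by (simp add: series_zero)

lemma Jideal_closed:
  assumes "a \<in> Jideal H" "b \<in> Jideal H"
  shows "a + b \<in> Jideal H" "a - b \<in> Jideal H" "cscale k a \<in> Jideal H"
  using assms halg_closed[of a b] by (auto simp: Jideal_def cscale_def)

lemma zero_Jideal: "0 \<in> Jideal H"
  by (simp add: Jideal_def zero_halg)

lemma star_ideal_Jideal: "star_ideal (halg H) (hstar H) conj_fn (Jideal H)"
  unfolding star_ideal_def cfun.subspace_def
  by (auto simp: Jideal_left Jideal_right conj_Jideal Jideal_closed zero_Jideal) (simp add: Jideal_def)

lemma hnorm_conj: "a \<in> halg H \<Longrightarrow> hnorm H \<epsilon> (conj_fn a) = hnorm H \<epsilon> a"
  by (auto simp: halg_series conj_series) (simp add: H hnorm_series[OF h] cconj_rapid rnorm_cconj)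

lemma continuous_conj: "continuous_map (htop H) (htop H) (conj_fn :: 'n::finite cfn \<Rightarrow> _)"
  unfolding continuous_map_def
proof (intro conjI allI impI)
  show "conj_fn \<in> topspace (htop H) \<rightarrow> topspace (htop H)"
    using halg_closed(4) by (auto simp: H topspace_htop[OF h])
  fix U :: "'n cfn set" assume U: "openin (htop H) U"
  show "openin (htop H) {a \<in> topspace (htop H). conj_fn a \<in> U}"
    unfolding H
  proof (rule openin_htopI[OF h])
    fix c :: "'n pidx \<Rightarrow> complex" assume c: "c \<in> rapid" and "series (of_real h) c \<in> {a \<in> topspace (htop (of_real h)). conj_fn a \<in> U}"
    then have "series (of_real h) (cconj c) \<in> U" using conj_series[OF c] by (simp add: H)
    then obtain \<epsilon> r where \<epsilon>: "0 < \<epsilon>" "\<epsilon> < 1" "0 < r"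
      and d: "\<And>d. d \<in> rapid \<Longrightarrow> rnorm \<epsilon> (d - cconj c) < r \<Longrightarrow> series (of_real h) d \<in> U"
      using openin_htop_imp[OF h U[unfolded H] cconj_rapid[OF c]] by blast
    have "series (of_real h) d \<in> {a \<in> topspace (htop (of_real h)). conj_fn a \<in> U}" if "d \<in> rapid" "rnorm \<epsilon> (d - c) < r" for d
    proof -
      have "cconj d - cconj c = cconj (d - c)" by (simp add: cconj_def fun_eq_iff)
      then have "rnorm \<epsilon> (cconj d - cconj c) < r" using that(2) by (simp add: rnorm_cconj)
      then have "series (of_real h) (cconj d) \<in> U" by (rule d[OF cconj_rapid[OF that(1)]])
      then show ?thesis using conj_series[OF that(1)] that(1) by (simp add: H topspace_htop[OF h] halg_eq)
    qed
    then show "\<exists>\<epsilon> r. 0 < \<epsilon> \<and> \<epsilon> < 1 \<and> 0 < r \<and> (\<forall>d\<in>rapid. rnorm \<epsilon> (d - c) < r \<longrightarrow> series (of_real h) d \<in> {a \<in> topspace (htop (of_real h)). conj_fn a \<in> U})"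
      using \<epsilon> by blast
  qed (auto simp: topspace_htop[OF h])
qed

end

lemma continuous_map_quotient: "continuous_map T (quotient_topology T q) q"
  by (auto simp: continuous_map_def topspace_quotient_topology openin_quotient_topology)

lemma continuous_map_from_quotient:
  assumes "continuous_map T Y (\<lambda>a. f (q a))"
  shows "continuous_map (quotient_topology T q) Y f"
  unfolding continuous_map_def
proof (intro conjI allI impI)
  show "f \<in> topspace (quotient_topology T q) \<rightarrow> topspace Y"
    using assms by (auto simp: continuous_map_def topspace_quotient_topology)
  fix U assume "openin Y U"
  then have "openin T {a \<in> topspace T. f (q a) \<in> U}" using assms by (simp add: continuous_map_def)
  moreover have "{a \<in> topspace T. q a \<in> {X \<in> topspace (quotient_topology T q). f X \<in> U}} = {a \<in> topspace T. f (q a) \<in> U}"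
    by (auto simp: topspace_quotient_topology)
  ultimately show "openin (quotient_topology T q) {X \<in> topspace (quotient_topology T q). f X \<in> U}"
    unfolding openin_quotient_topology by (auto simp: topspace_quotient_topology)
qed

definition schauder_sum :: "complex \<Rightarrow> ('n::finite mi \<times> 'n mi \<Rightarrow> complex) \<Rightarrow> ('n mi \<times> 'n mi) set \<Rightarrow> 'n cfn" where
  "schauder_sum h d F = (\<Sum>(P, Q)\<in>F. cscale (d (P, Q)) (fbas h (P, Q, max (mabs P) (mabs Q))))"

lemma schauder_sum_apply: "schauder_sum h d F w = (\<Sum>p\<in>F. d p * fpair h (red_pair p) w)"
  unfolding schauder_sum_def sum_fun_apply
  by (rule sum.cong) (auto simp: cscale_def fpair_def triple_of_red_pair)

lemma schauder_sum_series:
  assumes "finite F"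
  shows "schauder_sum h (\<lambda>p. c (red_pair p)) F = series h (restrict_coef (red_pair ` F) c)"
proof -
  have "red_pair ` F \<subseteq> balanced" using red_pair_balanced by blast
  then have "series h (restrict_coef (red_pair ` F) c) = (\<lambda>w. \<Sum>t\<in>red_pair ` F. c t * fpair h t w)"
    using assms by (intro series_restrict_coef) auto
  also have "\<dots> = schauder_sum h (\<lambda>p. c (red_pair p)) F"
    by (simp add: fun_eq_iff schauder_sum_apply sum.reindex[OF inj_on_subset[OF inj_red_pair subset_UNIV]])
  finally show ?thesis by simp
qed

context allowed_parameter
begin

lemma mem_cls: "b \<in> cls H a \<longleftrightarrow> a \<in> halg H \<and> b \<in> halg H \<and> a - b \<in> Jideal H"
  by (simp add: cls_def jrel_def)

lemma self_cls: "a \<in> halg H \<Longrightarrow> a \<in> cls H a"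
  by (simp add: mem_cls zero_Jideal)

lemma cls_eqI:
  fixes a b :: "'n::finite cfn"
  assumes ab: "a \<in> halg H" "b \<in> halg H" "a - b \<in> Jideal H"
  shows "cls H a = cls H b"
proof -
  have "a - c \<in> Jideal H \<longleftrightarrow> b - c \<in> Jideal H" for c
    using Jideal_closed(1)[OF ab(3), of "b - c"] Jideal_closed(2)[OF _ ab(3), of "a - c"] by auto
  then show ?thesis using ab by (auto simp: mem_cls)
qed

lemma UN_cls:
  assumes "a \<in> halg H" "\<And>b. b \<in> cls H a \<Longrightarrow> G b = Z"
  shows "(\<Union>b\<in>cls H a. G b) = Z"
  using assms self_cls by blast

lemma qalg_cls: "qalg H = cls H ` halg H"
  by (auto simp: qalg_def quotient_def cls_def)

text \<open>
  Products of representatives depend on the classes only, by this telescoping and the ideal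
  property.
\<close>

lemma hstar_diff:
  assumes "a \<in> halg H" "b \<in> halg H" "a' \<in> halg H" "b' \<in> halg H"
  shows "hstar H a b - hstar H a' b' = hstar H (a - a') b + hstar H a' (b - b')"
proof -
  obtain c where c: "c \<in> rapid" "a = series H c" using assms(1) by (auto simp: halg_series)
  obtain d where d: "d \<in> rapid" "b = series H d" using assms(2) by (auto simp: halg_series)
  obtain c' where c': "c' \<in> rapid" "a' = series H c'" using assms(3) by (auto simp: halg_series)
  obtain d' where d': "d' \<in> rapid" "b' = series H d'" using assms(4) by (auto simp: halg_series)
  have "hstar H (a - a') b = series H (cprod c d) - series H (cprod c' d)"
    unfolding c(2) c'(2) d(2) series_diff[OF c(1) c'(1), symmetric] hstar_series'[OF rapid_diff[OF c(1) c'(1)] d(1)]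
    by (simp add: cprod_diff_left[OF h] series_diff cprod_rapid c(1) c'(1) d(1))
  moreover have "hstar H a' (b - b') = series H (cprod c' d) - series H (cprod c' d')"
    unfolding d(2) c'(2) d'(2) series_diff[OF d(1) d'(1), symmetric] hstar_series'[OF c'(1) rapid_diff[OF d(1) d'(1)]]
    by (simp add: cprod_diff_right[OF h] series_diff cprod_rapid d(1) c'(1) d'(1))
  ultimately show ?thesis by (simp add: c d c' d' hstar_series')
qed

lemma qadd_cls:
  assumes a: "a \<in> halg H" and b: "b \<in> halg H"
  shows "qadd H (cls H a) (cls H b) = cls H (a + b)"
  unfolding qadd_def
proof (intro UN_cls a b)
  fix a' b' assume "a' \<in> cls H a" "b' \<in> cls H b"
  then have *: "a' \<in> halg H" "b' \<in> halg H" "a - a' \<in> Jideal H" "b - b' \<in> Jideal H" by (auto simp: mem_cls)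
  have "(a + b) - (a' + b') \<in> Jideal H" using Jideal_closed(1)[OF *(3,4)] by (simp add: algebra_simps)
  then show "cls H (a' + b') = cls H (a + b)"
    by (intro cls_eqI[symmetric] halg_closed a b *)
qed

lemma qscale_cls:
  assumes a: "a \<in> halg H"
  shows "qscale H k (cls H a) = cls H (cscale k a)"
  unfolding qscale_def
proof (intro UN_cls a)
  fix a' assume "a' \<in> cls H a"
  then have *: "a' \<in> halg H" "a - a' \<in> Jideal H" by (auto simp: mem_cls)
  have "cscale k a - cscale k a' = cscale k (a - a')" by (simp add: cscale_def fun_eq_iff algebra_simps)
  then have "cscale k a - cscale k a' \<in> Jideal H" using Jideal_closed(3)[OF *(2,2)] by simp
  then show "cls H (cscale k a') = cls H (cscale k a)"
    by (intro cls_eqI[symmetric] halg_closed(3)[OF a a] halg_closed(3)[OF *(1,1)])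
qed

lemma qstar_cls:
  assumes a: "a \<in> halg H" and b: "b \<in> halg H"
  shows "qstar H (cls H a) (cls H b) = cls H (hstar H a b)"
  unfolding qstar_def
proof (intro UN_cls a b)
  fix a' b' assume "a' \<in> cls H a" "b' \<in> cls H b"
  then have *: "a' \<in> halg H" "b' \<in> halg H" "a - a' \<in> Jideal H" "b - b' \<in> Jideal H" by (auto simp: mem_cls)
  have "hstar H a b - hstar H a' b' \<in> Jideal H"
    unfolding hstar_diff[OF a b *(1,2)]
    by (rule Jideal_closed(1)[OF Jideal_left[OF *(3) b] Jideal_right[OF *(4) *(1)]])
  then show "cls H (hstar H a' b') = cls H (hstar H a b)"
    by (intro cls_eqI[symmetric] halg_closed(5)[OF a b] halg_closed(5)[OF *(1,2)])
qed

text \<open>The classes in the union coincide by \<open>qconj_cls\<close>.\<close>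

definition qconj :: "'n::finite cfn set \<Rightarrow> 'n cfn set" where
  "qconj X = (\<Union>a\<in>X. cls H (conj_fn a))"

lemma qconj_cls:
  assumes a: "a \<in> halg H"
  shows "qconj (cls H a) = cls H (conj_fn a)"
  unfolding qconj_def
proof (intro UN_cls a)
  fix a' assume "a' \<in> cls H a"
  then have *: "a' \<in> halg H" "a - a' \<in> Jideal H" by (auto simp: mem_cls)
  have "conj_fn a - conj_fn a' = conj_fn (a - a')" by (simp add: conj_fn_def fun_eq_iff)
  then have "conj_fn a - conj_fn a' \<in> Jideal H" using conj_Jideal[OF *(2)] by simp
  then show "cls H (conj_fn a') = cls H (conj_fn a)"
    by (intro cls_eqI[symmetric] halg_closed(4)[OF a a] halg_closed(4)[OF *(1,1)])
qed

lemma star_involution_qalg: "star_involution (qalg H) (qadd H) (qscale H) (qstar H) (qconj :: 'n::finite cfn set \<Rightarrow> _)"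
proof -
  note inv = star_involution_halg[where 'n = 'n, unfolded star_involution_def]
  have closed: "conj_fn a \<in> halg H" if "a \<in> halg H" for a :: "'n cfn" using halg_closed(4)[OF that that] .
  show ?thesis
    unfolding star_involution_def
  proof (intro conjI ballI allI)
    fix X Y :: "'n cfn set" assume "X \<in> qalg H" "Y \<in> qalg H"
    then obtain a b where ab: "a \<in> halg H" "X = cls H a" "b \<in> halg H" "Y = cls H b" by (auto simp: qalg_cls)
    have "conj_fn (a + b) = conj_fn a + conj_fn b" using inv ab by blast
    then show "qconj (qadd H X Y) = qadd H (qconj X) (qconj Y)"
      by (simp add: ab qadd_cls qconj_cls closed halg_closed)
    have "conj_fn (hstar H a b) = hstar H (conj_fn b) (conj_fn a)" using inv ab by blast
    then show "qconj (qstar H X Y) = qstar H (qconj Y) (qconj X)"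
      by (simp add: ab qstar_cls qconj_cls closed halg_closed)
  next
    fix X :: "'n cfn set" and k assume "X \<in> qalg H"
    then obtain a where a: "a \<in> halg H" "X = cls H a" by (auto simp: qalg_cls)
    show "qconj X \<in> qalg H" using a closed[OF a(1)] by (simp add: qconj_cls qalg_cls)
    have "conj_fn (conj_fn a) = a" using inv a by blast
    then show "qconj (qconj X) = X" by (simp add: a qconj_cls closed)
    have "conj_fn (cscale k a) = cscale (cnj k) (conj_fn a)" using inv a by blast
    then show "qconj (qscale H k X) = qscale H (cnj k) (qconj X)"
      by (simp add: a qconj_cls qscale_cls closed halg_closed(3)[OF a(1) a(1)])
  qed
qed

lemma topspace_htop': "topspace (htop H) = (halg H :: 'n::finite cfn set)"
  unfolding H by (rule topspace_htop[OF h])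

lemma continuous_cls: "continuous_map (htop H) (qtop H) (cls H :: 'n::finite cfn \<Rightarrow> _)"
  unfolding qtop_def by (rule continuous_map_quotient)

lemma continuous_qconj: "continuous_map (qtop H) (qtop H) (qconj :: 'n::finite cfn set \<Rightarrow> _)"
proof -
  have "continuous_map (htop H) (qtop H) (cls H \<circ> (conj_fn :: 'n cfn \<Rightarrow> _))"
    by (rule continuous_map_compose[OF continuous_conj continuous_cls])
  then have "continuous_map (htop H) (qtop H) (\<lambda>a :: 'n cfn. qconj (cls H a))"
    by (rule continuous_map_eq) (simp add: topspace_htop' qconj_cls)
  then show ?thesis by (subst (1) qtop_def) (rule continuous_map_from_quotient)
qed

lemma cls_value:
  assumes "b \<in> cls H a" "ypot w = 1"
  shows "b w = a w"
  using assms by (auto simp: mem_cls Jideal_def)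

lemma qeval_cls:
  fixes v :: "complex ^ 'n::finite"
  assumes a: "a \<in> halg H" and v: "v \<in> disc"
  shows "qeval (cls H a) v = a (hyp_pt (\<lambda>i. v $ i))"
  unfolding qeval_def
proof (rule the_equality)
  note p = disc_point[OF v]
  show "\<forall>b\<in>cls H a. \<forall>w. dproj w = v \<and> ypot w = 1 \<longrightarrow> b w = a (hyp_pt (\<lambda>i. v $ i))"
  proof (intro ballI allI impI; elim conjE)
    fix b w assume b: "b \<in> cls H a" and w: "dproj w = v" "ypot w = 1"
    obtain u where u: "cmod u = 1" "w = (\<chi> i. u * hyp_pt (\<lambda>i. v $ i) $ i)"
      by (rule same_projection_phase[OF p(2) w(2)]) (simp_all add: p w)
    obtain c where c: "a = series H c" using a by (auto simp: halg_series)
    have "b w = series H c w" using cls_value[OF b w(2)] c by simp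
    also have "\<dots> = a (hyp_pt (\<lambda>i. v $ i))" unfolding c u(2) by (rule series_phase[OF u(1)])
    finally show "b w = a (hyp_pt (\<lambda>i. v $ i))" .
  qed
  show "c = a (hyp_pt (\<lambda>i. v $ i))" if "\<forall>b\<in>cls H a. \<forall>w. dproj w = v \<and> ypot w = 1 \<longrightarrow> b w = c" for c
    using that self_cls[OF a] p by metis
qed

lemma qeval_qconj:
  assumes "X \<in> qalg H" "v \<in> disc"
  shows "qeval (qconj X) v = cnj (qeval X v)"
proof -
  obtain a where a: "a \<in> halg H" "X = cls H a" using assms(1) by (auto simp: qalg_cls)
  show ?thesis using assms(2) halg_closed(4)[OF a(1) a(1)]
    by (simp add: a qconj_cls qeval_cls) (simp add: conj_fn_def)
qed

subsection \<open>Schauder coefficients\<close>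

text \<open>
  Truncations converge in the completion, and the projection to the quotient is continuous.  Index
  sets of pairs \<open>(P, Q)\<close> are compared with arbitrary finite index sets by adding indices on which
  \<open>c\<close> vanishes.
\<close>

lemma limitin_schauder_sum:
  fixes c :: "'n::finite pidx \<Rightarrow> complex"
  assumes c: "c \<in> rapid" and out: "\<And>u. u \<notin> reduced \<Longrightarrow> c u = 0"
  shows "limitin (qtop H) (\<lambda>F. cls H (schauder_sum H (\<lambda>p. c (red_pair p)) F)) (cls H (series H c)) (finite_subsets_at_top UNIV)"
proof -
  have fin: "\<forall>\<^sub>F F in finite_subsets_at_top (UNIV :: ('n mi \<times> 'n mi) set). finite F"
    by (rule eventually_finite_subsets_at_top_weakI)
  have "limitin (htop H) (\<lambda>F. series H (restrict_coef (red_pair ` F) c)) (series H c) (finite_subsets_at_top UNIV)"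
    unfolding H
  proof (rule limitin_series[OF h c])
    show "\<forall>\<^sub>F F in finite_subsets_at_top UNIV. restrict_coef (red_pair ` F) c \<in> rapid"
      by (rule always_eventually) (simp add: restrict_coef_rapid c)
    fix \<epsilon> e :: real assume \<epsilon>: "0 < \<epsilon>" "\<epsilon> < 1" and e: "0 < e"
    obtain F0 where F0: "finite F0" "F0 \<subseteq> balanced" "\<And>F. F0 \<subseteq> F \<Longrightarrow> rnorm \<epsilon> (restrict_coef F c - c) \<le> e / 2"
      using rnorm_restrict_coef[OF c \<epsilon>, of "e / 2"] e by auto
    show "\<forall>\<^sub>F F in finite_subsets_at_top UNIV. rnorm \<epsilon> (restrict_coef (red_pair ` F) c - c) < e"
      unfolding eventually_finite_subsets_at_top
    proof (intro exI[of _ "red_pair -` F0"] conjI allI impI; (elim conjE)?)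
      show "finite (red_pair -` F0)" by (rule finite_vimageI[OF F0(1) inj_red_pair])
      fix F :: "('n mi \<times> 'n mi) set" assume F: "red_pair -` F0 \<subseteq> F"
      have "restrict_coef (red_pair ` F) c = restrict_coef (red_pair ` F \<union> (F0 - reduced)) c"
        using out by (auto simp: restrict_coef_def fun_eq_iff)
      moreover have "F0 \<subseteq> red_pair ` F \<union> (F0 - reduced)"
      proof
        fix u assume u: "u \<in> F0"
        show "u \<in> red_pair ` F \<union> (F0 - reduced)"
        proof (cases "u \<in> reduced")
          case True
          then obtain p where p: "u = red_pair p" using bij_betw_imp_surj_on[OF bij_red_pair] by blast
          then have "p \<in> F" using u F by auto
          then show ?thesis using p by simp
        qed (simp add: u)
      qed
      ultimately show "rnorm \<epsilon> (restrict_coef (red_pair ` F) c - c) < e"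
        using F0(3)[of "red_pair ` F \<union> (F0 - reduced)"] e by simp
    qed simp
  qed
  then have "limitin (qtop H) (cls H \<circ> (\<lambda>F. series H (restrict_coef (red_pair ` F) c))) (cls H (series H c)) (finite_subsets_at_top UNIV)"
    by (rule continuous_map_limit[OF continuous_cls])
  then show ?thesis
    by (rule limitin_transform_eventually[rotated]) (rule eventually_mono[OF fin], simp add: schauder_sum_series)
qed

text \<open>
  The value at a point with \<open>y = 1\<close> is a continuous function of the class, so convergence of the
  expansion in the quotient topology yields pointwise convergence.  This is what makes Schauder
  coefficients unique.
\<close>

lemma schauder_values:
  fixes c :: "'n::finite pidx \<Rightarrow> complex"
  assumes c: "c \<in> rapid" and w: "ypot w = 1"
    and lim: "limitin (qtop H) (\<lambda>F. cls H (schauder_sum H d F)) (cls H (series H c)) (finite_subsets_at_top UNIV)"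
  shows "((\<lambda>p. d p * fpair H (red_pair p) w) has_sum series H c w) UNIV"
  unfolding has_sum_def
proof (rule topological_tendstoI)
  fix V assume V: "open V" "series H c w \<in> V"
  define U where "U = {X \<in> qalg H. \<forall>a\<in>X. a w \<in> V}"
  have clsU: "cls H a \<in> U \<longleftrightarrow> a w \<in> V" if "a \<in> halg H" for a :: "'n cfn"
  proof
    show "a w \<in> V" if "cls H a \<in> U" using that self_cls[OF \<open>a \<in> halg H\<close>] by (simp add: U_def)
    assume "a w \<in> V"
    then have "\<forall>b\<in>cls H a. b w \<in> V" by (intro ballI) (simp add: cls_value[OF _ w])
    then show "cls H a \<in> U" using that by (simp add: U_def qalg_cls)
  qed
  have "{a \<in> topspace (htop H). cls H a \<in> U} = {a \<in> halg H. a w \<in> V}"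
    unfolding topspace_htop' by (rule Collect_cong, rule conj_cong[OF refl], rule clsU)
  moreover have "openin (htop H) {a \<in> halg H. a w \<in> V}"
    unfolding H by (rule openin_eval_preimage[OF h V(1)])
  moreover have "U \<subseteq> cls H ` topspace (htop H)" unfolding topspace_htop' U_def qalg_cls by (rule Collect_restrict)
  ultimately have "openin (qtop H) U" unfolding qtop_def openin_quotient_topology by simp
  moreover have "cls H (series H c) \<in> U" using clsU[OF series_halg[OF c]] V(2) by simp
  ultimately have "\<forall>\<^sub>F F in finite_subsets_at_top UNIV. cls H (schauder_sum H d F) \<in> U"
    using lim by (simp add: limitin_def)
  moreover have "\<forall>\<^sub>F F in finite_subsets_at_top (UNIV :: ('n mi \<times> 'n mi) set). finite F"
    by (rule eventually_finite_subsets_at_top_weakI)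
  ultimately show "\<forall>\<^sub>F F in finite_subsets_at_top UNIV. (\<Sum>p\<in>F. d p * fpair H (red_pair p) w) \<in> V"
  proof eventually_elim
    case (elim F)
    have "d = (\<lambda>p. (d \<circ> inv red_pair) (red_pair p))" by (simp add: fun_eq_iff inj_red_pair)
    then have "schauder_sum H d F = series H (restrict_coef (red_pair ` F) (d \<circ> inv red_pair))"
      using schauder_sum_series[OF elim(2), of H "d \<circ> inv red_pair"] by simp
    moreover have "red_pair ` F \<subseteq> balanced" using red_pair_balanced by blast
    ultimately have "schauder_sum H d F \<in> halg H"
      using elim(2) by (simp add: restrict_coef_finite_rapid)
    then show ?case using elim(1) clsU by (simp add: schauder_sum_apply)
  qed
qed

lemma cls_reduce: "c \<in> rapid \<Longrightarrow> cls H (series H (reduce x c)) = cls H (series H c)"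
  using reduce_rapid[OF _ poch, of c]
  by (intro cls_eqI series_halg) (auto simp: Jideal_def series_reduce halg_closed)

text \<open>
  The reduction gives an expansion, and two expansions of a class have the same values on \<open>y = 1\<close>.
\<close>

lemma qcoef_cls:
  fixes c :: "'n::finite pidx \<Rightarrow> complex"
  assumes c: "c \<in> rapid"
  shows "qcoef H (cls H (series H c)) = (\<lambda>p. reduce x c (red_pair p))"
  unfolding qcoef_def schauder_sum_def[symmetric]
proof (rule the_equality)
  show ex: "limitin (qtop H) (\<lambda>F. cls H (schauder_sum H (\<lambda>p. reduce x c (red_pair p)) F)) (cls H (series H c)) (finite_subsets_at_top UNIV)"
    using limitin_schauder_sum[OF reduce_rapid[OF c poch] reduce_outside] cls_reduce[OF c] by simp
  fix d assume d: "limitin (qtop H) (\<lambda>F. cls H (schauder_sum H d F)) (cls H (series H c)) (finite_subsets_at_top UNIV)"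
  show "d = (\<lambda>p. reduce x c (red_pair p))"
  proof
    fix p
    have "d p - reduce x c (red_pair p) = 0"
    proof (rule hyperboloid_independence[of H "\<lambda>p. d p - reduce x c (red_pair p)", OF poch[unfolded x]])
      fix w :: "'n pt" assume w: "ypot w = 1"
      have "((\<lambda>p. d p * fpair H (red_pair p) w - reduce x c (red_pair p) * fpair H (red_pair p) w) has_sum (series H c w - series H c w)) UNIV"
        using has_sum_add[OF schauder_values[OF c w d] has_sum_uminusI[OF schauder_values[OF c w ex]]] by simp
      then show "((\<lambda>p. (d p - reduce x c (red_pair p)) * fpair H (red_pair p) w) has_sum 0) UNIV"
        by (simp add: algebra_simps)
    qed
    then show "d p = reduce x c (red_pair p)" by simp
  qed
qed

lemma qnorm_qconj:
  fixes X :: "'n::finite cfn set"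
  assumes X: "X \<in> qalg H"
  shows "qnorm H \<epsilon> (qconj X) = qnorm H \<epsilon> X"
proof -
  obtain c where c: "c \<in> rapid" "X = cls H (series H c)" using X by (auto simp: qalg_cls halg_series)
  have coef: "qcoef H (qconj X) p = cnj (qcoef H X (prod.swap p))" for p :: "'n mi \<times> 'n mi"
  proof -
    have "qcoef H (qconj X) p = reduce x (cconj c) (red_pair p)"
      by (simp add: c qconj_cls conj_series qcoef_cls cconj_rapid)
    also have "\<dots> = cnj (reduce x c (prod.swap (red_pair p)))" by (simp add: reduce_cconj[OF c(1)] cconj_def)
    also have "prod.swap (red_pair p) = red_pair (prod.swap p)" by (simp add: red_pair_def max.commute)
    finally show ?thesis by (simp add: c qcoef_cls)
  qed
  define g where "g = (\<lambda>(P, Q). cmod (qcoef H X (P, Q)) / fact (max (mabs P) (mabs Q)) powr \<epsilon>)"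
  have "(\<lambda>(P, Q). cmod (qcoef H (qconj X) (P, Q)) / fact (max (mabs P) (mabs Q)) powr \<epsilon>) = g \<circ> prod.swap"
    by (auto simp: g_def coef max.commute)
  then have "qnorm H \<epsilon> (qconj X) = (SUP p. (g \<circ> prod.swap) p)" by (simp add: qnorm_def)
  also have "range (g \<circ> prod.swap) = range g" by (metis image_comp surj_swap)
  finally show ?thesis by (simp add: qnorm_def g_def)
qed

end

theorem proposition5p20:
  fixes h :: complex
  assumes "h \<in> \<real>"
    and "2 * h \<notin> insert 0 {- 1 / of_nat k | k. k \<ge> 1}"
  shows "\<exists>\<sigma> :: 'n::finite cfn \<Rightarrow> 'n cfn.
    (star_involution (halg h) (+) cscale (hstar h) \<sigma> \<and>
     continuous_map (htop h) (htop h) \<sigma> \<and>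
     (\<forall>a\<in>alg h. \<sigma> a = (\<lambda>w. cnj (a w))) \<and>
     (\<forall>\<epsilon> a. 0 < \<epsilon> \<and> \<epsilon> < 1 \<and> a \<in> halg h \<longrightarrow> hnorm h \<epsilon> (\<sigma> a) = hnorm h \<epsilon> a)) \<and>
    star_ideal (halg h) (hstar h) \<sigma> (Jideal h) \<and>
    (\<exists>\<tau>. (\<forall>a\<in>halg h. \<tau> (cls h a) = cls h (\<sigma> a)) \<and>
       star_involution (qalg h) (qadd h) (qscale h) (qstar h) \<tau> \<and>
       continuous_map (qtop h) (qtop h) \<tau> \<and>
       (\<forall>X\<in>qalg h. \<forall>v\<in>disc. qeval (\<tau> X) v = cnj (qeval X v)) \<and>
       (\<forall>\<epsilon> X. 0 < \<epsilon> \<and> \<epsilon> < 1 \<and> X \<in> qalg h \<longrightarrow> qnorm h \<epsilon> (\<tau> X) = qnorm h \<epsilon> X))"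
proof -
  obtain \<eta> where \<eta>: "h = of_real \<eta>" using assms(1) by (rule Reals_cases)
  have h0: "h \<noteq> 0" using assms(2) by auto
  interpret allowed_parameter \<eta> h "1 / (2 * h)"
  proof
    show "\<eta> \<noteq> 0" using h0 \<eta> by simp
    show "pochhammer (1 / (2 * h)) n \<noteq> 0" for n
    proof
      assume "pochhammer (1 / (2 * h)) n = 0"
      then obtain k where k: "1 / (2 * h) = - of_nat k" by (auto simp: pochhammer_eq_0_iff)
      then have "k \<noteq> 0" using h0 by (cases "k = 0") auto
      have "2 * h = 1 / (1 / (2 * h))" by simp
      then have "2 * h = - 1 / of_nat k" unfolding k by simp
      then show False using assms(2) \<open>k \<noteq> 0\<close> by auto
    qed
  qed (simp_all add: \<eta>)
  show ?thesis
  proof (rule exI[of _ conj_fn], intro conjI)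
    show "\<exists>\<tau>. (\<forall>a\<in>halg h. \<tau> (cls h a) = cls h (conj_fn a :: 'n cfn)) \<and>
       star_involution (qalg h) (qadd h) (qscale h) (qstar h) \<tau> \<and>
       continuous_map (qtop h) (qtop h) \<tau> \<and>
       (\<forall>X\<in>qalg h. \<forall>v\<in>disc. qeval (\<tau> X) v = cnj (qeval X v)) \<and>
       (\<forall>\<epsilon> X. 0 < \<epsilon> \<and> \<epsilon> < 1 \<and> X \<in> qalg h \<longrightarrow> qnorm h \<epsilon> (\<tau> X) = qnorm h \<epsilon> X)"
      by (rule exI[of _ qconj])
        (simp add: qconj_cls star_involution_qalg continuous_qconj qeval_qconj qnorm_qconj)
  qed (simp_all add: star_involution_halg continuous_conj star_ideal_Jideal hnorm_conj, simp add: conj_fn_def)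
qed

end
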